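(* Let $H$ be an $(n-1)\times n$ matrix with entries in $\mathbb Q$, all of whose submatrices have maximal rank. Let $m_1,\dots,m_n,r_1,\dots,r_{n-1}$ be pairwise coprime positive integers, with all $r_j$ odd. Then the germ $f\colon(\mathbb C^n,0)\to(\mathbb C^{2n-1},0)$ given by $$x\mapsto\bigl(x_1^{m_1},\dots,x_n^{m_n},(Hx)_1^{r_1},\dots,(Hx)_{n-1}^{r_{n-1}}\bigr)$$ is $\mathcal A$-finite.
   Context: Here $(Hx)_i$ is the $i$th entry of $Hx$. "All submatrices have maximal rank" means that every submatrix (obtained by choosing any nonempty set of rows and any nonempty set of columns) of size $a\times b$ has rank $\min(a,b)$. "Pairwise coprime" means that any two members of the list $m_1,\dots,m_n,r_1,\dots,r_{n-1}$ (with different positions in the list) are coprime. Two (multi-)germs $f,f'$ are $\mathcal A$-equivalent if $f'=\psi\circ f\circ\phi$ for germs of biholomorphisms $\phi,\psi$ of source and target. An unfolding of a (multi-)germ $f\colon(\mathbb C^n,S)\to(\mathbb C^p,0)$ is a (multi-)germ $F(t,x)=(t,f_t(x))\colon(\mathbb C^{r}\times\mathbb C^n,\{0\}\times S)\to(\mathbb C^{r}\times\mathbb C^p,0)$ with $f_0=f$. It is trivial if it is $\mathcal A$-equivalent to $\mathrm{id}_{\mathbb C^r}\times f$ via biholomorphisms that are themselves unfoldings of the identities of $\mathbb C^n$ and $\mathbb C^p$. A (multi-)germ is stable if each of its unfoldings is trivial. A finite germ $f\colon(\mathbb C^n,0)\to(\mathbb C^p,0)$ is $\mathcal A$-finite if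 it has a small representative for which stability fails at most over the origin, i.e. the multi-germ of the representative at $f^{-1}(y)$ is stable for all $y\ne0$. *)

theory Defs
  imports
    "HOL-Analysis.Analysis"
    "Jordan_Normal_Form.DL_Rank"
    "Jordan_Normal_Form.DL_Submatrix"
begin

no_notation vec_nth (infixl \<open>$\<close> 90)

text \<open>
  The dimension of the parameter space of an unfolding is quantified over inside the definition of
  stability, so it cannot be a type. Therefore \<open>\<complex>\<^sup>n\<close> is the set of sequences that vanish from
  index \<open>n\<close> on. The product topology on \<^typ>\<open>nat \<Rightarrow> complex\<close> induces the Euclidean topology on it.
\<close>

definition cspace :: "nat \<Rightarrow> (nat \<Rightarrow> complex) set" where
  "cspace n = {x. \<forall>i\<ge>n. x i = 0}"

abbreviation origin :: "nat \<Rightarrow> complex" where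
  "origin \<equiv> (\<lambda>_. 0)"

abbreviation copen :: "nat \<Rightarrow> (nat \<Rightarrow> complex) set \<Rightarrow> bool" where
  "copen n U \<equiv> openin (top_of_set (cspace n)) U"

text \<open>
  The vector \<open>c\<close> is the gradient of \<open>g\<close> at \<open>a\<close>; so this is Frechet differentiability with a
  complex linear derivative.
\<close>

definition has_cgradient ::
    "nat \<Rightarrow> ((nat \<Rightarrow> complex) \<Rightarrow> complex) \<Rightarrow> (nat \<Rightarrow> complex) \<Rightarrow> (nat \<Rightarrow> complex) \<Rightarrow> bool" where
  "has_cgradient n g c a \<longleftrightarrow>
     ((\<lambda>x. (g x - g a - (\<Sum>i<n. c i * (x i - a i)))
             / of_real (L2_set (\<lambda>i. cmod (x i - a i)) {..<n})) \<longlongrightarrow> 0) (at a within cspace n)"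

definition holo_map ::
    "nat \<Rightarrow> nat \<Rightarrow> (nat \<Rightarrow> complex) set \<Rightarrow> ((nat \<Rightarrow> complex) \<Rightarrow> nat \<Rightarrow> complex) \<Rightarrow> bool" where
  "holo_map n p U f \<longleftrightarrow>
     copen n U \<and> f ` U \<subseteq> cspace p \<and>
     (\<forall>a\<in>U. \<forall>j<p. \<exists>c. has_cgradient n (\<lambda>x. f x j) c a)"

text \<open>
  A germ along \<open>S\<close> is given by a total function, of which only the values near \<open>S\<close> matter.
  A multi-germ in the usual sense is the case where \<open>S\<close> is finite and \<open>T\<close> is a single point;
  the germs of the identity at \<open>S\<close> and of its unfoldings need the more general targets.
  The base point in the target is not normalised to the origin.
\<close>

definition holo_germ ::
    "nat \<Rightarrow> nat \<Rightarrow> (nat \<Rightarrow> complex) set \<Rightarrow> (nat \<Rightarrow> complex) set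
      \<Rightarrow> ((nat \<Rightarrow> complex) \<Rightarrow> nat \<Rightarrow> complex) \<Rightarrow> bool" where
  "holo_germ n p S T f \<longleftrightarrow> T \<subseteq> cspace p \<and> f ` S \<subseteq> T \<and> (\<exists>U. S \<subseteq> U \<and> holo_map n p U f)"

definition germ_eq ::
    "nat \<Rightarrow> (nat \<Rightarrow> complex) set \<Rightarrow> ((nat \<Rightarrow> complex) \<Rightarrow> nat \<Rightarrow> complex)
      \<Rightarrow> ((nat \<Rightarrow> complex) \<Rightarrow> nat \<Rightarrow> complex) \<Rightarrow> bool" where
  "germ_eq n S f g \<longleftrightarrow> (\<exists>U. copen n U \<and> S \<subseteq> U \<and> (\<forall>x\<in>U. f x = g x))"

definition multigerm ::
    "nat \<Rightarrow> nat \<Rightarrow> (nat \<Rightarrow> complex) set \<Rightarrow> (nat \<Rightarrow> complex)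
      \<Rightarrow> ((nat \<Rightarrow> complex) \<Rightarrow> nat \<Rightarrow> complex) \<Rightarrow> bool" where
  "multigerm n p S y f \<longleftrightarrow> finite S \<and> holo_germ n p S {y} f"

definition biholo_germ ::
    "nat \<Rightarrow> (nat \<Rightarrow> complex) set \<Rightarrow> (nat \<Rightarrow> complex) set
      \<Rightarrow> ((nat \<Rightarrow> complex) \<Rightarrow> nat \<Rightarrow> complex) \<Rightarrow> bool" where
  "biholo_germ n S T \<phi> \<longleftrightarrow>
     (\<exists>U V. S \<subseteq> U \<and> T \<subseteq> V \<and> holo_map n n U \<phi> \<and> bij_betw \<phi> U V \<and>
            holo_map n n V (inv_into U \<phi>) \<and> \<phi> ` S = T)"

definition A_equivalent_via ::
    "nat \<Rightarrow> nat \<Rightarrow> (nat \<Rightarrow> complex) set \<Rightarrow> (nat \<Rightarrow> complex)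
      \<Rightarrow> ((nat \<Rightarrow> complex) \<Rightarrow> nat \<Rightarrow> complex)
      \<Rightarrow> (nat \<Rightarrow> complex) set \<Rightarrow> (nat \<Rightarrow> complex)
      \<Rightarrow> ((nat \<Rightarrow> complex) \<Rightarrow> nat \<Rightarrow> complex)
      \<Rightarrow> ((nat \<Rightarrow> complex) \<Rightarrow> nat \<Rightarrow> complex)
      \<Rightarrow> ((nat \<Rightarrow> complex) \<Rightarrow> nat \<Rightarrow> complex) \<Rightarrow> bool" where
  "A_equivalent_via n p S y f S' y' f' \<phi> \<psi> \<longleftrightarrow>
     biholo_germ n S' S \<phi> \<and> biholo_germ p {y} {y'} \<psi> \<and> germ_eq n S' f' (\<psi> \<circ> f \<circ> \<phi>)"

text \<open>The identification of \<open>\<complex>\<^sup>r \<times> \<complex>\<^sup>n\<close> with \<open>\<complex>\<^sup>r\<^sup>+\<^sup>n\<close>: parameters come first.\<close>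

definition join :: "nat \<Rightarrow> (nat \<Rightarrow> complex) \<Rightarrow> (nat \<Rightarrow> complex) \<Rightarrow> nat \<Rightarrow> complex" where
  "join r t x = (\<lambda>i. if i < r then t i else x (i - r))"

definition unfolding_of ::
    "nat \<Rightarrow> nat \<Rightarrow> nat \<Rightarrow> (nat \<Rightarrow> complex) set \<Rightarrow> (nat \<Rightarrow> complex) set
      \<Rightarrow> ((nat \<Rightarrow> complex) \<Rightarrow> nat \<Rightarrow> complex)
      \<Rightarrow> ((nat \<Rightarrow> complex) \<Rightarrow> nat \<Rightarrow> complex) \<Rightarrow> bool" where
  "unfolding_of r n p S T f F \<longleftrightarrow>
     holo_germ (r + n) (r + p) (join r origin ` S) (join r origin ` T) F \<and>
     (\<exists>U. copen (r + n) U \<and> join r origin ` S \<subseteq> U \<and> (\<forall>z\<in>U. \<forall>i<r. F z i = z i)) \<and>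
     germ_eq n S (\<lambda>x. F (join r origin x)) (\<lambda>x. join r origin (f x))"

definition id_times ::
    "nat \<Rightarrow> ((nat \<Rightarrow> complex) \<Rightarrow> nat \<Rightarrow> complex) \<Rightarrow> (nat \<Rightarrow> complex) \<Rightarrow> nat \<Rightarrow> complex" where
  "id_times r f z = join r z (f (\<lambda>i. z (r + i)))"

definition trivial_unfolding ::
    "nat \<Rightarrow> nat \<Rightarrow> nat \<Rightarrow> (nat \<Rightarrow> complex) set \<Rightarrow> (nat \<Rightarrow> complex)
      \<Rightarrow> ((nat \<Rightarrow> complex) \<Rightarrow> nat \<Rightarrow> complex)
      \<Rightarrow> ((nat \<Rightarrow> complex) \<Rightarrow> nat \<Rightarrow> complex) \<Rightarrow> bool" where
  "trivial_unfolding r n p S y f F \<longleftrightarrow>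
     (\<exists>\<Phi> \<Psi>. unfolding_of r n n S S id \<Phi> \<and> unfolding_of r p p {y} {y} id \<Psi> \<and>
        A_equivalent_via (r + n) (r + p)
          (join r origin ` S) (join r origin y) F
          (join r origin ` S) (join r origin y) (id_times r f) \<Phi> \<Psi>)"

definition stable_multigerm ::
    "nat \<Rightarrow> nat \<Rightarrow> (nat \<Rightarrow> complex) set \<Rightarrow> (nat \<Rightarrow> complex)
      \<Rightarrow> ((nat \<Rightarrow> complex) \<Rightarrow> nat \<Rightarrow> complex) \<Rightarrow> bool" where
  "stable_multigerm n p S y f \<longleftrightarrow>
     multigerm n p S y f \<and>
     (\<forall>r F. unfolding_of r n p S {y} f F \<longrightarrow> trivial_unfolding r n p S y f F)"

text \<open>Finite means closed (here: proper) with finite fibres.\<close>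

definition finite_representative ::
    "nat \<Rightarrow> nat \<Rightarrow> ((nat \<Rightarrow> complex) \<Rightarrow> nat \<Rightarrow> complex)
      \<Rightarrow> (nat \<Rightarrow> complex) set \<Rightarrow> (nat \<Rightarrow> complex) set \<Rightarrow> bool" where
  "finite_representative n p f U V \<longleftrightarrow>
     holo_map n p U f \<and> copen p V \<and> origin \<in> V \<and> f ` U \<subseteq> V \<and>
     proper_map (top_of_set U) (top_of_set V) f \<and>
     (\<forall>y\<in>V. finite {x\<in>U. f x = y}) \<and>
     {x\<in>U. f x = origin} = {origin}"

text \<open>
  The germ at the origin is represented by any function defining it. A small representative is a
  finite one whose source lies in a prescribed neighbourhood \<open>W\<close> of the origin.
\<close>

definition A_finite :: "nat \<Rightarrow> nat \<Rightarrow> ((nat \<Rightarrow> complex) \<Rightarrow> nat \<Rightarrow> complex) \<Rightarrow> bool" where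
  "A_finite n p f \<longleftrightarrow>
     (\<forall>W. copen n W \<and> origin \<in> W \<longrightarrow>
        (\<exists>U V. U \<subseteq> W \<and> finite_representative n p f U V \<and>
           (\<forall>y\<in>V - {origin}. stable_multigerm n p {x\<in>U. f x = y} y f)))"

definition all_submatrices_maximal_rank :: "'a::field mat \<Rightarrow> bool" where
  "all_submatrices_maximal_rank A \<longleftrightarrow>
     (\<forall>I J. I \<subseteq> {..<dim_row A} \<and> J \<subseteq> {..<dim_col A} \<and> I \<noteq> {} \<and> J \<noteq> {} \<longrightarrow>
        vec_space.rank (card I) (submatrix A I J) = min (card I) (card J))"

text \<open>Indices are shifted to start at 0, so \<open>m\<close> and \<open>r\<close> are used on \<open>{..<n}\<close> and \<open>{..<n - 1}\<close>.\<close>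

definition power_map ::
    "nat \<Rightarrow> rat mat \<Rightarrow> (nat \<Rightarrow> nat) \<Rightarrow> (nat \<Rightarrow> nat) \<Rightarrow> (nat \<Rightarrow> complex) \<Rightarrow> nat \<Rightarrow> complex" where
  "power_map n H m r x = (\<lambda>i.
     if i < n then x i ^ m i
     else if i < 2 * n - 1 then ((map_mat of_rat H *\<^sub>v vec n x) $ (i - n)) ^ r (i - n)
     else 0)"

end

theory Submission
  imports
    Defs
    "HOL-Complex_Analysis.Complex_Analysis"
    "HOL-Number_Theory.Number_Theory"
    "Jordan_Normal_Form.Char_Poly"
begin

text \<open>
  Put \<open>N = 2 n - 1\<close> and list the forms \<open>x\<^sub>1, \<dots>, x\<^sub>n, (Hx)\<^sub>1, \<dots>, (Hx)\<^sub>n\<^sub>-\<^sub>1\<close> as coordinates \<open>z k\<close>, \<open>k < N\<close>.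
  They embed the source as a rational subspace \<open>E\<close> of dimension \<open>n\<close> of \<open>\<complex>\<^sup>N\<close>, on which the map is
  \<open>z k \<mapsto> z k ^ M k\<close> with pairwise coprime \<open>M k\<close>. The rank hypothesis says that \<open>E\<close> is in general
  position: a non-zero vector of \<open>E\<close> has at least \<open>n\<close> non-zero coordinates. Hence the map is an
  immersion outside the origin, where its derivative is a diagonal map whose entry at \<open>k\<close> does not
  vanish if \<open>z k \<noteq> 0\<close>.

  Arithmetic controls the multiple points. If two points of the source have the same image, their
  coordinates are \<open>z\<close> and \<open>\<tau> z\<close> with roots of unity \<open>\<tau> k\<close> of order dividing \<open>M k\<close>, and at
  least \<open>n\<close> of them differ from 1. The conditions \<open>z \<in> E\<close> and \<open>\<tau> z \<in> E\<close> are \<open>2 (n - 1)\<close> linear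
  equations in \<open>N\<close> unknowns, and only the column of \<open>z k\<close> involves \<open>\<tau> k\<close>. Since the \<open>M k\<close> are
  coprime, the \<open>\<tau> k\<close> can be replaced by Galois conjugates independently of each other, so a minor
  that vanishes also vanishes after each column is replaced by a linear combination of its conjugates
  (\<open>singular_root_of_unity_specialize\<close>). A conjugate of \<open>(1, \<tau> k)\<close> is \<open>(1, \<tau> k\<^sup>2)\<close> if \<open>M k\<close> is odd,
  and \<open>(1, 1)\<close> is a combination of the two. After \<open>n - 1\<close> columns are specialised in this way the
  minors are visibly non-zero. So the solutions \<open>z\<close> form a line, no coordinate of which vanishes
  (\<open>double_point_line\<close>), and this says that the two branches are transverse. The same method with
  \<open>(1, \<tau> k, \<sigma> k)\<close> excludes triple points for \<open>n \<ge> 2\<close> (\<open>no_triple_point\<close>). Thus over a point other than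
  the origin the map is an immersion with at most a transverse double point, or, for \<open>n = 1\<close>, a finite
  number of local biholomorphisms.

  Such normal crossings are stable (\<open>normal_crossing_stable\<close>). Each branch of an unfolding is
  completed to a chart of the target by adding normal directions; the inverse chart contains
  equations \<open>g\<close> of the image of the branch. At the base point the differentials of all
  these equations are independent. So there are local coordinates of the target, depending on the
  parameters, in which all the equations become linear. Comparing these coordinates
  with those of the constant unfolding gives the biholomorphism of the target, and the charts of the
  branches lift it to the source. What is needed from analysis is the holomorphic inverse
  function theorem (\<open>holomorphic_inverse_function\<close>) in \<open>\<complex>\<^sup>N\<close> with \<open>N\<close> a variable. It is proved by
  contraction; Cauchy's estimate on lines turns differentiability into strict differentiability.
\<close>

no_notation vec_nth (infixl \<open>$\<close> 90)

section \<open>Conjugates of roots of unity\<close>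

text \<open>
  Freshman's dream: the inner binomial coefficients are divisible by the prime.
\<close>
lemma prime_power_add_cong:
  fixes a b :: "'a::comm_semiring_1"
  assumes "prime p"
  shows "\<exists>c. (a + b) ^ p = a ^ p + b ^ p + of_nat p * c"
proof -
  have p: "p > 1" using assms prime_gt_1_nat by blast
  define c where "c = (\<Sum>k\<in>{1..<p}. of_nat ((p choose k) div p) * a ^ k * b ^ (p - k))"
  have "(a + b) ^ p = (\<Sum>k\<le>p. of_nat (p choose k) * a ^ k * b ^ (p - k))"
    by (rule binomial_ring)
  also have "{..p} = insert 0 (insert p {1..<p})" using p by auto
  also have "(\<Sum>k\<in>insert 0 (insert p {1..<p}). of_nat (p choose k) * a ^ k * b ^ (p - k))
      = b ^ p + (a ^ p + (\<Sum>k\<in>{1..<p}. of_nat (p choose k) * a ^ k * b ^ (p - k)))"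
    using p by (subst sum.insert, simp, simp, subst sum.insert) auto
  also have "(\<Sum>k\<in>{1..<p}. of_nat (p choose k) * a ^ k * b ^ (p - k)) = of_nat p * c"
    unfolding c_def sum_distrib_left
  proof (rule sum.cong, simp)
    fix k assume k: "k \<in> {1..<p}"
    have "p dvd (p choose k)" using k assms by (intro dvd_choose_prime) auto
    then have "p choose k = p * ((p choose k) div p)" by simp
    then have "(of_nat (p choose k) :: 'a) = of_nat p * of_nat ((p choose k) div p)"
      by (metis of_nat_mult)
    then show "of_nat (p choose k) * a ^ k * b ^ (p - k)
        = of_nat p * (of_nat ((p choose k) div p) * a ^ k * b ^ (p - k))"
      by (simp add: mult.assoc)
  qed
  finally show ?thesis by (intro exI[of _ c]) (simp add: algebra_simps)
qed

lemma int_power_prime_cong: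
  fixes a :: int
  assumes "prime p"
  shows "\<exists>c. a ^ p = a + int p * c"
proof -
  have nn: "\<exists>c. (int k) ^ p = int k + int p * c" for k
  proof (induction k)
    case 0
    then show ?case using assms prime_gt_0_nat by (intro exI[of _ 0]) (auto simp: zero_power)
  next
    case (Suc k)
    then obtain c where c: "(int k) ^ p = int k + int p * c" by blast
    obtain d where "(int k + 1) ^ p = int k ^ p + 1 ^ p + int p * d"
      using prime_power_add_cong[OF assms, of "int k" 1] by auto
    then show ?case using c by (intro exI[of _ "c + d"]) (simp add: algebra_simps)
  qed
  show ?thesis
  proof (cases "a \<ge> 0")
    case True then show ?thesis using nn[of "nat a"] by simp
  next
    case False
    obtain c where c: "(-a) ^ p = -a + int p * c" using nn[of "nat (-a)"] False by auto
    obtain d where d: "(a + (-a)) ^ p = a ^ p + (-a) ^ p + int p * d"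
      using prime_power_add_cong[OF assms, of a "-a"] by auto
    have "a ^ p = a + int p * (- c - d)"
      using c d prime_gt_0_nat[OF assms] by (simp add: zero_power algebra_simps)
    then show ?thesis by blast
  qed
qed

lemma int_poly_power_prime_cong:
  fixes q :: "int poly"
  assumes "prime p"
  shows "\<exists>g. q ^ p = pcompose q (Polynomial.monom 1 p) + of_nat p * g"
proof (induction q)
  case 0
  then show ?case using prime_gt_0_nat[OF assms] by (intro exI[of _ 0]) (simp add: zero_power)
next
  case (pCons a q)
  then obtain g where g: "q ^ p = pcompose q (Polynomial.monom 1 p) + of_nat p * g" by blast
  obtain c where c: "a ^ p = a + int p * c" using int_power_prime_cong[OF assms] by blast
  have split: "pCons a q = [:a:] + Polynomial.monom 1 1 * q"
    by (simp add: monom_altdef)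
  obtain h where h: "([:a:] + Polynomial.monom 1 1 * q) ^ p = [:a:] ^ p + (Polynomial.monom 1 1 * q) ^ p + of_nat p * h"
    using prime_power_add_cong[OF assms, of "[:a:]" "Polynomial.monom 1 1 * q"] by blast
  have 1: "[:a:] ^ p = [:a:] + of_nat p * [:c:]"
    by (simp add: poly_const_pow c of_nat_poly)
  have 2: "(Polynomial.monom 1 1 * q) ^ p = Polynomial.monom 1 p * (pcompose q (Polynomial.monom 1 p) + of_nat p * g)"
    by (simp add: power_mult_distrib monom_power g)
  have 3: "pcompose (pCons a q) (Polynomial.monom 1 p) = [:a:] + Polynomial.monom 1 p * pcompose q (Polynomial.monom 1 p)"
    by (simp add: pcompose_pCons)
  show ?case
    unfolding 3 unfolding split h 1 2
    by (intro exI[of _ "[:c:] + Polynomial.monom 1 p * g + h"]) (simp add: algebra_simps)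
qed

lemma sum_mod_periodic:
  fixes f :: "nat \<Rightarrow> 'a::comm_monoid_add"
  assumes "finite K" "M > 0"
  shows "(\<Sum>j<M. \<Sum>k\<in>{k\<in>K. (i + k) mod M = j}. f k) = sum f K"
proof -
  have "(\<Sum>j<M. \<Sum>k\<in>{k\<in>K. (i + k) mod M = j}. f k) = sum f (\<Union>j\<in>{..<M}. {k\<in>K. (i + k) mod M = j})"
    by (rule sum.UNION_disjoint[symmetric]) (use assms in auto)
  also have "(\<Union>j\<in>{..<M}. {k\<in>K. (i + k) mod M = j}) = K" using assms by auto
  finally show ?thesis .
qed

lemma power_mod_root_of_unity:
  fixes z :: "'a::monoid_mult"
  assumes "z ^ M = 1"
  shows "z ^ (k mod M) = z ^ k"
proof -
  have "z ^ k = z ^ (M * (k div M) + k mod M)" by simp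
  also have "\<dots> = z ^ (k mod M)" by (simp only: power_add power_mult assms power_one mult_1)
  finally show ?thesis by simp
qed

text \<open>
  Multiplication by \<open>q(z)\<close> permutes and combines the powers \<open>1, z, \<dots>, z\<^sup>M\<^sup>-\<^sup>1\<close> with integer
  coefficients. So \<open>q(z)\<close> is an eigenvalue of an integer matrix and a root of its characteristic
  polynomial.
\<close>
lemma algebraic_int_poly_root_of_unity:
  fixes z :: complex
  assumes "z ^ M = 1" "M > 0"
  shows "algebraic_int (poly (of_int_poly q) z)"
proof -
  define a where "a = poly (of_int_poly q) z"
  define A where "A = mat M M (\<lambda>(i,j). \<Sum>k\<in>{k\<in>{..degree q}. (i + k) mod M = j}. Polynomial.coeff q k)"
  have A: "A \<in> carrier_mat M M" by (simp add: A_def)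
  define B where "B = map_mat (of_int :: int \<Rightarrow> complex) A"
  have B: "B \<in> carrier_mat M M" using A by (simp add: B_def)
  define v where "v = vec M (\<lambda>i. z ^ i)"
  have a: "a = (\<Sum>k\<le>degree q. of_int (Polynomial.coeff q k) * z ^ k)"
    by (simp add: a_def poly_altdef)
  have "B *\<^sub>v v = a \<cdot>\<^sub>v v"
  proof (rule eq_vecI)
    fix i assume "i < dim_vec (a \<cdot>\<^sub>v v)"
    then have i: "i < M" by (simp add: v_def)
    have "(B *\<^sub>v v) $ i = (\<Sum>j<M. of_int (\<Sum>k\<in>{k\<in>{..degree q}. (i + k) mod M = j}. Polynomial.coeff q k) * z ^ j)"
      using i by (simp add: B_def A_def v_def scalar_prod_def atLeast0LessThan)
    also have "\<dots> = (\<Sum>j<M. \<Sum>k\<in>{k\<in>{..degree q}. (i + k) mod M = j}. of_int (Polynomial.coeff q k) * z ^ (i + k))"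
      unfolding of_int_sum sum_distrib_right
      by (intro sum.cong refl) (use power_mod_root_of_unity[OF assms(1)] in force)
    also have "\<dots> = (\<Sum>k\<le>degree q. of_int (Polynomial.coeff q k) * z ^ (i + k))"
      by (rule sum_mod_periodic) (use assms in auto)
    also have "\<dots> = a * z ^ i"
      unfolding a by (simp add: sum_distrib_left sum_distrib_right power_add algebra_simps)
    finally show "(B *\<^sub>v v) $ i = (a \<cdot>\<^sub>v v) $ i" using i by (simp add: v_def)
  qed (use B in \<open>simp add: v_def\<close>)
  moreover have "v \<noteq> 0\<^sub>v M"
  proof
    assume "v = 0\<^sub>v M"
    then have "v $ 0 = 0" using assms by simp
    then show False using assms by (simp add: v_def)
  qed
  ultimately have "eigenvalue B a"
    unfolding eigenvalue_def eigenvector_def using B by (intro exI[of _ v]) (auto simp: v_def)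
  then have "poly (char_poly B) a = 0" using eigenvalue_root_char_poly[OF B] by simp
  moreover have "char_poly B = of_int_poly (char_poly A)"
    unfolding B_def by (rule of_int_hom.char_poly_hom[OF A])
  moreover have "lead_coeff (char_poly A) = 1" using degree_monic_char_poly[OF A] by auto
  ultimately show ?thesis unfolding a_def[symmetric] algebraic_int_altdef_ipoly by auto
qed

text \<open>
  A non-zero element of \<open>\<int>[z]\<close> is a root of an integer polynomial with constant term \<open>a \<noteq> 0\<close>. If \<open>p\<close>
  divides the element in \<open>\<int>[z]\<close>, it divides \<open>a\<close> there; then \<open>a / p\<close> is a rational algebraic integer.
\<close>
lemma root_of_unity_ring_no_large_divisor:
  fixes z :: complex
  assumes z: "z ^ M = 1" "M > 0" and nz: "poly (of_int_poly q) z \<noteq> 0"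
  shows "\<exists>a::int. a \<noteq> 0 \<and> (\<forall>p g. p > 0 \<longrightarrow> poly (of_int_poly q) z = of_int p * poly (of_int_poly g) z \<longrightarrow> p dvd a)"
proof -
  define \<alpha> where "\<alpha> = poly (of_int_poly q) z"
  have "algebraic_int \<alpha>" unfolding \<alpha>_def using z by (rule algebraic_int_poly_root_of_unity)
  then obtain P0 :: "int poly" where P0: "poly (of_int_poly P0) \<alpha> = 0" "lead_coeff P0 = 1"
    unfolding algebraic_int_altdef_ipoly by blast
  have "P0 \<noteq> 0" using P0(2) by auto
  then have "\<exists>P::int poly. poly (of_int_poly P) \<alpha> = 0 \<and> Polynomial.coeff P 0 \<noteq> 0" using P0(1)
  proof (induction P0)
    case (pCons a P)
    show ?case
    proof (cases "a = 0")
      case True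
      then have "\<alpha> * poly (of_int_poly P) \<alpha> = 0" using pCons.prems(2) by (simp add: of_int_hom.map_poly_pCons_hom)
      then have "poly (of_int_poly P) \<alpha> = 0" using nz \<alpha>_def by simp
      moreover have "P \<noteq> 0" using True pCons.prems(1) by auto
      ultimately show ?thesis using pCons.IH by blast
    next
      case False then show ?thesis using pCons.prems by (intro exI[of _ "pCons a P"]) auto
    qed
  qed simp
  then obtain P :: "int poly" where P: "poly (of_int_poly P) \<alpha> = 0" "Polynomial.coeff P 0 \<noteq> 0" by blast
  obtain a R where aR: "P = pCons a R" by (cases P)
  have a: "a \<noteq> 0" using P(2) aR by simp
  have eq: "of_int a + \<alpha> * poly (of_int_poly R) \<alpha> = 0"
    using P(1) unfolding aR by (simp add: of_int_hom.map_poly_pCons_hom)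
  have "p dvd a" if p: "p > 0" and g: "\<alpha> = of_int p * poly (of_int_poly g) z" for p g
  proof -
    define h where "h = - (g * pcompose R q)"
    have "of_int a = of_int p * poly (of_int_poly h) z"
    proof -
      have "of_int a = - \<alpha> * poly (of_int_poly R) \<alpha>" using eq by (simp add: eq_neg_iff_add_eq_0)
      also have "poly (of_int_poly R) \<alpha> = poly (of_int_poly (pcompose R q)) z"
        unfolding \<alpha>_def by (simp add: of_int_hom.map_poly_pcompose poly_pcompose)
      also have "- \<alpha> * \<dots> = of_int p * poly (of_int_poly h) z"
        unfolding h_def by (subst g) (simp add: of_int_poly_hom.hom_uminus of_int_poly_hom.hom_mult)
      finally show ?thesis .
    qed
    then have e: "complex_of_int a / complex_of_int p = poly (of_int_poly h) z" using p by simp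
    have "algebraic_int (complex_of_int a / complex_of_int p)"
      unfolding e using z by (rule algebraic_int_poly_root_of_unity)
    then have "complex_of_int a / complex_of_int p \<in> \<int>"
      by (rule rational_algebraic_int_is_int) auto
    then obtain b where "complex_of_int a / complex_of_int p = of_int b" by (auto elim: Ints_cases)
    then have "complex_of_int a = of_int (p * b)" using p by (simp add: field_simps)
    then have "a = p * b" by (simp only: of_int_eq_iff)
    then show ?thesis by simp
  qed
  then show ?thesis using a unfolding \<alpha>_def by blast
qed

text \<open>
  The representative is taken congruent to 1 modulo all small primes that do not divide \<open>M\<close>.
\<close>
lemma cong_with_large_prime_factors:
  fixes c M B :: nat
  assumes "coprime c M" "M > 0"
  shows "\<exists>c'>0. [c' = c] (mod M) \<and> (\<forall>p. prime p \<and> p dvd c' \<longrightarrow> p > B)"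
proof -
  define L where "L = \<Prod>{p. prime p \<and> p \<le> B \<and> \<not> p dvd M}"
  have fin: "finite {p. prime p \<and> p \<le> B \<and> \<not> p dvd M}" by (rule finite_subset[of _ "{..B}"]) auto
  have L0: "L > 0" unfolding L_def by (rule prod_pos) (auto simp: prime_gt_0_nat)
  have cop: "coprime M L" unfolding L_def
    by (rule prod_coprime_right) (auto simp: coprime_commute prime_imp_coprime)
  obtain x where x: "[x = c] (mod M)" "[x = 1] (mod L)"
    using binary_chinese_remainder_nat[OF cop] by blast
  define c' where "c' = x + M * L"
  have c'0: "c' > 0" using L0 assms by (simp add: c'_def)
  have c'M: "[c' = c] (mod M)" and c'L: "[c' = 1] (mod L)"
    using x by (auto simp: c'_def cong_def)
  have "p > B" if p: "prime p" "p dvd c'" for p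
  proof (rule ccontr)
    assume n: "\<not> p > B"
    have "coprime c' M" using c'M assms(1) by (metis cong_imp_coprime cong_sym)
    then have pM: "\<not> p dvd M" using p by (meson coprime_common_divisor_nat not_prime_1 coprime_def not_prime_unit)
    then have "p dvd L" unfolding L_def using p n fin by (intro dvd_prodI) auto
    then have "[c' = 1] (mod p)" using c'L cong_dvd_modulus_nat by blast
    then have "p dvd 1" using p(2) cong_dvd_iff by blast
    then show False using p(1) by simp
  qed
  then show ?thesis using c'0 c'M by blast
qed

text \<open>
  This is the irreducibility of the cyclotomic polynomials, as a statement on conjugates. Modulo a
  prime \<open>p\<close>, \<open>q(z\<^sup>p)\<close> is congruent to \<open>q(z)\<^sup>p\<close>. So \<open>q(z) = 0\<close> makes \<open>q(z\<^sup>p)\<close> divisible by \<open>p\<close>. There are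
  only finitely many values of \<open>q\<close> at powers of \<open>z\<close>, so for large \<open>p\<close> this value must be 0. Up to
  multiples of \<open>M\<close>, every exponent coprime to \<open>M\<close> is a product of large primes.
\<close>
theorem int_poly_root_of_unity_conj:
  fixes z :: complex
  assumes z: "z ^ M = 1" "M > 0" and 0: "poly (of_int_poly q) z = 0" and c: "coprime c M"
  shows "poly (of_int_poly q) (z ^ c) = 0"
proof -
  have zk: "(z ^ k) ^ M = 1" for k using z by (metis power_mult mult.commute power_one)
  let ?ok = "\<lambda>k. poly (of_int_poly q) (z ^ k) = 0"
  have "\<exists>B::int. \<forall>p::nat. \<forall>k g. prime p \<longrightarrow> int p > B \<longrightarrow> k < M \<longrightarrow> \<not> ?ok k \<longrightarrow>
      poly (of_int_poly q) (z ^ k) \<noteq> of_int (int p) * poly (of_int_poly g) (z ^ k)"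
  proof -
    have "\<forall>k. \<exists>a::int. \<not> ?ok k \<longrightarrow> a \<noteq> 0 \<and> (\<forall>p g. p > 0 \<longrightarrow> poly (of_int_poly q) (z ^ k) = of_int p * poly (of_int_poly g) (z ^ k) \<longrightarrow> p dvd a)"
      using root_of_unity_ring_no_large_divisor[OF zk z(2)] by blast
    then obtain a :: "nat \<Rightarrow> int" where a: "\<And>k. \<not> ?ok k \<Longrightarrow> a k \<noteq> 0"
      "\<And>k p g. \<not> ?ok k \<Longrightarrow> p > 0 \<Longrightarrow> poly (of_int_poly q) (z ^ k) = of_int p * poly (of_int_poly g) (z ^ k) \<Longrightarrow> p dvd a k"
      by metis
    show ?thesis
    proof (intro exI[of _ "\<Sum>k<M. \<bar>a k\<bar>"] allI impI notI)
      fix p :: nat and k g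
      assume p: "prime p" "int p > (\<Sum>k<M. \<bar>a k\<bar>)" and k: "k < M" "\<not> ?ok k"
        and e: "poly (of_int_poly q) (z ^ k) = of_int (int p) * poly (of_int_poly g) (z ^ k)"
      have "int p dvd a k" using a(2)[OF k(2) _ e] p(1) prime_gt_0_nat by auto
      then have "int p \<le> \<bar>a k\<bar>" using a(1)[OF k(2)] by (meson dvd_imp_le_int dual_order.trans abs_ge_self)
      also have "\<bar>a k\<bar> \<le> (\<Sum>k<M. \<bar>a k\<bar>)" using k(1) by (intro member_le_sum) auto
      finally show False using p(2) by simp
    qed
  qed
  then obtain B :: int where B: "\<And>p k g. prime p \<Longrightarrow> int p > B \<Longrightarrow> k < M \<Longrightarrow> \<not> ?ok k \<Longrightarrow>
      poly (of_int_poly q) (z ^ k) \<noteq> of_int (int p) * poly (of_int_poly g) (z ^ k)" by blast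
  have step: "?ok (k * p)" if p: "prime p" "int p > B" "coprime p M" and k: "?ok k" for p k
  proof (rule ccontr)
    assume n: "\<not> ?ok (k * p)"
    define l where "l = (k * p) mod M"
    have l: "l < M" "z ^ l = z ^ (k * p)" using z by (auto simp: l_def power_mod_root_of_unity)
    \<comment> \<open>\<open>z ^ k\<close> is itself a power of \<open>z ^ l\<close> since \<open>p\<close> is invertible modulo \<open>M\<close>.\<close>
    obtain p' where p': "[p * p' = 1] (mod M)" using cong_solve_coprime_nat[OF p(3)] by auto
    have zback: "(z ^ l) ^ p' = z ^ k"
    proof -
      have "(z ^ l) ^ p' = (z ^ k) ^ (p * p')" by (simp only: l(2) power_mult)
      also have "\<dots> = (z ^ k) ^ ((p * p') mod M)" using power_mod_root_of_unity[OF zk] by simp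
      also have "\<dots> = (z ^ k) ^ (1 mod M)" using p' by (simp add: cong_def)
      also have "\<dots> = z ^ k" using power_mod_root_of_unity[OF zk, of k 1] by simp
      finally show ?thesis .
    qed
    obtain g where g: "q ^ p = pcompose q (Polynomial.monom 1 p) + of_nat p * g"
      using int_poly_power_prime_cong[OF p(1)] by blast
    have pe: "poly (of_int_poly (of_nat p)) (z ^ k) = of_nat p"
      by (subst of_int_poly_hom.hom_of_nat) (simp add: of_nat_poly)
    have "poly (of_int_poly (q ^ p)) (z ^ k) = poly (of_int_poly (pcompose q (Polynomial.monom 1 p) + of_nat p * g)) (z ^ k)"
      using g by simp
    then have "poly (of_int_poly q) (z ^ k) ^ p = poly (of_int_poly (pcompose q (Polynomial.monom 1 p))) (z ^ k)
        + of_nat p * poly (of_int_poly g) (z ^ k)"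
      by (simp only: of_int_poly_hom.hom_power of_int_poly_hom.hom_add of_int_poly_hom.hom_mult
          poly_power poly_add poly_mult pe)
    then have "poly (of_int_poly q) (z ^ k) ^ p = poly (of_int_poly q) (z ^ (k * p)) + of_nat p * poly (of_int_poly g) (z ^ k)"
      by (simp add: of_int_hom.map_poly_pcompose poly_pcompose poly_monom power_mult)
    then have "poly (of_int_poly q) (z ^ (k * p)) = - (of_nat p * poly (of_int_poly g) (z ^ k))"
      using k p(1) prime_gt_0_nat[of p] by (simp add: zero_power eq_neg_iff_add_eq_0)
    also have "poly (of_int_poly g) (z ^ k) = poly (of_int_poly (pcompose g (Polynomial.monom 1 p'))) (z ^ l)"
      using zback by (simp add: of_int_hom.map_poly_pcompose poly_pcompose poly_monom)
    finally have "poly (of_int_poly q) (z ^ l) = of_int (int p) * poly (of_int_poly (- pcompose g (Polynomial.monom 1 p'))) (z ^ l)"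
      using l by (simp add: of_int_poly_hom.hom_uminus)
    then show False using B[OF p(1,2) l(1)] n l(2) by metis
  qed
  obtain c' where c': "c' > 0" "[c' = c] (mod M)" "\<And>p. prime p \<Longrightarrow> p dvd c' \<Longrightarrow> p > nat B"
    using cong_with_large_prime_factors[OF c z(2), of "nat B"] by blast
  have cop: "coprime c' M" using c'(2) c by (metis cong_imp_coprime cong_sym)
  have "?ok d" if "d > 0" "d dvd c'" for d
    using that
  proof (induction d rule: less_induct)
    case (less d)
    show ?case
    proof (cases "d = 1")
      case True then show ?thesis using 0 by simp
    next
      case False
      then obtain p where p: "prime p" "p dvd d" using prime_factor_nat by blast
      then obtain k where k: "d = k * p" by (auto elim: dvdE simp: mult.commute)
      have "p dvd c'" using p(2) less.prems(2) dvd_trans by blast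
      then have "int p > B" "coprime p M" using c'(3)[OF p(1)] cop coprime_divisors by auto
      moreover have "?ok k"
        using less.IH[of k] less.prems k prime_gt_1_nat[OF p(1)] by (auto intro: dvd_mult_left)
      ultimately show ?thesis using step[OF p(1)] k by blast
    qed
  qed
  from this[OF c'(1) dvd_refl] have "?ok c'" .
  moreover have "z ^ c' = z ^ c"
  proof -
    have "c' mod M = c mod M" using c'(2) by (simp add: cong_def)
    then show ?thesis using power_mod_root_of_unity[OF z(1), of c'] power_mod_root_of_unity[OF z(1), of c]
      by simp
  qed
  ultimately show ?thesis by simp
qed

section \<open>Specialisation of singular systems\<close>

lemma det_zero_iff_kernel:
  fixes f :: "nat \<Rightarrow> nat \<Rightarrow> 'a::field"
  shows "det (mat q q (\<lambda>(i,k). f i k)) = 0 \<longleftrightarrow>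
    (\<exists>v. (\<exists>k<q. v k \<noteq> 0) \<and> (\<forall>i<q. (\<Sum>k<q. f i k * v k) = 0))" (is "_ \<longleftrightarrow> ?rhs")
proof -
  let ?A = "mat q q (\<lambda>(i,k). f i k)"
  have "det ?A = 0 \<longleftrightarrow> (\<exists>v. v \<in> carrier_vec q \<and> v \<noteq> 0\<^sub>v q \<and> ?A *\<^sub>v v = 0\<^sub>v q)"
    by (rule det_0_iff_vec_prod_zero_field) simp
  also have "\<dots> \<longleftrightarrow> ?rhs"
  proof
    assume "\<exists>v. v \<in> carrier_vec q \<and> v \<noteq> 0\<^sub>v q \<and> ?A *\<^sub>v v = 0\<^sub>v q"
    then obtain v where v: "v \<in> carrier_vec q" "v \<noteq> 0\<^sub>v q" "?A *\<^sub>v v = 0\<^sub>v q" by blast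
    have "\<exists>k<q. v $ k \<noteq> 0"
    proof (rule ccontr)
      assume "\<not> ?thesis"
      then have "v = 0\<^sub>v q" using v(1) by (intro eq_vecI) auto
      then show False using v(2) by contradiction
    qed
    moreover have "(\<Sum>k<q. f i k * v $ k) = 0" if "i < q" for i
    proof -
      have "(?A *\<^sub>v v) $ i = 0" using v(3) that by simp
      then show ?thesis using that v(1) by (simp add: scalar_prod_def atLeast0LessThan)
    qed
    ultimately show ?rhs by blast
  next
    assume ?rhs
    then obtain v where v: "\<exists>k<q. v k \<noteq> 0" "\<And>i. i < q \<Longrightarrow> (\<Sum>k<q. f i k * v k) = 0" by blast
    obtain k where k: "k < q" "v k \<noteq> 0" using v(1) by blast
    have "vec q v \<noteq> 0\<^sub>v q"
    proof
      assume "vec q v = 0\<^sub>v q"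
      then have "vec q v $ k = 0\<^sub>v q $ k" by simp
      then show False using k by simp
    qed
    moreover have "?A *\<^sub>v vec q v = 0\<^sub>v q"
      by (rule eq_vecI) (use v(2) in \<open>auto simp: scalar_prod_def atLeast0LessThan\<close>)
    ultimately show "\<exists>v. v \<in> carrier_vec q \<and> v \<noteq> 0\<^sub>v q \<and> ?A *\<^sub>v v = 0\<^sub>v q"
      by (intro exI[of _ "vec q v"] conjI) (rule vec_carrier)
  qed
  finally show ?thesis .
qed

text \<open>
  Multilinearity of the determinant in the columns, with all columns expanded at once.
\<close>
lemma det_sum_columns:
  fixes X :: "nat \<Rightarrow> 'e \<Rightarrow> nat \<Rightarrow> 'a::comm_ring_1"
  assumes "\<And>k. finite (C k)"
  shows "det (mat q q (\<lambda>(i,k). \<Sum>e\<in>C k. l k e * X k e i)) =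
    (\<Sum>g\<in>Pi\<^sub>E {0..<q} C. (\<Prod>k=0..<q. l k (g k)) * det (mat q q (\<lambda>(i,k). X k (g k) i)))"
proof -
  have col: "det (mat q q (\<lambda>(i,k). Y i k)) =
      (\<Sum>p\<in>{p. p permutes {0..<q}}. signof p * (\<Prod>k=0..<q. Y (p k) k))" for Y :: "nat \<Rightarrow> nat \<Rightarrow> 'a"
  proof -
    have "det (mat q q (\<lambda>(i,k). Y i k)) = det (transpose_mat (mat q q (\<lambda>(i,k). Y i k)))"
      by (rule det_transpose[symmetric]) auto
    also have "transpose_mat (mat q q (\<lambda>(i,k). Y i k)) = mat q q (\<lambda>(k,i). Y i k)"
      by (rule eq_matI) auto
    also have "det \<dots> = (\<Sum>p\<in>{p. p permutes {0..<q}}. signof p * (\<Prod>k=0..<q. Y (p k) k))"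
      unfolding det_def'[of _ q, OF mat_carrier]
    proof (rule sum.cong, rule refl)
      fix p assume p: "p \<in> {p. p permutes {0..<q}}"
      have "(\<Prod>i=0..<q. mat q q (\<lambda>(k,i). Y i k) $$ (i, p i)) = (\<Prod>k=0..<q. Y (p k) k)"
        by (rule prod.cong) (use p in \<open>auto dest: permutes_in_image\<close>)
      then show "signof p * (\<Prod>i=0..<q. mat q q (\<lambda>(k,i). Y i k) $$ (i, p i)) =
          signof p * (\<Prod>k=0..<q. Y (p k) k)" by simp
    qed
    finally show ?thesis .
  qed
  have "det (mat q q (\<lambda>(i,k). \<Sum>e\<in>C k. l k e * X k e i)) =
      (\<Sum>p\<in>{p. p permutes {0..<q}}. signof p * (\<Sum>g\<in>Pi\<^sub>E {0..<q} C. \<Prod>k=0..<q. l k (g k) * X k (g k) (p k)))"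
    unfolding col by (subst prod_sum_PiE) (use assms in auto)
  also have "\<dots> = (\<Sum>g\<in>Pi\<^sub>E {0..<q} C. (\<Prod>k=0..<q. l k (g k)) *
      (\<Sum>p\<in>{p. p permutes {0..<q}}. signof p * (\<Prod>k=0..<q. X k (g k) (p k))))"
    unfolding sum_distrib_left by (subst sum.swap) (simp add: prod.distrib algebra_simps)
  finally show ?thesis unfolding col .
qed

lemma root_of_unity_power_cis:
  fixes z :: complex
  assumes "z ^ M = 1" "M > 0"
  shows "\<exists>k. z = cis (2 * pi / M) ^ k"
proof -
  have "z \<in> {z. z ^ M = 1}" using assms by simp
  then have "z \<in> (\<lambda>k. cis (2 * pi * real k / real M)) ` {..<M}"
    using Complex.bij_betw_roots_unity[OF assms(2)] by (simp add: bij_betw_def)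
  then obtain k where k: "z = cis (2 * pi * real k / real M)" by auto
  have "cis (2 * pi / M) ^ k = cis (real k * (2 * pi / M))" by (rule Complex.DeMoivre)
  also have "real k * (2 * pi / M) = 2 * pi * real k / real M" by simp
  finally show ?thesis unfolding k by (intro exI[of _ k]) (rule sym)
qed

text \<open>
  The determinant is a polynomial in one root of unity whose order is the product of all \<open>\<mu> k\<close>. By
  the Chinese remainder theorem a single conjugation has the prescribed effect on each column.
\<close>
lemma det_root_of_unity_conj:
  fixes h :: "nat \<Rightarrow> nat \<Rightarrow> int" and \<rho> :: "nat \<Rightarrow> nat \<Rightarrow> complex"
  assumes pos: "\<And>k. k < q \<Longrightarrow> \<mu> k > 0"
    and cop: "\<And>k l. k < q \<Longrightarrow> l < q \<Longrightarrow> k \<noteq> l \<Longrightarrow> coprime (\<mu> k) (\<mu> l)"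
    and \<rho>: "\<And>i k. i < q \<Longrightarrow> k < q \<Longrightarrow> \<rho> i k ^ \<mu> k = 1"
    and e: "\<And>k. k < q \<Longrightarrow> coprime (e k) (\<mu> k)"
    and det: "det (mat q q (\<lambda>(i,k). of_int (h i k) * \<rho> i k)) = 0"
  shows "det (mat q q (\<lambda>(i,k). of_int (h i k) * \<rho> i k ^ e k)) = 0"
proof -
  define M where "M = (\<Prod>k<q. \<mu> k)"
  have M: "M > 0" unfolding M_def by (rule prod_pos) (use pos in auto)
  define z where "z = cis (2 * pi / M)"
  have "z ^ M = cis (real M * (2 * pi / M))" unfolding z_def by (rule Complex.DeMoivre)
  also have "real M * (2 * pi / M) = 2 * pi" using M by simp
  finally have zM: "z ^ M = 1" by (simp only: cis_2pi)
  have "\<exists>E. \<rho> i k = z ^ E" if "i < q" "k < q" for i k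
  proof -
    have "\<mu> k dvd M" unfolding M_def by (rule dvd_prodI) (use that in auto)
    then have "\<rho> i k ^ M = 1" using \<rho>[OF that] by (auto elim!: dvdE simp: power_mult)
    then show ?thesis using root_of_unity_power_cis[OF _ M] unfolding z_def by blast
  qed
  then obtain E where E: "\<And>i k. i < q \<Longrightarrow> k < q \<Longrightarrow> \<rho> i k = z ^ E i k" by metis
  have "\<exists>c. \<forall>k\<in>{..<q}. [c = e k] (mod \<mu> k)"
    by (rule chinese_remainder_nat) (use cop in auto)
  then obtain c where c: "\<And>k. k < q \<Longrightarrow> [c = e k] (mod \<mu> k)" by auto
  have "coprime c (\<mu> k)" if "k < q" for k
    using c[OF that] e[OF that] by (metis cong_imp_coprime cong_sym)
  then have cM: "coprime c M" unfolding M_def by (intro prod_coprime_right) auto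
  define P where "P = mat q q (\<lambda>(i,k). Polynomial.monom (h i k) (E i k))"
  have ev: "poly (of_int_poly (det P)) x = det (mat q q (\<lambda>(i,k). of_int (h i k) * x ^ E i k))" for x :: complex
  proof -
    interpret ev: comm_ring_hom "\<lambda>p. poly (of_int_poly p) x"
      by unfold_locales (auto simp: of_int_poly_hom.hom_add of_int_poly_hom.hom_mult)
    have "poly (of_int_poly (det P)) x = det (map_mat (\<lambda>p. poly (of_int_poly p) x) P)"
      by (simp add: ev.hom_det)
    also have "map_mat (\<lambda>p. poly (of_int_poly p) x) P = mat q q (\<lambda>(i,k). of_int (h i k) * x ^ E i k)"
      by (rule eq_matI) (auto simp: P_def poly_monom)
    finally show ?thesis .
  qed
  have "mat q q (\<lambda>(i,k). of_int (h i k) * \<rho> i k) = mat q q (\<lambda>(i,k). of_int (h i k) * z ^ E i k)"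
    by (rule eq_matI) (auto simp: E)
  then have "poly (of_int_poly (det P)) z = 0" unfolding ev using det by simp
  then have "poly (of_int_poly (det P)) (z ^ c) = 0"
    by (rule int_poly_root_of_unity_conj[OF zM M _ cM])
  moreover have "mat q q (\<lambda>(i,k). of_int (h i k) * \<rho> i k ^ e k) = mat q q (\<lambda>(i,k). of_int (h i k) * (z ^ c) ^ E i k)"
  proof (rule eq_matI)
    fix i k assume "i < dim_row (mat q q (\<lambda>(i,k). of_int (h i k) * (z ^ c) ^ E i k))"
      "k < dim_col (mat q q (\<lambda>(i,k). of_int (h i k) * (z ^ c) ^ E i k))"
    then have ik: "i < q" "k < q" by auto
    have "\<rho> i k ^ e k = \<rho> i k ^ c"
      using power_mod_root_of_unity[OF \<rho>[OF ik]] c[OF ik(2)] unfolding cong_def by metis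
    also have "\<dots> = (z ^ c) ^ E i k"
      unfolding E[OF ik] by (simp only: power_mult[symmetric] mult.commute)
    finally show "mat q q (\<lambda>(i,k). of_int (h i k) * \<rho> i k ^ e k) $$ (i, k) =
      mat q q (\<lambda>(i,k). of_int (h i k) * (z ^ c) ^ E i k) $$ (i, k)" using ik by simp
  qed auto
  ultimately show ?thesis unfolding ev by simp
qed

text \<open>
  The determinant of a square system vanishes at all conjugates, chosen independently in the
  columns, and it is linear in each column. So it vanishes when each column is replaced by a linear
  combination of its conjugates. The exponents are the freedom that the coprime orders give.
\<close>
theorem singular_root_of_unity_specialize:
  fixes h :: "'r \<Rightarrow> 'c \<Rightarrow> int" and \<rho> :: "'r \<Rightarrow> 'c \<Rightarrow> complex"
  assumes fin: "finite R" "finite C" "card R = card C"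
    and pos: "\<And>k. k \<in> C \<Longrightarrow> \<mu> k > 0"
    and cop: "\<And>k l. k \<in> C \<Longrightarrow> l \<in> C \<Longrightarrow> k \<noteq> l \<Longrightarrow> coprime (\<mu> k) (\<mu> l)"
    and \<rho>: "\<And>i k. i \<in> R \<Longrightarrow> k \<in> C \<Longrightarrow> \<rho> i k ^ \<mu> k = 1"
    and e: "\<And>k e. k \<in> C \<Longrightarrow> e \<in> X k \<Longrightarrow> coprime e (\<mu> k)"
    and finX: "\<And>k. finite (X k)"
    and z: "k0 \<in> C" "z k0 \<noteq> 0" "\<And>i. i \<in> R \<Longrightarrow> (\<Sum>k\<in>C. of_int (h i k) * \<rho> i k * z k) = 0"
  shows "\<exists>v. (\<exists>k\<in>C. v k \<noteq> 0) \<and>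
    (\<forall>i\<in>R. (\<Sum>k\<in>C. of_int (h i k) * (\<Sum>e\<in>X k. l k e * \<rho> i k ^ e) * v k) = 0)"
proof -
  define q where "q = card C"
  obtain r where r: "bij_betw r {..<q} R"
    using ex_bij_betw_nat_finite[OF fin(1)] fin(3) by (auto simp: q_def atLeast0LessThan)
  obtain s where s: "bij_betw s {..<q} C"
    using ex_bij_betw_nat_finite[OF fin(2)] by (auto simp: q_def atLeast0LessThan)
  have rin: "r i \<in> R" if "i < q" for i using r that by (auto simp: bij_betw_def)
  have sin: "s i \<in> C" if "i < q" for i using s that by (auto simp: bij_betw_def)
  have sinj: "s i \<noteq> s j" if "i < q" "j < q" "i \<noteq> j" for i j
    using s that by (auto simp: bij_betw_def inj_on_def)
  have reidx: "(\<Sum>k\<in>C. f k) = (\<Sum>k<q. f (s k))" for f :: "'c \<Rightarrow> complex"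
    using sum.reindex_bij_betw[OF s, of f] by simp
  obtain j0 where j0: "j0 < q" "s j0 = k0" using s z(1) by (auto simp: bij_betw_def)
  have "det (mat q q (\<lambda>(i,k). of_int (h (r i) (s k)) * \<rho> (r i) (s k))) = 0"
    unfolding det_zero_iff_kernel
    by (rule exI[of _ "\<lambda>k. z (s k)"]) (use z j0 rin in \<open>auto simp: reidx\<close>)
  then have det: "det (mat q q (\<lambda>(i,k). of_int (h (r i) (s k)) * \<rho> (r i) (s k) ^ g k)) = 0"
    if "\<And>k. k < q \<Longrightarrow> g k \<in> X (s k)" for g
    by (rule det_root_of_unity_conj[where \<mu> = "\<lambda>k. \<mu> (s k)", rotated 4])
       (use pos cop \<rho> e sin rin sinj that in auto)
  have "det (mat q q (\<lambda>(i,k). \<Sum>e\<in>X (s k). l (s k) e * (of_int (h (r i) (s k)) * \<rho> (r i) (s k) ^ e))) = 0"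
    by (subst det_sum_columns[of "\<lambda>k. X (s k)"], rule finX, rule sum.neutral)
       (use det in \<open>auto simp: PiE_iff\<close>)
  then obtain v where v: "\<exists>k<q. v k \<noteq> 0"
    "\<And>i. i < q \<Longrightarrow> (\<Sum>k<q. (\<Sum>e\<in>X (s k). l (s k) e * (of_int (h (r i) (s k)) * \<rho> (r i) (s k) ^ e)) * v k) = 0"
    unfolding det_zero_iff_kernel by blast
  define t where "t = the_inv_into {..<q} s"
  have t: "t (s k) = k" if "k < q" for k
    using s that by (simp add: t_def bij_betw_def the_inv_into_f_f)
  show ?thesis
  proof (intro exI[of _ "\<lambda>k. v (t k)"] conjI ballI)
    show "\<exists>k\<in>C. v (t k) \<noteq> 0" using v(1) t sin by metis
    fix i assume "i \<in> R"
    then obtain j where j: "j < q" "r j = i" using r by (auto simp: bij_betw_def)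
    have "(\<Sum>k\<in>C. of_int (h i k) * (\<Sum>e\<in>X k. l k e * \<rho> i k ^ e) * v (t k)) =
        (\<Sum>k<q. (\<Sum>e\<in>X (s k). l (s k) e * (of_int (h (r j) (s k)) * \<rho> (r j) (s k) ^ e)) * v k)"
      unfolding reidx by (rule sum.cong) (auto simp: t j sum_distrib_left algebra_simps)
    then show "(\<Sum>k\<in>C. of_int (h i k) * (\<Sum>e\<in>X k. l k e * \<rho> i k ^ e) * v (t k)) = 0"
      using v(2)[OF j(1)] by simp
  qed
qed

section \<open>Multiple points of powers in general position\<close>

text \<open>
  Three complex numbers of modulus 1 with sum 0 form an equilateral triangle, which here would
  require cube roots of unity.
\<close>
lemma one_plus_roots_of_unity_nonzero:
  fixes s t :: complex
  assumes t: "t ^ M = 1" and s: "s ^ M = 1" and M: "M > 0" "\<not> 3 dvd M"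
  shows "1 + t + s \<noteq> 0"
proof
  assume 0: "1 + t + s = 0"
  have norm1: "norm x = 1" if "x ^ M = 1" for x :: complex
  proof -
    have "norm x ^ M = 1 ^ M" using that by (simp flip: norm_power)
    then show ?thesis by (rule power_eq_imp_eq_base) (use M(1) in auto)
  qed
  then have nt: "norm t = 1" and ns: "norm s = 1" using t s by auto
  have ct: "t * cnj t = 1" and cs: "s * cnj s = 1"
    using nt ns by (simp_all add: complex_norm_square[symmetric])
  have "1 + cnj t + cnj s = 0" using 0 by (metis complex_cnj_add complex_cnj_one complex_cnj_zero)
  then have "t * s * (1 + cnj t + cnj s) = 0" by simp
  moreover have "t * s * (1 + cnj t + cnj s) = t * s + s * (t * cnj t) + t * (s * cnj s)"
    by (simp add: algebra_simps)
  ultimately have 1: "t * s + s + t = 0" using ct cs by simp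
  have s_eq: "s = - 1 - t" using 0 by (simp add: algebra_simps eq_neg_iff_add_eq_0)
  have "t * t + t + 1 = - (t * s + s + t)" unfolding s_eq by (simp add: algebra_simps)
  then have q: "t * t + t + 1 = 0" using 1 by simp
  have "t ^ 3 - 1 = (t - 1) * (t * t + t + 1)" by (simp add: power3_eq_cube algebra_simps)
  then have "t ^ 3 = 1" unfolding q by simp
  moreover have "coprime 3 M" using M(2) by (simp add: prime_imp_coprime)
  then obtain x where "[3 * x = 1] (mod M)" using cong_solve_coprime_nat by auto
  then have "(3 * x) mod M = 1 mod M" by (simp add: cong_def)
  then have "t ^ (3 * x) = t ^ 1"
    using power_mod_root_of_unity[OF t, of "3 * x"] power_mod_root_of_unity[OF t, of 1] by simp
  ultimately have "t = 1" by (simp add: power_mult)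
  then show False using q by simp
qed

locale generic_power_map =
  fixes n :: nat and b :: "nat \<Rightarrow> nat \<Rightarrow> int" and M :: "nat \<Rightarrow> nat"
  assumes n1: "n \<ge> 1"
    and generic: "\<And>z k. (\<And>j. j < n - 1 \<Longrightarrow> (\<Sum>k<2*n-1. of_int (b k j) * z k) = (0::complex)) \<Longrightarrow>
      card {k\<in>{..<2*n-1}. z k \<noteq> 0} < n \<Longrightarrow> k < 2*n-1 \<Longrightarrow> z k = 0"
    and Mpos: "\<And>k. k < 2*n-1 \<Longrightarrow> M k > 0"
    and Mcop: "\<And>k l. k < 2*n-1 \<Longrightarrow> l < 2*n-1 \<Longrightarrow> k \<noteq> l \<Longrightarrow> coprime (M k) (M l)"
begin

abbreviation N :: nat where "N \<equiv> 2*n-1"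

definition inE :: "(nat \<Rightarrow> complex) \<Rightarrow> bool" where
  "inE z \<longleftrightarrow> (\<forall>j<n-1. (\<Sum>k<N. of_int (b k j) * z k) = 0)"

lemma inE_zero:
  assumes "inE z" "card {k\<in>{..<N}. z k \<noteq> 0} < n" "k < N"
  shows "z k = 0"
  using generic[of z k] assms by (simp add: inE_def)

lemma inE_comb: "inE y \<Longrightarrow> inE z \<Longrightarrow> inE (\<lambda>k. c * y k + d * z k)"
proof -
  assume y: "inE y" and z: "inE z"
  have "(\<Sum>k<N. of_int (b k j) * (c * y k + d * z k)) =
      c * (\<Sum>k<N. of_int (b k j) * y k) + d * (\<Sum>k<N. of_int (b k j) * z k)" for j
    unfolding sum_distrib_left sum.distrib[symmetric] by (rule sum.cong) (auto simp: algebra_simps)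
  then show ?thesis using y z by (simp add: inE_def)
qed

text \<open>
  Any \<open>n - 1\<close> of the vectors \<open>b k\<close> are linearly independent.
\<close>
lemma generic_supported:
  fixes z :: "nat \<Rightarrow> complex"
  assumes "\<And>j. j < n - 1 \<Longrightarrow> (\<Sum>k\<in>A. of_int (b k j) * z k) = 0"
    and "A \<subseteq> {..<N}" "card A < n" "k \<in> A"
  shows "z k = 0"
proof -
  define y where "y = (\<lambda>k. if k \<in> A then z k else 0)"
  have "(\<Sum>k<N. of_int (b k j) * y k) = 0" if "j < n - 1" for j
  proof -
    have "(\<Sum>k<N. of_int (b k j) * y k) = (\<Sum>k\<in>A. of_int (b k j) * z k)"
      using assms(2) by (intro sum.mono_neutral_cong_right) (auto simp: y_def)
    then show ?thesis using assms(1)[OF that] by simp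
  qed
  moreover have "card {k\<in>{..<N}. y k \<noteq> 0} \<le> card A"
    using assms(2) by (intro card_mono) (auto simp: y_def finite_subset)
  ultimately have "y k = 0" using assms(2-4) by (intro generic[of y k]) auto
  then show ?thesis using assms(4) by (simp add: y_def)
qed

lemma card_dvd_M_le_1:
  assumes "d > 1"
  shows "card {k\<in>{..<N}. d dvd M k} \<le> 1"
proof -
  have "k = l" if "k < N" "l < N" "d dvd M k" "d dvd M l" for k l
  proof (rule ccontr)
    assume "k \<noteq> l"
    then have "is_unit d" using Mcop that coprime_common_divisor by blast
    then show False using assms by simp
  qed
  then show ?thesis by (auto simp: card_le_Suc0_iff_eq)
qed

text \<open>
  The coordinate \<open>k0\<close> is dropped, which leaves a square system with columns
  \<open>b k \<otimes> (1, \<tau> k)\<close>. All but \<open>n - 1\<close> of the columns are specialised to \<open>b k \<otimes> (1, 1)\<close>. The remaining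
  ones are chosen among the \<open>k\<close> with \<open>\<tau> k \<noteq> 1\<close> and include the only index where \<open>M k\<close> may be even,
  as 2 is not an admissible exponent there. Modulo \<open>(1, 1)\<close> the two groups separate, and in each
  of them general position applies.
\<close>
lemma double_point_line:
  assumes n: "n \<ge> 2"
    and \<tau>: "\<And>k. k < N \<Longrightarrow> \<tau> k ^ M k = 1"
    and T: "card {k\<in>{..<N}. \<tau> k \<noteq> 1} \<ge> n"
    and E: "inE z" "inE (\<lambda>k. \<tau> k * z k)"
    and k0: "k0 < N" "z k0 = 0" and k: "k < N"
  shows "z k = 0"
proof (rule ccontr)
  assume zk: "z k \<noteq> 0"
  define C where "C = {..<N} - {k0}"
  have C: "finite C" "C \<subseteq> {..<N}" "card C = 2 * (n - 1)" "k \<in> C"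
    using k0 k zk by (auto simp: C_def)
  define T' where "T' = {k\<in>C. \<tau> k \<noteq> 1}"
  have "{k\<in>{..<N}. \<tau> k \<noteq> 1} \<subseteq> insert k0 T'" by (auto simp: T'_def C_def)
  moreover have fT': "finite T'" using C(1) by (simp add: T'_def)
  ultimately have "card {k\<in>{..<N}. \<tau> k \<noteq> 1} \<le> card (insert k0 T')" by (intro card_mono) simp_all
  then have "n \<le> card (insert k0 T')" using T by linarith
  then have cT': "n - 1 \<le> card T'" using fT' by (simp add: card_insert_if split: if_splits)
  have "card {k\<in>T'. even (M k)} \<le> card {k\<in>{..<N}. 2 dvd M k}"
    using C(2) by (intro card_mono) (auto simp: T'_def)
  then have ev: "card {k\<in>T'. even (M k)} \<le> n - 1" using card_dvd_M_le_1[of 2] n by simp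
  obtain Z where Z: "{k\<in>T'. even (M k)} \<subseteq> Z" "Z \<subseteq> T'" "card Z = n - 1"
    using exists_subset_between[OF ev cT'] C(1) by (auto simp: T'_def)
  define G where "G = C - Z"
  have ZC: "Z \<subseteq> C" using Z(2) by (auto simp: T'_def)
  have cG: "card G = n - 1" using ZC Z(3) C by (simp add: G_def card_Diff_subset finite_subset)
  define triv where "triv = (\<lambda>k. k \<in> Z \<or> \<tau> k = 1)"
  define \<rho> where "\<rho> = (\<lambda>(j::nat,a::nat) k. if a = 0 then 1 else \<tau> k)"
  define X where "X = (\<lambda>k. if triv k then {1} else {1,2::nat})"
  \<comment> \<open>The polynomial \<open>1 - (x - 1) (x - \<tau>) / \<tau>\<close> has no constant term and takes the value 1 at 1 and \<open>\<tau>\<close>.\<close>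
  define l where "l = (\<lambda>k e. if triv k then 1 else if e = (1::nat) then (1 + \<tau> k) / \<tau> k else - 1 / \<tau> k)"
  define R where "R = {..<n-1} \<times> {..<2::nat}"
  have \<tau>0: "\<tau> k \<noteq> 0" if "k < N" for k using \<tau>[OF that] Mpos[OF that] by (auto simp: zero_power)
  have "\<exists>v. (\<exists>k\<in>C. v k \<noteq> 0) \<and>
    (\<forall>i\<in>R. (\<Sum>k\<in>C. of_int (b k (fst i)) * (\<Sum>e\<in>X k. l k e * \<rho> i k ^ e) * v k) = 0)"
  proof (rule singular_root_of_unity_specialize[where \<mu> = M and ?k0.0 = k and z = z])
    show "card R = card C" using C by (simp add: R_def)
    show "coprime (M k) (M l)" if "k \<in> C" "l \<in> C" "k \<noteq> l" for k l
      using Mcop[of k l] C(2) that by auto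
    show "M k > 0" if "k \<in> C" for k using Mpos[of k] C(2) that by auto
    show "\<rho> i k ^ M k = 1" if "i \<in> R" "k \<in> C" for i k
      using that C(2) \<tau> by (auto simp: \<rho>_def R_def split: if_splits)
    show "coprime e (M k)" if "k \<in> C" "e \<in> X k" for k e
    proof (cases "triv k")
      case False
      then have "odd (M k)" using that(1) Z(1) by (auto simp: triv_def T'_def)
      then show ?thesis using that(2) False by (auto simp: X_def)
    qed (use that in \<open>simp add: X_def\<close>)
    show "(\<Sum>k\<in>C. of_int (b k (fst i)) * \<rho> i k * z k) = 0" if "i \<in> R" for i
    proof -
      have ij: "fst i < n - 1" using that by (auto simp: R_def)
      have full: "(\<Sum>k\<in>C. of_int (b k (fst i)) * f k * z k) = (\<Sum>k<N. of_int (b k (fst i)) * (f k * z k))" for f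
        using k0 by (intro sum.mono_neutral_cong_left) (auto simp: C_def)
      have "\<rho> i = (\<lambda>k. 1) \<or> \<rho> i = \<tau>" by (cases i) (auto simp: \<rho>_def fun_eq_iff)
      then show ?thesis
        using E ij unfolding full inE_def by (elim disjE) simp_all
    qed
  qed (use C zk in \<open>auto simp: R_def X_def\<close>)
  then obtain v where v: "\<exists>k\<in>C. v k \<noteq> 0"
    "\<And>i. i \<in> R \<Longrightarrow> (\<Sum>k\<in>C. of_int (b k (fst i)) * (\<Sum>e\<in>X k. l k e * \<rho> i k ^ e) * v k) = 0" by blast
  define u where "u = (\<lambda>k. if k \<in> Z then \<tau> k else 1)"
  have P: "(\<Sum>e\<in>X k. l k e * \<rho> (j,0) k ^ e) = 1" "(\<Sum>e\<in>X k. l k e * \<rho> (j,1) k ^ e) = u k"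
    if "k \<in> C" for j k
    using \<tau>0[of k] that C(2) by (auto simp: X_def l_def \<rho>_def u_def triv_def field_simps power2_eq_square)
  have 0: "(\<Sum>k\<in>C. of_int (b k j) * v k) = 0" if "j < n - 1" for j
    using v(2)[of "(j,0)"] that P(1) by (simp add: R_def)
  have 1: "(\<Sum>k\<in>C. of_int (b k j) * u k * v k) = 0" if "j < n - 1" for j
    using v(2)[of "(j,1)"] that P(2) by (simp add: R_def)
  have vZ: "v k = 0" if "k \<in> Z" for k
  proof -
    have "(\<tau> k - 1) * v k = 0"
    proof (rule generic_supported[where A = Z and z = "\<lambda>k. (\<tau> k - 1) * v k"])
      fix j assume j: "j < n - 1"
      have "(\<Sum>k\<in>Z. of_int (b k j) * ((\<tau> k - 1) * v k)) = (\<Sum>k\<in>C. of_int (b k j) * ((u k - 1) * v k))"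
        using ZC C(1) by (intro sum.mono_neutral_cong_left) (auto simp: u_def)
      also have "\<dots> = (\<Sum>k\<in>C. of_int (b k j) * u k * v k) - (\<Sum>k\<in>C. of_int (b k j) * v k)"
        by (simp add: sum_subtractf[symmetric] algebra_simps)
      finally show "(\<Sum>k\<in>Z. of_int (b k j) * ((\<tau> k - 1) * v k)) = 0" using 0[OF j] 1[OF j] by simp
    qed (use ZC C(2) Z(3) n that in auto)
    then show ?thesis using that Z(2) by (auto simp: T'_def)
  qed
  have vG: "v k = 0" if "k \<in> G" for k
  proof (rule generic_supported[where A = G])
    fix j assume j: "j < n - 1"
    have "(\<Sum>k\<in>G. of_int (b k j) * v k) = (\<Sum>k\<in>C. of_int (b k j) * v k)"
      using C(1) vZ by (intro sum.mono_neutral_left) (auto simp: G_def)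
    then show "(\<Sum>k\<in>G. of_int (b k j) * v k) = 0" using 0[OF j] by simp
  qed (use C(2) cG n that in \<open>auto simp: G_def\<close>)
  show False using v(1) vZ vG by (auto simp: G_def)
qed

text \<open>
  Suppose that \<open>(s - 1, s' - 1)\<close> is a multiple of \<open>(t - 1, t' - 1)\<close>. Replacing \<open>t, t'\<close> by their complex
  conjugates while keeping \<open>s, s'\<close> preserves the relation, because the orders are coprime. Then
  \<open>(t - 1, t' - 1)\<close> is parallel to its own conjugate, that is, \<open>1, t, t'\<close> lie on a real line; but a
  line meets the unit circle in at most two points.
\<close>
lemma not_parallel_of_distinct:
  fixes t t' s s' :: complex
  assumes t: "t ^ p = 1" "t' ^ p = 1" and s: "s ^ q = 1" "s' ^ q = 1"
    and pq: "p > 0" "q > 0" "coprime p q"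
    and dist: "t \<noteq> 1" "t' \<noteq> 1" "t \<noteq> t'"
    and ds: "s \<noteq> 1" "s' \<noteq> 1"
  shows "(t - 1) * (s' - 1) \<noteq> (t' - 1) * (s - 1)"
proof
  assume par: "(t - 1) * (s' - 1) = (t' - 1) * (s - 1)"
  define c where "c = (s - 1) / (t - 1)"
  have c: "s - 1 = c * (t - 1)" "s' - 1 = c * (t' - 1)"
    using par dist by (auto simp: c_def field_simps)
  have c0: "c \<noteq> 0" using c ds by auto
  have p2: "p \<ge> 2" using t dist pq(1) by (cases "p = 1") auto
  define \<rho> where "\<rho> = (\<lambda>(a::nat) (k::nat). if a = 0 \<or> k = 0 then 1
      else if k = 1 then (if a = 1 then t else t') else (if a = 1 then s else s'))"
  define \<mu> where "\<mu> = (\<lambda>k::nat. if k = 0 then 1 else if k = 1 then p else q)"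
  define X where "X = (\<lambda>k::nat. {if k = 1 then p - 1 else 1})"
  define z where "z = (\<lambda>k::nat. if k = 0 then c - 1 else if k = 1 then - c else 1)"
  have three: "{..<3::nat} = {0,1,2}" by auto
  have "\<exists>v. (\<exists>k\<in>{..<3::nat}. v k \<noteq> 0) \<and>
    (\<forall>i\<in>{..<3::nat}. (\<Sum>k\<in>{..<3::nat}. of_int 1 * (\<Sum>e\<in>X k. 1 * \<rho> i k ^ e) * v k) = 0)"
  proof (rule singular_root_of_unity_specialize[where \<mu> = \<mu> and ?k0.0 = 2 and z = z])
    show "\<mu> k > 0" for k using pq by (simp add: \<mu>_def)
    show "coprime (\<mu> k) (\<mu> l)" if "k \<in> {..<3}" "l \<in> {..<3}" "k \<noteq> l" for k l
      using that pq(3) by (auto simp: \<mu>_def coprime_commute)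
    show "\<rho> i k ^ \<mu> k = 1" for i k using t s by (simp add: \<rho>_def \<mu>_def)
    show "coprime e (\<mu> k)" if "e \<in> X k" for k e
      using that coprime_diff_one_left_nat[OF pq(1)] by (auto simp: X_def \<mu>_def)
    show "(\<Sum>k\<in>{..<3}. of_int 1 * \<rho> i k * z k) = 0" if "i \<in> {..<3}" for i
    proof -
      have "s = 1 + c * (t - 1)" "s' = 1 + c * (t' - 1)" using c by (simp_all add: algebra_simps)
      then show ?thesis using that unfolding three by (auto simp: \<rho>_def z_def algebra_simps)
    qed
  qed (auto simp: X_def z_def)
  then obtain v where v: "\<exists>k\<in>{..<3::nat}. v k \<noteq> 0"
    "\<And>i. i < 3 \<Longrightarrow> (\<Sum>k\<in>{..<3::nat}. (\<Sum>e\<in>X k. \<rho> i k ^ e) * v k) = 0" by auto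
  have 0: "v 0 + v 1 + v 2 = 0" using v(2)[of 0] unfolding three by (simp add: X_def \<rho>_def algebra_simps)
  have inv: "x ^ (p - 1) = 1 / x" if "x ^ p = 1" for x :: complex
  proof -
    have "x ^ p = x * x ^ (p - 1)" using pq(1) by (metis Suc_diff_1 power_Suc)
    moreover have "x \<noteq> 0" using that pq(1) by (auto simp: zero_power)
    ultimately show ?thesis using that by (simp add: field_simps)
  qed
  have 1: "v 0 + v 1 / t + v 2 * s = 0" using v(2)[of 1] unfolding three
    by (simp add: X_def \<rho>_def inv[OF t(1), simplified] algebra_simps)
  have 2: "v 0 + v 1 / t' + v 2 * s' = 0" using v(2)[of 2] unfolding three
    by (simp add: X_def \<rho>_def inv[OF t(2), simplified] algebra_simps)
  have t0: "t \<noteq> 0" "t' \<noteq> 0" using t pq(1) by (auto simp: zero_power)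
  have A: "v 2 * (c * (t - 1)) = v 1 * (t - 1) / t"
  proof -
    have "v 2 * (s - 1) + (v 1 / t - v 1) = (v 0 + v 1 / t + v 2 * s) - (v 0 + v 1 + v 2)"
      by (simp add: algebra_simps)
    then have "v 2 * (s - 1) = v 1 - v 1 / t" unfolding 0 1 by (simp add: algebra_simps add_eq_0_iff)
    then show ?thesis unfolding c(1) using t0 by (simp add: field_simps)
  qed
  have B: "v 2 * (c * (t' - 1)) = v 1 * (t' - 1) / t'"
  proof -
    have "v 2 * (s' - 1) + (v 1 / t' - v 1) = (v 0 + v 1 / t' + v 2 * s') - (v 0 + v 1 + v 2)"
      by (simp add: algebra_simps)
    then have "v 2 * (s' - 1) = v 1 - v 1 / t'" unfolding 0 2 by (simp add: algebra_simps add_eq_0_iff)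
    then show ?thesis unfolding c(2) using t0 by (simp add: field_simps)
  qed
  have "(t - 1) * (v 2 * c * t - v 1) = 0" using A t0 by (simp add: field_simps)
  then have A': "v 2 * c * t = v 1" using dist by simp
  have "(t' - 1) * (v 2 * c * t' - v 1) = 0" using B t0 by (simp add: field_simps)
  then have B': "v 2 * c * t' = v 1" using dist by simp
  have "v 2 * c * (t - t') = 0" using A' B' by (simp add: algebra_simps)
  then have "v 2 = 0" using c0 dist(3) by simp
  moreover from this have "v 1 = 0" using A' by simp
  ultimately have "v 0 = 0" using 0 by simp
  then show False using v(1) \<open>v 2 = 0\<close> \<open>v 1 = 0\<close> unfolding three by auto
qed

text \<open>
  The columns are now \<open>b k \<otimes> u k\<close> with \<open>u k = (1, \<tau> k, \<sigma> k)\<close>. If 2 and 3 do not divide \<open>M k\<close>, then \<open>(1, 1, 1)\<close>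
  is a combination of the conjugates of \<open>u k\<close> with exponents 1, 2, 4: the cubic with roots
  \<open>1, \<tau> k, \<sigma> k\<close> has a multiple of the form \<open>1 - \<lambda>\<^sub>1 x - \<lambda>\<^sub>2 x\<^sup>2 - \<lambda>\<^sub>4 x\<^sup>4\<close>. In this way \<open>n - 1\<close>
  columns are specialised to \<open>b k \<otimes> (1, 1, 1)\<close>. There remain \<open>n\<close> columns, whose classes
  modulo \<open>(1, 1, 1)\<close> are \<open>b k \<otimes> w k\<close> with \<open>w k = (\<tau> k - 1, \<sigma> k - 1)\<close>. As the \<open>n\<close> vectors \<open>b k\<close> satisfy
  a single relation with all coefficients non-zero, these columns are independent as soon as the
  \<open>w k\<close> are not all parallel. Adding the columns \<open>b k \<otimes> w'\<close> for all but two of these \<open>k\<close>, with \<open>w'\<close>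
  completing \<open>w k\<close> to a basis, makes the system square.
\<close>
lemma no_triple_point:
  assumes n: "n \<ge> 2"
    and \<tau>: "\<And>k. k < N \<Longrightarrow> \<tau> k ^ M k = 1" and \<sigma>: "\<And>k. k < N \<Longrightarrow> \<sigma> k ^ M k = 1"
    and T1: "card {k\<in>{..<N}. \<tau> k \<noteq> 1} \<ge> n" and T2: "card {k\<in>{..<N}. \<sigma> k \<noteq> 1} \<ge> n"
    and T3: "card {k\<in>{..<N}. \<tau> k \<noteq> \<sigma> k} \<ge> n"
    and E: "inE z" "inE (\<lambda>k. \<tau> k * z k)" "inE (\<lambda>k. \<sigma> k * z k)"
    and k0: "k0 < N"
  shows "z k0 = 0"
proof (rule ccontr)
  assume zk: "z k0 \<noteq> 0"
  define T where "T = {k\<in>{..<N}. \<tau> k \<noteq> 1 \<or> \<sigma> k \<noteq> 1}"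
  have T: "finite T" "T \<subseteq> {..<N}" by (auto simp: T_def)
  have cT: "n \<le> card T"
  proof -
    have "card {k\<in>{..<N}. \<tau> k \<noteq> 1} \<le> card T" by (rule card_mono) (auto simp: T_def)
    then show ?thesis using T1 by linarith
  qed
  define par where "par = (\<lambda>p q. (\<tau> p - 1) * (\<sigma> q - 1) = (\<sigma> p - 1) * (\<tau> q - 1))"
  have par_sym: "par p q \<Longrightarrow> par q p" for p q by (auto simp: par_def algebra_simps)
  \<comment> \<open>Parallel vectors occur only within these three classes, and no class exhausts \<open>T\<close>.\<close>
  define cls where "cls = (\<lambda>i::nat. {k\<in>T. if i = 0 then \<sigma> k = 1 else if i = 1 then \<tau> k = 1 else \<tau> k = \<sigma> k})"
  have cls_comp: "n \<le> card (T - cls i)" for i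
  proof -
    have "T - cls i = (if i = 0 then {k\<in>{..<N}. \<sigma> k \<noteq> 1} else if i = 1 then {k\<in>{..<N}. \<tau> k \<noteq> 1}
        else {k\<in>{..<N}. \<tau> k \<noteq> \<sigma> k})"
      by (auto simp: cls_def T_def)
    then show ?thesis using T1 T2 T3 by (simp split: if_splits)
  qed
  have par_cls: "\<exists>i. p \<in> cls i \<and> q \<in> cls i" if pq: "p \<in> T" "q \<in> T" "p \<noteq> q" "par p q" for p q
  proof (cases "\<exists>i. p \<in> cls i \<or> q \<in> cls i")
    case True
    then obtain i where i: "p \<in> cls i \<or> q \<in> cls i" by blast
    have "q \<in> cls i" if "p \<in> cls i" "par p q" "p \<in> T" "q \<in> T" for p q
      using that by (auto simp: cls_def par_def T_def split: if_splits)
    then show ?thesis using i pq par_sym by blast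
  next
    case False
    then have f: "p \<notin> cls i" "q \<notin> cls i" for i by auto
    have d: "\<sigma> p \<noteq> 1" "\<tau> p \<noteq> 1" "\<tau> p \<noteq> \<sigma> p" "\<sigma> q \<noteq> 1" "\<tau> q \<noteq> 1"
      using f[of 0] f[of 1] f[of 2] pq(1,2) by (simp_all add: cls_def)
    have "p < N" "q < N" using pq T by auto
    then have "\<not> par p q" unfolding par_def
      by (intro not_parallel_of_distinct[where p = "M p" and q = "M q"])
         (use \<tau> \<sigma> Mpos Mcop d pq in auto)
    then show ?thesis using pq by simp
  qed
  have nonpar: "\<exists>q\<in>T. q \<noteq> p \<and> \<not> par p q" if p: "p \<in> T" for p
  proof (cases "\<exists>i. p \<in> cls i")
    case True
    then obtain i where i: "p \<in> cls i" by blast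
    obtain q where q: "q \<in> T - cls i" using cls_comp[of i] n by (metis card.empty all_not_in_conv not_numeral_le_zero order_trans)
    have "\<not> par p q"
      using i q by (auto simp: cls_def par_def T_def split: if_splits)
    moreover have "q \<in> T" "q \<noteq> p" using q i by auto
    ultimately show ?thesis by blast
  next
    case False
    have "\<exists>q\<in>T. q \<noteq> p"
    proof (rule ccontr)
      assume "\<not> ?thesis"
      then have "T \<subseteq> {p}" by auto
      then have "card T \<le> 1" using card_mono[of "{p}" T] by simp
      then show False using cT n by simp
    qed
    then show ?thesis using False par_cls[OF p] by blast
  qed
  define X where "X = {k\<in>T. even (M k) \<or> 3 dvd M k}"
  have X: "finite X" "X \<subseteq> T" using T by (auto simp: X_def)
  have cX: "card X \<le> 2"
  proof -
    have "card X \<le> card ({k\<in>{..<N}. 2 dvd M k} \<union> {k\<in>{..<N}. 3 dvd M k})"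
      using T by (intro card_mono) (auto simp: X_def)
    also have "\<dots> \<le> card {k\<in>{..<N}. 2 dvd M k} + card {k\<in>{..<N}. 3 dvd M k}" by (rule card_Un_le)
    also have "\<dots> \<le> 1 + 1" by (intro add_mono card_dvd_M_le_1) auto
    finally show ?thesis by simp
  qed
  \<comment> \<open>All indices in \<open>X\<close> have to stay unspecialised, together with a pair that is not parallel;
    there is room for this among \<open>n\<close> indices.\<close>
  have "\<exists>p q. p \<in> T \<and> q \<in> T \<and> p \<noteq> q \<and> \<not> par p q \<and> card (X \<union> {p,q}) \<le> n"
  proof (cases "card X \<le> 1")
    case True
    have "T \<noteq> {}" using cT n by auto
    then obtain p where p: "p \<in> T" "X \<subseteq> {p}"
      using True X by (cases "X = {}") (auto simp: card_le_Suc0_iff_eq)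
    obtain q where q: "q \<in> T" "q \<noteq> p" "\<not> par p q" using nonpar[OF p(1)] by blast
    have "X \<union> {p,q} = {p,q}" using p(2) by auto
    then have "card (X \<union> {p,q}) \<le> n" using n q by simp
    then show ?thesis using p q by blast
  next
    case False
    then have "card X = 2" using cX by simp
    then obtain p p' where pp: "X = {p,p'}" "p \<noteq> p'" by (auto simp: card_2_iff)
    show ?thesis
    proof (cases "par p p'")
      case False
      have "X \<union> {p,p'} = X" using pp by auto
      then show ?thesis using False pp X cX n by (intro exI[of _ p] exI[of _ p']) auto
    next
      case True
      obtain i where i: "p \<in> cls i" "p' \<in> cls i" using par_cls[OF _ _ pp(2) True] pp X by blast
      have "n \<ge> 3"
      proof (rule ccontr)
        assume "\<not> n \<ge> 3"
        then have "n = 2" using n by simp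
        have "card ((T - cls i) \<union> {p,p'}) \<le> card {..<N}"
          using T pp X by (intro card_mono) auto
        moreover have "card ((T - cls i) \<union> {p,p'}) = card (T - cls i) + card {p,p'}"
          using i T by (intro card_Un_disjoint) auto
        ultimately show False using cls_comp[of i] pp(2) \<open>n = 2\<close> by simp
      qed
      obtain q where q: "q \<in> T" "q \<noteq> p" "\<not> par p q" using nonpar[of p] pp X by blast
      have "X \<union> {p,q} = insert q X" using pp by auto
      moreover have "card (insert q X) \<le> Suc (card X)" using X(1) by (simp add: card_insert_if)
      ultimately have "card (X \<union> {p,q}) \<le> n" using cX \<open>n \<ge> 3\<close> by simp
      then show ?thesis using q pp X by blast
    qed
  qed
  then obtain p q where pq: "p \<in> T" "q \<in> T" "p \<noteq> q" "\<not> par p q" "card (X \<union> {p,q}) \<le> n" by blast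
  obtain Z where Z: "X \<union> {p,q} \<subseteq> Z" "Z \<subseteq> T" "card Z = n"
    using exists_subset_between[OF pq(5) cT _ T(1)] X pq by auto
  have ZN: "finite Z" "Z \<subseteq> {..<N}" using Z T finite_subset by auto
  define G where "G = {..<N} - Z"
  have cG: "card G = n - 1" using ZN Z(3) n by (simp add: G_def card_Diff_subset)
  define Y where "Y = Z - {p,q}"
  have cY: "card Y = n - 2" and finY: "finite Y" using Z pq ZN by (auto simp: Y_def card_Diff_subset)
  define C where "C = (Inl ` {..<N} \<union> Inr ` Y :: (nat + nat) set)"
  have sumC: "(\<Sum>c\<in>C. f c) = (\<Sum>k<N. f (Inl k)) + (\<Sum>k\<in>Y. f (Inr k))" for f :: "nat + nat \<Rightarrow> complex"
  proof -
    have "(\<Sum>c\<in>C. f c) = (\<Sum>c\<in>Inl ` {..<N}. f c) + (\<Sum>c\<in>Inr ` Y. f c)"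
      unfolding C_def using finY by (intro sum.union_disjoint) auto
    then show ?thesis by (simp add: sum.reindex)
  qed
  define R where "R = {..<n-1} \<times> {..<3::nat}"
  define x where "x = (\<lambda>(a::nat) k. if a = (if \<tau> k \<noteq> 1 then 2 else 1) then 1 else (0::int))"
  define h where "h = (\<lambda>(j,a). case_sum (\<lambda>k. b k j) (\<lambda>k. b k j * x a k))"
  define \<rho> where "\<rho> = (\<lambda>(j::nat,a::nat). case_sum (\<lambda>k. if a = 0 then 1 else if a = 1 then \<tau> k else \<sigma> k) (\<lambda>k::nat. 1))"
  define \<mu> where "\<mu> = case_sum M (\<lambda>k::nat. 1)"
  define triv where "triv = (\<lambda>k. k \<in> Z \<or> (\<tau> k = 1 \<and> \<sigma> k = 1))"
  define Ex where "Ex = case_sum (\<lambda>k. if triv k then {1} else {1,2,4::nat}) (\<lambda>k::nat. {1})"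
  define s1 where "s1 = (\<lambda>k. 1 + \<tau> k + \<sigma> k)"
  define s2 where "s2 = (\<lambda>k. \<tau> k + \<sigma> k + \<tau> k * \<sigma> k)"
  define s3 where "s3 = (\<lambda>k. \<tau> k * \<sigma> k)"
  \<comment> \<open>\<open>1 + (x - 1) (x - \<tau>) (x - \<sigma>) (q0 + q1 x)\<close> has neither a constant nor a cubic term.\<close>
  define q0 where "q0 = (\<lambda>k. 1 / s3 k)"
  define q1 where "q1 = (\<lambda>k. q0 k / s1 k)"
  define l where "l = case_sum (\<lambda>k e. if triv k then 1 else if e = (1::nat) then s2 k * q0 k - s3 k * q1 k
      else if e = 2 then s2 k * q1 k - s1 k * q0 k else q1 k) (\<lambda>(k::nat) e. 1)"
  have \<tau>0: "\<tau> k \<noteq> 0" "\<sigma> k \<noteq> 0" if "k < N" for k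
    using \<tau>[OF that] \<sigma>[OF that] Mpos[OF that] by (auto simp: zero_power)
  have notX: "odd (M k)" "\<not> 3 dvd M k" if "k < N" "\<not> triv k" for k
    using that Z(1) by (auto simp: triv_def X_def T_def)
  have cC: "card C = 3 * (n - 1)"
  proof -
    have "card C = card (Inl ` {..<N} :: (nat+nat) set) + card (Inr ` Y :: (nat+nat) set)"
      unfolding C_def using finY by (intro card_Un_disjoint) auto
    then show ?thesis using cY n by (simp add: card_image)
  qed
  have "\<exists>v. (\<exists>c\<in>C. v c \<noteq> 0) \<and>
    (\<forall>i\<in>R. (\<Sum>c\<in>C. of_int (h i c) * (\<Sum>e\<in>Ex c. l c e * \<rho> i c ^ e) * v c) = 0)"
  proof (rule singular_root_of_unity_specialize[where \<mu> = \<mu> and ?k0.0 = "Inl k0" and z = "case_sum z (\<lambda>_. 0)"])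
    show "card R = card C" using cC by (simp add: R_def)
    show "\<mu> c > 0" if "c \<in> C" for c using that Mpos by (auto simp: \<mu>_def C_def)
    show "coprime (\<mu> c) (\<mu> d)" if "c \<in> C" "d \<in> C" "c \<noteq> d" for c d
      using that by (auto simp: \<mu>_def C_def) (metis Mcop One_nat_def)
    show "\<rho> i c ^ \<mu> c = 1" if "i \<in> R" "c \<in> C" for i c
      using that \<tau> \<sigma> by (cases i) (auto simp: \<rho>_def C_def \<mu>_def)
    show "coprime e (\<mu> c)" if c: "c \<in> C" "e \<in> Ex c" for c e
    proof (cases c)
      case (Inl k)
      then have k: "k < N" using c by (auto simp: C_def)
      show ?thesis
      proof (cases "triv k")
        case False
        have "coprime 2 (M k)" using notX[OF k False] by simp
        moreover from this have "coprime (2 ^ 2) (M k)" by (simp only: coprime_power_left_iff) simp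
        ultimately show ?thesis using c False Inl by (auto simp: Ex_def \<mu>_def)
      qed (use c Inl in \<open>simp add: Ex_def \<mu>_def\<close>)
    qed (use c in \<open>simp add: Ex_def \<mu>_def\<close>)
    show "finite (Ex c)" for c by (cases c) (auto simp: Ex_def)
    show "(\<Sum>c\<in>C. of_int (h i c) * \<rho> i c * case_sum z (\<lambda>_. 0) c) = 0" if "i \<in> R" for i
    proof -
      obtain j a where i: "i = (j,a)" by (cases i)
      have j: "j < n - 1" using that i by (auto simp: R_def)
      consider "a = 0" | "a = 1" | "a \<noteq> 0" "a \<noteq> 1" by blast
      then show ?thesis unfolding sumC using E j
        by cases (simp_all add: i h_def \<rho>_def inE_def mult.assoc)
    qed
  qed (use k0 zk finY in \<open>auto simp: C_def R_def\<close>)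
  then obtain v where v: "\<exists>c\<in>C. v c \<noteq> 0"
    "\<And>i. i \<in> R \<Longrightarrow> (\<Sum>c\<in>C. of_int (h i c) * (\<Sum>e\<in>Ex c. l c e * \<rho> i c ^ e) * v c) = 0" by blast
  define u where "u = (\<lambda>(a::nat) k. if a = 0 then 1 else if k \<in> Z then (if a = 1 then \<tau> k else \<sigma> k) else 1)"
  have P: "(\<Sum>e\<in>Ex (Inl k). l (Inl k) e * \<rho> (j,a) (Inl k) ^ e) = u a k" if k: "k < N" for j a k
  proof (cases "triv k")
    case True
    then show ?thesis by (auto simp: Ex_def l_def \<rho>_def u_def triv_def)
  next
    case False
    define r where "r = (if a = 0 then 1 else if a = 1 then \<tau> k else \<sigma> k)"
    have s: "s1 k \<noteq> 0" "s3 k \<noteq> 0"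
      using one_plus_roots_of_unity_nonzero[OF \<tau>[OF k] \<sigma>[OF k] Mpos[OF k] notX(2)[OF k False]] \<tau>0[OF k]
      by (auto simp: s1_def s3_def)
    have q: "s3 k * q0 k = 1" "s1 k * q1 k = q0 k" using s by (auto simp: q0_def q1_def)
    have "(r - 1) * (r - \<tau> k) * (r - \<sigma> k) = 0" by (auto simp: r_def)
    then have "r ^ 3 - s1 k * r ^ 2 + s2 k * r - s3 k = 0"
      by (simp add: s1_def s2_def s3_def power2_eq_square power3_eq_cube algebra_simps)
    then have "(q0 k + q1 k * r) * (r ^ 3 - s1 k * r ^ 2 + s2 k * r - s3 k) = 0" by simp
    moreover have "(q0 k + q1 k * r) * (r ^ 3 - s1 k * r ^ 2 + s2 k * r - s3 k) =
        (s2 k * q0 k - s3 k * q1 k) * r + (s2 k * q1 k - s1 k * q0 k) * r ^ 2 + (q0 k - s1 k * q1 k) * r ^ 3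
        + q1 k * r ^ 4 - s3 k * q0 k"
      by (simp add: eval_nat_numeral algebra_simps)
    ultimately have "(s2 k * q0 k - s3 k * q1 k) * r + (s2 k * q1 k - s1 k * q0 k) * r ^ 2 + q1 k * r ^ 4 = 1"
      unfolding q by (simp add: algebra_simps)
    moreover have "(\<Sum>e\<in>Ex (Inl k). l (Inl k) e * \<rho> (j,a) (Inl k) ^ e) =
        (s2 k * q0 k - s3 k * q1 k) * r + (s2 k * q1 k - s1 k * q0 k) * r ^ 2 + q1 k * r ^ 4"
      using False by (simp add: Ex_def l_def \<rho>_def r_def)
    moreover have "u a k = 1" using False by (simp add: u_def triv_def)
    ultimately show ?thesis by simp
  qed
  have eq: "(\<Sum>k<N. of_int (b k j) * (u a k * v (Inl k))) + (\<Sum>k\<in>Y. of_int (b k j) * (of_int (x a k) * v (Inr k))) = 0"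
    if "j < n - 1" "a < 3" for j a
  proof -
    have "(\<Sum>c\<in>C. of_int (h (j,a) c) * (\<Sum>e\<in>Ex c. l c e * \<rho> (j,a) c ^ e) * v c) = 0"
      using v(2)[of "(j,a)"] that by (simp add: R_def)
    moreover have "(\<Sum>c\<in>C. of_int (h (j,a) c) * (\<Sum>e\<in>Ex c. l c e * \<rho> (j,a) c ^ e) * v c) =
      (\<Sum>k<N. of_int (b k j) * (u a k * v (Inl k))) + (\<Sum>k\<in>Y. of_int (b k j) * (of_int (x a k) * v (Inr k)))"
      unfolding sumC using P by (simp add: h_def Ex_def l_def \<rho>_def mult.assoc)
    ultimately show ?thesis by simp
  qed
  define w where "w = (\<lambda>a k. (u a k - 1) * v (Inl k) + (if k \<in> Y then of_int (x a k) * v (Inr k) else 0))"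
  have wZ: "(\<Sum>k\<in>Z. of_int (b k j) * w a k) = 0" if ja: "j < n - 1" "a < 3" for j a
  proof -
    have 0: "(\<Sum>k<N. of_int (b k j) * v (Inl k)) = 0"
      using eq[OF ja(1), of 0] by (simp add: u_def x_def split: if_splits)
    have "(\<Sum>k\<in>Z. of_int (b k j) * w a k) = (\<Sum>k\<in>Z. of_int (b k j) * ((u a k - 1) * v (Inl k)))
        + (\<Sum>k\<in>Z. of_int (b k j) * (if k \<in> Y then of_int (x a k) * v (Inr k) else 0))"
      unfolding sum.distrib[symmetric] by (rule sum.cong) (auto simp: w_def distrib_left)
    also have "(\<Sum>k\<in>Z. of_int (b k j) * ((u a k - 1) * v (Inl k))) = (\<Sum>k<N. of_int (b k j) * ((u a k - 1) * v (Inl k)))"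
      using ZN by (intro sum.mono_neutral_left) (auto simp: u_def)
    also have "\<dots> = (\<Sum>k<N. of_int (b k j) * (u a k * v (Inl k))) - (\<Sum>k<N. of_int (b k j) * v (Inl k))"
      by (simp add: sum_subtractf[symmetric] algebra_simps)
    also have "(\<Sum>k\<in>Z. of_int (b k j) * (if k \<in> Y then of_int (x a k) * v (Inr k) else 0)) =
        (\<Sum>k\<in>Y. of_int (b k j) * (of_int (x a k) * v (Inr k)))"
      using ZN by (intro sum.mono_neutral_cong_right) (auto simp: Y_def)
    finally show ?thesis using 0 eq[OF ja] by simp
  qed
  have supp: "y k = 0" if y: "\<And>j. j < n - 1 \<Longrightarrow> (\<Sum>k\<in>Z. of_int (b k j) * y k) = 0" "y p' = 0" "p' \<in> Z" "k \<in> Z"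
    for y :: "nat \<Rightarrow> complex" and p' k
  proof (cases "k = p'")
    case False
    show ?thesis
    proof (rule generic_supported[where A = "Z - {p'}"])
      fix j assume "j < n - 1"
      then have "(\<Sum>k\<in>Z. of_int (b k j) * y k) = 0" by (rule y(1))
      then show "(\<Sum>k\<in>Z - {p'}. of_int (b k j) * y k) = 0" using y(2,3) ZN by (simp add: sum_diff1)
    qed (use ZN Z y False n in auto)
  qed (use y in simp)
  have pqZ: "p \<in> Z" "q \<in> Z" "p \<notin> Y" "q \<notin> Y" using Z by (auto simp: Y_def)
  have w12: "w 1 k = (\<tau> k - 1) * v (Inl k) + (if k \<in> Y \<and> \<tau> k = 1 then v (Inr k) else 0)"
    "w 2 k = (\<sigma> k - 1) * v (Inl k) + (if k \<in> Y \<and> \<tau> k \<noteq> 1 then v (Inr k) else 0)" if "k \<in> Z" for k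
    using that by (auto simp: w_def u_def x_def)
  \<comment> \<open>The combination that vanishes at \<open>p\<close> is supported on \<open>n - 1\<close> indices, hence zero; likewise for \<open>q\<close>.\<close>
  have cross: "(\<sigma> p - 1) * w 1 k = (\<tau> p - 1) * w 2 k" "(\<sigma> q - 1) * w 1 k = (\<tau> q - 1) * w 2 k" if "k \<in> Z" for k
  proof -
    have "(\<sigma> r - 1) * w 1 k - (\<tau> r - 1) * w 2 k = 0" if r: "r \<in> {p,q}" for r
    proof (rule supp[where p' = r])
      fix j assume j: "j < n - 1"
      have "(\<Sum>k\<in>Z. of_int (b k j) * ((\<sigma> r - 1) * w 1 k - (\<tau> r - 1) * w 2 k)) =
        (\<sigma> r - 1) * (\<Sum>k\<in>Z. of_int (b k j) * w 1 k) - (\<tau> r - 1) * (\<Sum>k\<in>Z. of_int (b k j) * w 2 k)"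
        unfolding sum_distrib_left sum_subtractf[symmetric] by (rule sum.cong) (auto simp: algebra_simps)
      then show "(\<Sum>k\<in>Z. of_int (b k j) * ((\<sigma> r - 1) * w 1 k - (\<tau> r - 1) * w 2 k)) = 0"
        using wZ[OF j, of 1] wZ[OF j, of 2] by simp
    qed (use r pqZ \<open>k \<in> Z\<close> in \<open>auto simp: w12 simp del: One_nat_def\<close>)
    then show "(\<sigma> p - 1) * w 1 k = (\<tau> p - 1) * w 2 k" "(\<sigma> q - 1) * w 1 k = (\<tau> q - 1) * w 2 k" by auto
  qed
  have w0: "w 1 k = 0" "w 2 k = 0" if k: "k \<in> Z" for k
  proof -
    define D where "D = (\<tau> p - 1) * (\<sigma> q - 1) - (\<sigma> p - 1) * (\<tau> q - 1)"
    have D: "D \<noteq> 0" using pq(4) by (simp add: D_def par_def)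
    have "D * w 1 k = (\<tau> p - 1) * ((\<sigma> q - 1) * w 1 k) - (\<tau> q - 1) * ((\<sigma> p - 1) * w 1 k)"
      by (simp add: D_def algebra_simps)
    also have "\<dots> = 0" unfolding cross[OF k] by (simp add: algebra_simps)
    finally show "w 1 k = 0" using D by simp
    have "D * w 2 k = (\<sigma> q - 1) * ((\<tau> p - 1) * w 2 k) - (\<sigma> p - 1) * ((\<tau> q - 1) * w 2 k)"
      by (simp add: D_def algebra_simps)
    also have "\<dots> = 0" unfolding cross[OF k, symmetric] by (simp add: algebra_simps)
    finally show "w 2 k = 0" using D by simp
  qed
  have vZ: "v (Inl k) = 0" if "k \<in> Z" for k
    using w0[OF that] that Z(2) unfolding w12[OF that] by (cases "\<tau> k = 1") (auto simp: T_def)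
  have vY: "v (Inr k) = 0" if "k \<in> Y" for k
  proof -
    have k: "k \<in> Z" using that by (simp add: Y_def)
    show ?thesis using w0[OF k] that unfolding w12[OF k] vZ[OF k] by (cases "\<tau> k = 1") auto
  qed
  have vG: "v (Inl k) = 0" if "k \<in> G" for k
  proof (rule generic_supported[where A = G and z = "\<lambda>k. v (Inl k)"])
    fix j assume j: "j < n - 1"
    have "(\<Sum>k\<in>G. of_int (b k j) * v (Inl k)) = (\<Sum>k<N. of_int (b k j) * (u 0 k * v (Inl k)))"
      using vZ by (intro sum.mono_neutral_cong_left) (auto simp: G_def u_def)
    then show "(\<Sum>k\<in>G. of_int (b k j) * v (Inl k)) = 0" using eq[OF j, of 0] vY by simp
  qed (use cG n that in \<open>auto simp: G_def\<close>)
  have "v c = 0" if "c \<in> C" for c using that vZ vY vG by (auto simp: C_def G_def)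
  then show False using v(1) by blast
qed

end

section \<open>Holomorphic maps in sequence spaces\<close>

text \<open>
  The sum norm. It makes the bounds for sums over coordinates immediate.
\<close>
definition nrm :: "nat \<Rightarrow> (nat \<Rightarrow> complex) \<Rightarrow> real" where
  "nrm n x = (\<Sum>i<n. cmod (x i))"

lemma nrm_nonneg [simp]: "nrm n x \<ge> 0"
  by (simp add: nrm_def sum_nonneg)

lemma nrm_add: "nrm n (\<lambda>i. x i + y i) \<le> nrm n x + nrm n y"
  unfolding nrm_def sum.distrib[symmetric] by (rule sum_mono) (rule norm_triangle_ineq)

lemma nrm_diff: "nrm n (\<lambda>i. x i - y i) \<le> nrm n x + nrm n y"
  unfolding nrm_def sum.distrib[symmetric] by (rule sum_mono) (rule norm_triangle_ineq4)

lemma nrm_triangle: "nrm n (x - z) \<le> nrm n (x - y) + nrm n (y - z)"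
  using nrm_add[of n "x - y" "y - z"] by (simp add: fun_diff_def)

lemma nrm_commute: "nrm n (x - y) = nrm n (y - x)"
  by (simp add: nrm_def norm_minus_commute)

lemma nrm_scale: "nrm n (\<lambda>i. c * x i) = cmod c * nrm n x"
  by (simp add: nrm_def norm_mult sum_distrib_left)

lemma nrm_cong: "(\<And>i. i < n \<Longrightarrow> x i = y i) \<Longrightarrow> nrm n x = nrm n y"
  by (simp add: nrm_def)

lemma norm_le_nrm: "i < n \<Longrightarrow> cmod (x i) \<le> nrm n x"
  unfolding nrm_def by (rule member_le_sum) auto

lemma nrm_diff_self [simp]: "nrm n (x - x) = 0"
  by (simp add: nrm_def)

lemma nrm_eq_0D:
  assumes "nrm n (x - y) = 0" "x \<in> cspace n" "y \<in> cspace n"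
  shows "x = y"
proof
  fix i show "x i = y i"
  proof (cases "i < n")
    case True
    then have "cmod ((x - y) i) \<le> 0" using norm_le_nrm[of i n "x - y"] assms by simp
    then show ?thesis by simp
  qed (use assms in \<open>simp add: cspace_def\<close>)
qed

lemma cspaceD: "x \<in> cspace n \<Longrightarrow> i \<ge> n \<Longrightarrow> x i = 0"
  by (simp add: cspace_def)

lemma cspace_diff [simp]: "x \<in> cspace n \<Longrightarrow> y \<in> cspace n \<Longrightarrow> x - y \<in> cspace n"
  by (simp add: cspace_def)

lemma cspace_add_scale [simp]: "x \<in> cspace n \<Longrightarrow> y \<in> cspace n \<Longrightarrow> (\<lambda>i. x i + c * y i) \<in> cspace n"
  by (simp add: cspace_def)

lemma copen_cspace: "copen n (cspace n)"
  by (simp add: openin_subtopology_self)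

lemma copen_subset: "copen n U \<Longrightarrow> U \<subseteq> cspace n"
  by (rule openin_imp_subset)

lemma continuous_on_nrm: "continuous_on S (\<lambda>x. nrm n (x - a))"
  unfolding nrm_def minus_apply
  by (intro continuous_intros continuous_on_subset[OF continuous_on_product_coordinates]) auto

lemma copen_ball: "copen n {x \<in> cspace n. nrm n (x - a) < e}"
proof -
  have "copen n (cspace n \<inter> (\<lambda>x. nrm n (x - a)) -` {..<e})"
    by (rule continuous_openin_preimage_gen[OF continuous_on_nrm]) simp
  also have "cspace n \<inter> (\<lambda>x. nrm n (x - a)) -` {..<e} = {x \<in> cspace n. nrm n (x - a) < e}" by auto
  finally show ?thesis .
qed

lemma copen_contains_ball:
  assumes "copen n U" "a \<in> U"
  obtains e where "e > 0" "\<And>x. x \<in> cspace n \<Longrightarrow> nrm n (x - a) < e \<Longrightarrow> x \<in> U"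
proof -
  obtain T where T: "open T" "U = cspace n \<inter> T" using assms(1) by (auto simp: openin_open)
  have a: "a \<in> cspace n" "a \<in> T" using assms(2) T by auto
  obtain X where X: "a \<in> PiE UNIV X" "\<And>i. open (X i)" "PiE UNIV X \<subseteq> T"
    using product_topology_open_contains_basis[of "\<lambda>_. euclidean" UNIV T a] T(1) a(2)
    by (auto simp: open_fun_def)
  have "\<exists>e>0. \<forall>w. dist w (a i) < e \<longrightarrow> w \<in> X i" for i
    using X(1,2) by (auto simp: PiE_iff open_dist)
  then obtain r where r: "\<And>i. r i > 0" "\<And>i w. dist w (a i) < r i \<Longrightarrow> w \<in> X i" by metis
  define e where "e = Min (insert 1 (r ` {..<n}))"
  have e: "e > 0" "\<And>i. i < n \<Longrightarrow> e \<le> r i" using r(1) by (auto simp: e_def)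
  have "x \<in> U" if x: "x \<in> cspace n" "nrm n (x - a) < e" for x
  proof -
    have "x i \<in> X i" for i
    proof (cases "i < n")
      case True
      have "dist (x i) (a i) \<le> nrm n (x - a)" using norm_le_nrm[OF True, of "x - a"] by (simp add: dist_norm)
      then show ?thesis using e(2)[OF True] x(2) by (intro r(2)) linarith
    next
      case False
      then have "x i = a i" using x(1) a(1) by (simp add: cspace_def)
      then show ?thesis using X(1) by (auto simp: PiE_iff)
    qed
    then show ?thesis using X(3) x(1) T(2) by (auto simp: PiE_iff)
  qed
  then show ?thesis using e(1) that by blast
qed

lemma copenI:
  assumes "U \<subseteq> cspace n" "\<And>a. a \<in> U \<Longrightarrow> \<exists>e>0. \<forall>x\<in>cspace n. nrm n (x - a) < e \<longrightarrow> x \<in> U"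
  shows "copen n U"
proof (subst openin_subopen, intro ballI)
  fix a assume a: "a \<in> U"
  then obtain e where e: "e > 0" "\<And>x. x \<in> cspace n \<Longrightarrow> nrm n (x - a) < e \<Longrightarrow> x \<in> U" using assms(2) by blast
  show "\<exists>T. copen n T \<and> a \<in> T \<and> T \<subseteq> U"
    by (rule exI[of _ "{x \<in> cspace n. nrm n (x - a) < e}"]) (use e a assms(1) copen_ball in auto)
qed

text \<open>
  From here on all limits in the product topology are handled by the norm.
\<close>
lemma eventually_at_cspace:
  assumes "a \<in> cspace n"
  shows "eventually P (at a within cspace n) \<longleftrightarrow>
    (\<exists>d>0. \<forall>x\<in>cspace n. x \<noteq> a \<and> nrm n (x - a) < d \<longrightarrow> P x)"
proof
  assume "eventually P (at a within cspace n)"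
  then obtain T where T: "open T" "a \<in> T" "\<And>x. x \<in> T \<Longrightarrow> x \<noteq> a \<Longrightarrow> x \<in> cspace n \<Longrightarrow> P x"
    by (auto simp: eventually_at_topological)
  have "copen n (cspace n \<inter> T)" using T(1) by (simp add: openin_open_Int)
  then obtain d where "d > 0" "\<And>x. x \<in> cspace n \<Longrightarrow> nrm n (x - a) < d \<Longrightarrow> x \<in> cspace n \<inter> T"
    using copen_contains_ball[of n "cspace n \<inter> T" a] T(2) assms by blast
  then show "\<exists>d>0. \<forall>x\<in>cspace n. x \<noteq> a \<and> nrm n (x - a) < d \<longrightarrow> P x" using T(3) by blast
next
  assume "\<exists>d>0. \<forall>x\<in>cspace n. x \<noteq> a \<and> nrm n (x - a) < d \<longrightarrow> P x"
  then obtain d where d: "d > 0" "\<And>x. x \<in> cspace n \<Longrightarrow> x \<noteq> a \<Longrightarrow> nrm n (x - a) < d \<Longrightarrow> P x" by blast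
  obtain T where "open T" "{x \<in> cspace n. nrm n (x - a) < d} = cspace n \<inter> T"
    using copen_ball[of n a d] by (auto simp: openin_open)
  then show "eventually P (at a within cspace n)"
    unfolding eventually_at_topological using d assms by (intro exI[of _ T]) auto
qed

lemma L2_le_nrm: "L2_set (\<lambda>i. cmod (x i)) {..<n} \<le> nrm n x"
  unfolding nrm_def by (rule L2_set_le_sum) auto

lemma nrm_le_L2: "nrm n x \<le> real n * L2_set (\<lambda>i. cmod (x i)) {..<n}"
proof -
  have "nrm n x \<le> (\<Sum>i<n. L2_set (\<lambda>i. cmod (x i)) {..<n})"
    unfolding nrm_def by (rule sum_mono) (rule member_le_L2_set, auto)
  then show ?thesis by simp
qed

lemma has_cgradient_iff:
  assumes a: "a \<in> cspace n"
  shows "has_cgradient n g c a \<longleftrightarrow> (\<forall>e>0. \<exists>d>0. \<forall>x\<in>cspace n. nrm n (x - a) < d \<longrightarrow>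
    cmod (g x - g a - (\<Sum>i<n. c i * (x i - a i))) \<le> e * nrm n (x - a))" (is "_ \<longleftrightarrow> ?rhs")
proof -
  let ?R = "\<lambda>x. g x - g a - (\<Sum>i<n. c i * (x i - a i))"
  let ?L = "\<lambda>x. L2_set (\<lambda>i. cmod (x i - a i)) {..<n}"
  have L: "?L x \<le> nrm n (x - a)" "nrm n (x - a) \<le> real n * ?L x" for x
    using L2_le_nrm[of "x - a" n] nrm_le_L2[of n "x - a"] by auto
  have L0: "?L x \<ge> 0" for x by simp
  have pos: "?L x > 0" if "x \<in> cspace n" "x \<noteq> a" for x
  proof (rule ccontr)
    assume "\<not> ?L x > 0"
    then have "?L x = 0" using L0[of x] by linarith
    then have "nrm n (x - a) = 0" using L(2)[of x] nrm_nonneg[of n "x - a"] by simp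
    then show False using nrm_eq_0D a that by blast
  qed
  have "has_cgradient n g c a \<longleftrightarrow> (\<forall>e>0. \<exists>d>0. \<forall>x\<in>cspace n. x \<noteq> a \<and> nrm n (x - a) < d \<longrightarrow> cmod (?R x) / ?L x < e)"
    unfolding has_cgradient_def tendsto_iff eventually_at_cspace[OF a]
    by (simp add: norm_divide)
  also have "\<dots> \<longleftrightarrow> ?rhs"
  proof (intro iffI allI impI)
    fix e :: real assume e: "e > 0" and
      H: "\<forall>e>0. \<exists>d>0. \<forall>x\<in>cspace n. x \<noteq> a \<and> nrm n (x - a) < d \<longrightarrow> cmod (?R x) / ?L x < e"
    obtain d where d: "d > 0" "\<And>x. x \<in> cspace n \<Longrightarrow> x \<noteq> a \<Longrightarrow> nrm n (x - a) < d \<Longrightarrow> cmod (?R x) / ?L x < e"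
      using H e by blast
    have "cmod (?R x) \<le> e * nrm n (x - a)" if x: "x \<in> cspace n" "nrm n (x - a) < d" for x
    proof (cases "x = a")
      case False
      have "cmod (?R x) \<le> e * ?L x"
        using d(2)[OF x(1) False x(2)] pos[OF x(1) False] by (simp add: pos_divide_less_eq)
      also have "\<dots> \<le> e * nrm n (x - a)" using L(1) e by (intro mult_left_mono) auto
      finally show ?thesis .
    qed simp
    then show "\<exists>d>0. \<forall>x\<in>cspace n. nrm n (x - a) < d \<longrightarrow> cmod (?R x) \<le> e * nrm n (x - a)"
      using d(1) by blast
  next
    fix e :: real assume e: "e > 0" and
      H: "\<forall>e>0. \<exists>d>0. \<forall>x\<in>cspace n. nrm n (x - a) < d \<longrightarrow> cmod (?R x) \<le> e * nrm n (x - a)"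
    define e' where "e' = e / (real n + 1)"
    have e': "e' > 0" using e by (simp add: e'_def)
    obtain d where d: "d > 0" "\<And>x. x \<in> cspace n \<Longrightarrow> nrm n (x - a) < d \<Longrightarrow> cmod (?R x) \<le> e' * nrm n (x - a)"
      using H e' by blast
    have "cmod (?R x) / ?L x < e" if x: "x \<in> cspace n" "x \<noteq> a" "nrm n (x - a) < d" for x
    proof -
      have "cmod (?R x) \<le> e' * nrm n (x - a)" using d(2) x by blast
      also have "\<dots> \<le> e' * (real n * ?L x)" using L(2) e' by (intro mult_left_mono) auto
      also have "\<dots> = (e' * real n) * ?L x" by simp
      also have "\<dots> < e * ?L x"
      proof (rule mult_strict_right_mono)
        have "e' * real n < e' * (real n + 1)" using e' by simp
        also have "\<dots> = e" by (simp add: e'_def)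
        finally show "e' * real n < e" .
      qed (rule pos[OF x(1,2)])
      finally show ?thesis using pos[OF x(1,2)] by (simp add: pos_divide_less_eq)
    qed
    then show "\<exists>d>0. \<forall>x\<in>cspace n. x \<noteq> a \<and> nrm n (x - a) < d \<longrightarrow> cmod (?R x) / ?L x < e"
      using d(1) by blast
  qed
  finally show ?thesis .
qed

lemma has_cgradientD:
  assumes "a \<in> cspace n" "has_cgradient n g c a" "e > 0"
  obtains d where "d > 0" "\<And>x. x \<in> cspace n \<Longrightarrow> nrm n (x - a) < d \<Longrightarrow>
    cmod (g x - g a - (\<Sum>i<n. c i * (x i - a i))) \<le> e * nrm n (x - a)"
  using assms(2,3) unfolding has_cgradient_iff[OF assms(1)] by blast

definition cdiff :: "nat \<Rightarrow> ((nat \<Rightarrow> complex) \<Rightarrow> complex) \<Rightarrow> (nat \<Rightarrow> complex) \<Rightarrow> bool" where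
  "cdiff n g a \<longleftrightarrow> (\<exists>c. has_cgradient n g c a)"

lemma has_cgradient_cong:
  assumes "a \<in> cspace n" "r > 0" "\<And>x. x \<in> cspace n \<Longrightarrow> nrm n (x - a) < r \<Longrightarrow> g x = h x"
  shows "has_cgradient n g c a \<longleftrightarrow> has_cgradient n h c a"
proof -
  have "has_cgradient n g c a" if H: "has_cgradient n h c a" and gh: "\<And>x. x \<in> cspace n \<Longrightarrow> nrm n (x - a) < r \<Longrightarrow> g x = h x" for g h
    unfolding has_cgradient_iff[OF assms(1)]
  proof (intro allI impI)
    fix e :: real assume "e > 0"
    then obtain d where d: "d > 0" "\<And>x. x \<in> cspace n \<Longrightarrow> nrm n (x - a) < d \<Longrightarrow>
      cmod (h x - h a - (\<Sum>i<n. c i * (x i - a i))) \<le> e * nrm n (x - a)"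
      using H unfolding has_cgradient_iff[OF assms(1)] by blast
    have "g a = h a" using gh assms(1,2) by simp
    then show "\<exists>d>0. \<forall>x\<in>cspace n. nrm n (x - a) < d \<longrightarrow>
      cmod (g x - g a - (\<Sum>i<n. c i * (x i - a i))) \<le> e * nrm n (x - a)"
      using d gh assms(2) by (intro exI[of _ "min d r"]) auto
  qed
  from this[of g h] this[of h g] show ?thesis using assms(3) by auto
qed

lemma has_cgradient_const: "a \<in> cspace n \<Longrightarrow> has_cgradient n (\<lambda>x. k) (\<lambda>_. 0) a"
  by (auto simp: has_cgradient_iff intro!: exI[of _ 1])

lemma has_cgradient_coord:
  assumes "a \<in> cspace n"
  shows "has_cgradient n (\<lambda>x. x i) (\<lambda>k. if k = i then 1 else 0) a"
proof -
  have "x i - a i - (\<Sum>k<n. (if k = i then 1 else 0) * (x k - a k)) = 0" if "x \<in> cspace n" for x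
  proof -
    have "(\<Sum>k<n. (if k = i then 1 else 0) * (x k - a k)) = (\<Sum>k<n. if k = i then x k - a k else 0)"
      by (rule sum.cong) auto
    also have "\<dots> = x i - a i" using that assms by (auto simp: cspace_def)
    finally show ?thesis by simp
  qed
  then show ?thesis using assms by (auto simp: has_cgradient_iff intro!: exI[of _ 1])
qed

lemma has_cgradient_add:
  assumes a: "a \<in> cspace n" and g: "has_cgradient n g c a" and h: "has_cgradient n h d a"
  shows "has_cgradient n (\<lambda>x. g x + h x) (\<lambda>i. c i + d i) a"
proof -
  have "((\<lambda>x. (g x - g a - (\<Sum>i<n. c i * (x i - a i))) / of_real (L2_set (\<lambda>i. cmod (x i - a i)) {..<n})
     + (h x - h a - (\<Sum>i<n. d i * (x i - a i))) / of_real (L2_set (\<lambda>i. cmod (x i - a i)) {..<n})) \<longlongrightarrow> 0 + 0)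
     (at a within cspace n)"
    using g h unfolding has_cgradient_def by (rule tendsto_add)
  moreover have "(g x - g a - (\<Sum>i<n. c i * (x i - a i))) / L + (h x - h a - (\<Sum>i<n. d i * (x i - a i))) / L
      = (g x + h x - (g a + h a) - (\<Sum>i<n. (c i + d i) * (x i - a i))) / L" for x and L :: complex
    unfolding add_divide_distrib[symmetric] distrib_right sum.distrib by (simp add: algebra_simps)
  ultimately show ?thesis unfolding has_cgradient_def by simp
qed

lemma sum_bound:
  "cmod (\<Sum>i<n. c i * v i) \<le> (\<Sum>i<n. cmod (c i)) * nrm n v"
proof -
  have "cmod (\<Sum>i<n. c i * v i) \<le> (\<Sum>i<n. cmod (c i) * cmod (v i))"
    by (rule order_trans[OF norm_sum]) (simp add: norm_mult)
  also have "\<dots> \<le> (\<Sum>i<n. cmod (c i) * nrm n v)"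
    by (intro sum_mono mult_left_mono) (auto intro: norm_le_nrm)
  finally show ?thesis by (simp add: sum_distrib_right)
qed

lemma has_cgradient_lipschitz:
  assumes a: "a \<in> cspace n" and g: "has_cgradient n g c a"
  obtains d K where "d > 0" "K > 0" "\<And>x. x \<in> cspace n \<Longrightarrow> nrm n (x - a) < d \<Longrightarrow> cmod (g x - g a) \<le> K * nrm n (x - a)"
proof -
  obtain d where d: "d > 0" "\<And>x. x \<in> cspace n \<Longrightarrow> nrm n (x - a) < d \<Longrightarrow>
      cmod (g x - g a - (\<Sum>i<n. c i * (x i - a i))) \<le> 1 * nrm n (x - a)"
    using has_cgradientD[OF a g, of 1] by auto
  define K where "K = 1 + (\<Sum>i<n. cmod (c i))"
  have "K > 0" unfolding K_def by (rule add_pos_nonneg) (auto intro: sum_nonneg)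
  moreover have "cmod (g x - g a) \<le> K * nrm n (x - a)" if x: "x \<in> cspace n" "nrm n (x - a) < d" for x
  proof -
    have "cmod (g x - g a) \<le> cmod (g x - g a - (\<Sum>i<n. c i * (x i - a i))) + cmod (\<Sum>i<n. c i * (x - a) i)"
      using norm_triangle_ineq[of "g x - g a - (\<Sum>i<n. c i * (x i - a i))" "\<Sum>i<n. c i * (x - a) i"] by simp
    also have "\<dots> \<le> 1 * nrm n (x - a) + (\<Sum>i<n. cmod (c i)) * nrm n (x - a)"
      using d(2)[OF x] sum_bound[of c "x - a" n] by (intro add_mono)
    finally show ?thesis by (simp add: K_def algebra_simps)
  qed
  ultimately show ?thesis using d(1) that by blast
qed

lemma has_cgradient_mult:
  assumes a: "a \<in> cspace n" and g: "has_cgradient n g c a" and h: "has_cgradient n h k a"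
  shows "has_cgradient n (\<lambda>x. g x * h x) (\<lambda>i. c i * h a + g a * k i) a"
  unfolding has_cgradient_iff[OF a]
proof (intro allI impI)
  fix e :: real assume e: "e > 0"
  obtain d1 K where K: "d1 > 0" "K > 0" "\<And>x. x \<in> cspace n \<Longrightarrow> nrm n (x - a) < d1 \<Longrightarrow> cmod (g x - g a) \<le> K * nrm n (x - a)"
    using has_cgradient_lipschitz[OF a g] by blast
  obtain d2 L where L: "d2 > 0" "L > 0" "\<And>x. x \<in> cspace n \<Longrightarrow> nrm n (x - a) < d2 \<Longrightarrow> cmod (h x - h a) \<le> L * nrm n (x - a)"
    using has_cgradient_lipschitz[OF a h] by blast
  define e1 where "e1 = e / (3 * (cmod (h a) + 1))"
  define e2 where "e2 = e / (3 * (cmod (g a) + 1))"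
  have "cmod (h a) + 1 > 0" "cmod (g a) + 1 > 0" using norm_ge_zero[of "h a"] norm_ge_zero[of "g a"] by linarith+
  then have e12: "e1 > 0" "e2 > 0" using e by (simp_all add: e1_def e2_def)
  obtain d3 where d3: "d3 > 0" "\<And>x. x \<in> cspace n \<Longrightarrow> nrm n (x - a) < d3 \<Longrightarrow>
      cmod (g x - g a - (\<Sum>i<n. c i * (x i - a i))) \<le> e1 * nrm n (x - a)"
    using g e12 unfolding has_cgradient_iff[OF a] by blast
  obtain d4 where d4: "d4 > 0" "\<And>x. x \<in> cspace n \<Longrightarrow> nrm n (x - a) < d4 \<Longrightarrow>
      cmod (h x - h a - (\<Sum>i<n. k i * (x i - a i))) \<le> e2 * nrm n (x - a)"
    using h e12 unfolding has_cgradient_iff[OF a] by blast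
  define d where "d = Min {d1, d2, d3, d4, e / (3 * K * L)}"
  have d: "d > 0" "d \<le> d1" "d \<le> d2" "d \<le> d3" "d \<le> d4" "d \<le> e / (3 * K * L)"
    using K(1,2) L(1,2) d3(1) d4(1) e by (auto simp: d_def)
  have "cmod (g x * h x - g a * h a - (\<Sum>i<n. (c i * h a + g a * k i) * (x i - a i))) \<le> e * nrm n (x - a)"
    if x: "x \<in> cspace n" "nrm n (x - a) < d" for x
  proof -
    define r where "r = nrm n (x - a)"
    let ?G = "g x - g a - (\<Sum>i<n. c i * (x i - a i))" and ?H = "h x - h a - (\<Sum>i<n. k i * (x i - a i))"
    have split: "(\<Sum>i<n. (c i * h a + g a * k i) * (x i - a i)) =
      (\<Sum>i<n. c i * (x i - a i)) * h a + g a * (\<Sum>i<n. k i * (x i - a i))"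
      unfolding sum_distrib_left sum_distrib_right sum.distrib[symmetric] by (rule sum.cong) (auto simp: algebra_simps)
    have "g x * h x - g a * h a - (\<Sum>i<n. (c i * h a + g a * k i) * (x i - a i))
      = ?G * h a + g a * ?H + (g x - g a) * (h x - h a)"
      unfolding split by (simp add: algebra_simps)
    then have "cmod (g x * h x - g a * h a - (\<Sum>i<n. (c i * h a + g a * k i) * (x i - a i)))
      \<le> cmod ?G * cmod (h a) + cmod (g a) * cmod ?H + cmod (g x - g a) * cmod (h x - h a)"
      unfolding norm_mult[symmetric] by (simp only:) (intro norm_triangle_le add_right_mono norm_triangle_ineq)
    also have "\<dots> \<le> e / 3 * r + e / 3 * r + e / 3 * r"
    proof (intro add_mono)
      have "cmod ?G * cmod (h a) \<le> (e1 * r) * (cmod (h a) + 1)"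
        using d3(2)[OF x(1)] x(2) d e12 unfolding r_def by (intro mult_mono) auto
      also have "\<dots> = e / 3 * r" using \<open>cmod (h a) + 1 > 0\<close> by (simp add: e1_def field_simps)
      finally show "cmod ?G * cmod (h a) \<le> e / 3 * r" .
      have "cmod (g a) * cmod ?H \<le> (cmod (g a) + 1) * (e2 * r)"
        using d4(2)[OF x(1)] x(2) d e12 unfolding r_def by (intro mult_mono) auto
      also have "\<dots> = e / 3 * r" using \<open>cmod (g a) + 1 > 0\<close> by (simp add: e2_def field_simps)
      finally show "cmod (g a) * cmod ?H \<le> e / 3 * r" .
      have "cmod (g x - g a) * cmod (h x - h a) \<le> (K * r) * (L * r)"
        using K(2) K(3)[OF x(1)] L(3)[OF x(1)] x(2) d unfolding r_def by (intro mult_mono) auto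
      also have "\<dots> = (K * L * r) * r" by simp
      also have "\<dots> \<le> e / 3 * r"
      proof (rule mult_right_mono)
        have "r \<le> e / (3 * K * L)" using x(2) d unfolding r_def by linarith
        then show "K * L * r \<le> e / 3" using K(2) L(2) by (simp add: field_simps)
      qed (simp add: r_def)
      finally show "cmod (g x - g a) * cmod (h x - h a) \<le> e / 3 * r" .
    qed
    finally show ?thesis by (simp add: r_def)
  qed
  then show "\<exists>d>0. \<forall>x\<in>cspace n. nrm n (x - a) < d \<longrightarrow>
    cmod (g x * h x - g a * h a - (\<Sum>i<n. (c i * h a + g a * k i) * (x i - a i))) \<le> e * nrm n (x - a)"
    using d(1) by blast
qed

lemma cdiff_const: "a \<in> cspace n \<Longrightarrow> cdiff n (\<lambda>x. k) a"
  unfolding cdiff_def using has_cgradient_const by blast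

lemma cdiff_coord: "a \<in> cspace n \<Longrightarrow> cdiff n (\<lambda>x. x i) a"
  unfolding cdiff_def using has_cgradient_coord by blast

lemma cdiff_add: "a \<in> cspace n \<Longrightarrow> cdiff n g a \<Longrightarrow> cdiff n h a \<Longrightarrow> cdiff n (\<lambda>x. g x + h x) a"
  unfolding cdiff_def using has_cgradient_add by blast

lemma cdiff_mult: "a \<in> cspace n \<Longrightarrow> cdiff n g a \<Longrightarrow> cdiff n h a \<Longrightarrow> cdiff n (\<lambda>x. g x * h x) a"
  unfolding cdiff_def using has_cgradient_mult by blast

lemma cdiff_diff:
  assumes "a \<in> cspace n" "cdiff n g a" "cdiff n h a"
  shows "cdiff n (\<lambda>x. g x - h x) a"
  using cdiff_add[OF assms(1,2) cdiff_mult[OF assms(1) cdiff_const[OF assms(1), of "-1"] assms(3)]] by simp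

lemma cdiff_sum:
  assumes "a \<in> cspace n" "\<And>k. k \<in> K \<Longrightarrow> cdiff n (g k) a"
  shows "cdiff n (\<lambda>x. \<Sum>k\<in>K. g k x) a"
  using assms(2)
proof (induction K rule: infinite_finite_induct)
  case (insert k K)
  then show ?case using cdiff_add[OF assms(1), of "g k" "\<lambda>x. \<Sum>k\<in>K. g k x"] by simp
qed (use assms(1) in \<open>simp_all add: cdiff_const\<close>)

lemma cdiff_power:
  assumes "a \<in> cspace n" "cdiff n g a"
  shows "cdiff n (\<lambda>x. g x ^ m) a"
proof (induction m)
  case (Suc m)
  then show ?case using cdiff_mult[OF assms] by simp
qed (use assms in \<open>simp add: cdiff_const\<close>)

lemma cdiff_cong:
  assumes "a \<in> cspace n" "r > 0" "\<And>x. x \<in> cspace n \<Longrightarrow> nrm n (x - a) < r \<Longrightarrow> g x = h x"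
  shows "cdiff n g a \<longleftrightarrow> cdiff n h a"
  unfolding cdiff_def using has_cgradient_cong[OF assms] by auto

lemma cdiff_if: "a \<in> cspace n \<Longrightarrow> (P \<Longrightarrow> cdiff n g a) \<Longrightarrow> (\<not> P \<Longrightarrow> cdiff n h a) \<Longrightarrow> cdiff n (\<lambda>x. if P then g x else h x) a"
  by (cases P) auto

text \<open>
  The matrix \<open>A\<close> acts on \<open>\<complex>\<^sup>n\<close> with values in \<open>\<complex>\<^sup>p\<close>, so the result vanishes from index \<open>p\<close> on.
\<close>
definition lin :: "nat \<Rightarrow> nat \<Rightarrow> (nat \<Rightarrow> nat \<Rightarrow> complex) \<Rightarrow> (nat \<Rightarrow> complex) \<Rightarrow> nat \<Rightarrow> complex" where
  "lin p n A v = (\<lambda>j. if j < p then \<Sum>i<n. A j i * v i else 0)"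

definition has_cderiv ::
    "nat \<Rightarrow> nat \<Rightarrow> ((nat \<Rightarrow> complex) \<Rightarrow> nat \<Rightarrow> complex) \<Rightarrow> (nat \<Rightarrow> nat \<Rightarrow> complex) \<Rightarrow> (nat \<Rightarrow> complex) \<Rightarrow> bool" where
  "has_cderiv n p F A a \<longleftrightarrow> (\<forall>e>0. \<exists>d>0. \<forall>x\<in>cspace n. nrm n (x - a) < d \<longrightarrow>
     nrm p (F x - F a - lin p n A (x - a)) \<le> e * nrm n (x - a))"

lemma has_cderivD:
  assumes "has_cderiv n p F A a" "e > 0"
  obtains d where "d > 0" "\<And>x. x \<in> cspace n \<Longrightarrow> nrm n (x - a) < d \<Longrightarrow>
    nrm p (F x - F a - lin p n A (x - a)) \<le> e * nrm n (x - a)"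
  using assms unfolding has_cderiv_def by blast

lemma has_cderiv_iff:
  assumes a: "a \<in> cspace n"
  shows "has_cderiv n p F A a \<longleftrightarrow> (\<forall>j<p. has_cgradient n (\<lambda>x. F x j) (A j) a)"
proof (intro iffI allI impI)
  fix j assume F: "has_cderiv n p F A a" and j: "j < p"
  show "has_cgradient n (\<lambda>x. F x j) (A j) a"
    unfolding has_cgradient_iff[OF a]
  proof (intro allI impI)
    fix e :: real assume "e > 0"
    then obtain d where d: "d > 0" "\<And>x. x \<in> cspace n \<Longrightarrow> nrm n (x - a) < d \<Longrightarrow>
      nrm p (F x - F a - lin p n A (x - a)) \<le> e * nrm n (x - a)" using F unfolding has_cderiv_def by blast
    have "cmod (F x j - F a j - (\<Sum>i<n. A j i * (x i - a i))) \<le> nrm p (F x - F a - lin p n A (x - a))" for x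
      using norm_le_nrm[OF j, of "F x - F a - lin p n A (x - a)"] j by (simp add: lin_def)
    then show "\<exists>d>0. \<forall>x\<in>cspace n. nrm n (x - a) < d \<longrightarrow>
      cmod (F x j - F a j - (\<Sum>i<n. A j i * (x i - a i))) \<le> e * nrm n (x - a)"
      using d(1) by (intro exI[of _ d] conjI ballI impI) (auto intro: order_trans d(2))
  qed
next
  assume F: "\<forall>j<p. has_cgradient n (\<lambda>x. F x j) (A j) a"
  show "has_cderiv n p F A a" unfolding has_cderiv_def
  proof (intro allI impI)
    fix e :: real assume e: "e > 0"
    define e' where "e' = e / (real p + 1)"
    have e': "e' > 0" using e by (simp add: e'_def)
    have "\<forall>j. \<exists>d>0. j < p \<longrightarrow> (\<forall>x\<in>cspace n. nrm n (x - a) < d \<longrightarrow>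
      cmod (F x j - F a j - (\<Sum>i<n. A j i * (x i - a i))) \<le> e' * nrm n (x - a))"
    proof
      fix j
      show "\<exists>d>0. j < p \<longrightarrow> (\<forall>x\<in>cspace n. nrm n (x - a) < d \<longrightarrow>
        cmod (F x j - F a j - (\<Sum>i<n. A j i * (x i - a i))) \<le> e' * nrm n (x - a))"
      proof (cases "j < p")
        case True
        then have "has_cgradient n (\<lambda>x. F x j) (A j) a" using F by blast
        then show ?thesis using e' True unfolding has_cgradient_iff[OF a] by simp
      qed (rule exI[of _ 1], simp)
    qed
    then obtain r where r: "\<And>j. r j > 0" "\<And>j x. j < p \<Longrightarrow> x \<in> cspace n \<Longrightarrow> nrm n (x - a) < r j \<Longrightarrow>
      cmod (F x j - F a j - (\<Sum>i<n. A j i * (x i - a i))) \<le> e' * nrm n (x - a)" by metis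
    define d where "d = Min (insert 1 (r ` {..<p}))"
    have d: "d > 0" "\<And>j. j < p \<Longrightarrow> d \<le> r j" using r(1) by (auto simp: d_def)
    have "nrm p (F x - F a - lin p n A (x - a)) \<le> e * nrm n (x - a)" if x: "x \<in> cspace n" "nrm n (x - a) < d" for x
    proof -
      have "nrm p (F x - F a - lin p n A (x - a)) \<le> (\<Sum>j<p. e' * nrm n (x - a))"
        unfolding nrm_def[of p]
      proof (rule sum_mono)
        fix j assume j: "j \<in> {..<p}"
        then have "nrm n (x - a) < r j" using d(2)[of j] x(2) by simp
        then show "cmod ((F x - F a - lin p n A (x - a)) j) \<le> e' * nrm n (x - a)"
          using r(2)[of j x] j x by (simp add: lin_def)
      qed
      also have "\<dots> = (real p * e') * nrm n (x - a)" by simp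
      also have "\<dots> \<le> e * nrm n (x - a)"
      proof (rule mult_right_mono)
        have "real p * e' \<le> (real p + 1) * e'" using e' by simp
        then show "real p * e' \<le> e" by (simp add: e'_def)
      qed simp
      finally show ?thesis .
    qed
    then show "\<exists>d>0. \<forall>x\<in>cspace n. nrm n (x - a) < d \<longrightarrow>
      nrm p (F x - F a - lin p n A (x - a)) \<le> e * nrm n (x - a)" using d(1) by blast
  qed
qed

lemma lin_bound:
  obtains K where "K > 0" "\<And>v. nrm p (lin p n A v) \<le> K * nrm n v"
proof
  show "1 + (\<Sum>j<p. \<Sum>i<n. cmod (A j i)) > 0" by (rule add_pos_nonneg) (auto intro!: sum_nonneg)
  fix v
  have "nrm p (lin p n A v) \<le> (\<Sum>j<p. (\<Sum>i<n. cmod (A j i)) * nrm n v)"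
    unfolding nrm_def[of p]
  proof (rule sum_mono)
    fix j assume "j \<in> {..<p}"
    then show "cmod (lin p n A v j) \<le> (\<Sum>i<n. cmod (A j i)) * nrm n v"
      using sum_bound[of "A j" v n] by (simp add: lin_def)
  qed
  also have "\<dots> \<le> (1 + (\<Sum>j<p. \<Sum>i<n. cmod (A j i))) * nrm n v"
    unfolding sum_distrib_right[symmetric] by (intro mult_right_mono) auto
  finally show "nrm p (lin p n A v) \<le> (1 + (\<Sum>j<p. \<Sum>i<n. cmod (A j i))) * nrm n v" .
qed

lemma has_cderiv_lipschitz:
  assumes F: "has_cderiv n p F A a"
  obtains d K where "d > 0" "K > 0" "\<And>x. x \<in> cspace n \<Longrightarrow> nrm n (x - a) < d \<Longrightarrow> nrm p (F x - F a) \<le> K * nrm n (x - a)"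
proof -
  obtain d where d: "d > 0" "\<And>x. x \<in> cspace n \<Longrightarrow> nrm n (x - a) < d \<Longrightarrow>
      nrm p (F x - F a - lin p n A (x - a)) \<le> 1 * nrm n (x - a)"
    using has_cderivD[OF F, of 1] by auto
  obtain K where K: "K > 0" "\<And>v. nrm p (lin p n A v) \<le> K * nrm n v" using lin_bound by blast
  have "nrm p (F x - F a) \<le> (1 + K) * nrm n (x - a)" if x: "x \<in> cspace n" "nrm n (x - a) < d" for x
  proof -
    have "nrm p (F x - F a) \<le> nrm p (F x - F a - lin p n A (x - a)) + nrm p (lin p n A (x - a))"
      using nrm_add[of p "F x - F a - lin p n A (x - a)" "lin p n A (x - a)"] by (simp add: fun_diff_def)
    also have "\<dots> \<le> 1 * nrm n (x - a) + K * nrm n (x - a)" using d(2)[OF x] K(2) by (intro add_mono)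
    finally show ?thesis by (simp add: algebra_simps)
  qed
  then show ?thesis using that[of d "1 + K"] d(1) K(1) by simp
qed

lemma has_cgradient_compose:
  assumes a: "a \<in> cspace n" and r: "r > 0"
    and im: "\<And>x. x \<in> cspace n \<Longrightarrow> nrm n (x - a) < r \<Longrightarrow> F x \<in> cspace p"
    and A: "has_cderiv n p F A a" and c: "has_cgradient p g c (F a)"
  shows "has_cgradient n (\<lambda>x. g (F x)) (\<lambda>i. \<Sum>j<p. c j * A j i) a"
proof -
  have Fa: "F a \<in> cspace p" using im[OF a] r by simp
  define k where "k = (\<lambda>i. \<Sum>j<p. c j * A j i)"
  obtain d0 K where K: "d0 > 0" "K > 0" "\<And>x. x \<in> cspace n \<Longrightarrow> nrm n (x - a) < d0 \<Longrightarrow> nrm p (F x - F a) \<le> K * nrm n (x - a)"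
    using has_cderiv_lipschitz[OF A] by blast
  define L where "L = 1 + (\<Sum>j<p. cmod (c j))"
  have L: "L > 0" unfolding L_def by (rule add_pos_nonneg) (auto intro: sum_nonneg)
  have "has_cgradient n (\<lambda>x. g (F x)) k a"
    unfolding has_cgradient_iff[OF a]
  proof (intro allI impI)
    fix e :: real assume e: "e > 0"
    obtain d1 where d1: "d1 > 0" "\<And>y. y \<in> cspace p \<Longrightarrow> nrm p (y - F a) < d1 \<Longrightarrow>
      cmod (g y - g (F a) - (\<Sum>j<p. c j * (y j - F a j))) \<le> e / (2 * K) * nrm p (y - F a)"
      using has_cgradientD[OF Fa c, of "e / (2 * K)"] e K(2) by auto
    obtain d2 where d2: "d2 > 0" "\<And>x. x \<in> cspace n \<Longrightarrow> nrm n (x - a) < d2 \<Longrightarrow>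
      nrm p (F x - F a - lin p n A (x - a)) \<le> e / (2 * L) * nrm n (x - a)"
      using has_cderivD[OF A, of "e / (2 * L)"] e L by auto
    define d where "d = Min {r, d0, d2, d1 / K}"
    have d: "d > 0" "d \<le> r" "d \<le> d0" "d \<le> d2" "d \<le> d1 / K" using r K d1(1) d2(1) by (auto simp: d_def)
    have "cmod (g (F x) - g (F a) - (\<Sum>i<n. k i * (x i - a i))) \<le> e * nrm n (x - a)"
      if x: "x \<in> cspace n" "nrm n (x - a) < d" for x
    proof -
      let ?v = "F x - F a" and ?l = "lin p n A (x - a)"
      have 1: "nrm p ?v \<le> K * nrm n (x - a)" using K(3)[OF x(1)] x(2) d by simp
      have "K * nrm n (x - a) < d1"
      proof -
        have "nrm n (x - a) < d1 / K" using x(2) d by simp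
        then show ?thesis using K(2) by (simp add: field_simps)
      qed
      then have 2: "cmod (g (F x) - g (F a) - (\<Sum>j<p. c j * ?v j)) \<le> e / (2 * K) * nrm p ?v"
        using d1(2)[of "F x"] im[OF x(1)] x(2) d 1 by simp
      have 3: "(\<Sum>i<n. k i * (x i - a i)) = (\<Sum>j<p. c j * ?l j)"
      proof -
        have "(\<Sum>i<n. k i * (x i - a i)) = (\<Sum>i<n. \<Sum>j<p. c j * (A j i * (x i - a i)))"
          by (simp add: k_def sum_distrib_right mult.assoc)
        also have "\<dots> = (\<Sum>j<p. \<Sum>i<n. c j * (A j i * (x i - a i)))" by (rule sum.swap)
        also have "\<dots> = (\<Sum>j<p. c j * ?l j)" by (rule sum.cong) (auto simp: lin_def sum_distrib_left)
        finally show ?thesis .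
      qed
      have "g (F x) - g (F a) - (\<Sum>i<n. k i * (x i - a i)) =
         (g (F x) - g (F a) - (\<Sum>j<p. c j * ?v j)) + (\<Sum>j<p. c j * (?v - ?l) j)"
        unfolding 3 by (simp add: sum_subtractf[symmetric] algebra_simps)
           (simp add: sum.distrib[symmetric] sum_subtractf[symmetric] algebra_simps)
      then have "cmod (g (F x) - g (F a) - (\<Sum>i<n. k i * (x i - a i))) \<le>
        cmod (g (F x) - g (F a) - (\<Sum>j<p. c j * ?v j)) + cmod (\<Sum>j<p. c j * (?v - ?l) j)"
        by (simp only: norm_triangle_ineq)
      also have "\<dots> \<le> e / (2 * K) * (K * nrm n (x - a)) + L * (e / (2 * L) * nrm n (x - a))"
      proof (rule add_mono)
        show "cmod (g (F x) - g (F a) - (\<Sum>j<p. c j * ?v j)) \<le> e / (2 * K) * (K * nrm n (x - a))"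
          by (rule order_trans[OF 2 mult_left_mono[OF 1]]) (use e K in auto)
        have "cmod (\<Sum>j<p. c j * (?v - ?l) j) \<le> (\<Sum>j<p. cmod (c j)) * nrm p (?v - ?l)"
          using sum_bound[of c "?v - ?l" p] by simp
        also have "\<dots> \<le> L * (e / (2 * L) * nrm n (x - a))"
          using d2(2)[OF x(1)] x(2) d L by (intro mult_mono) (auto simp: L_def)
        finally show "cmod (\<Sum>j<p. c j * (?v - ?l) j) \<le> L * (e / (2 * L) * nrm n (x - a))" .
      qed
      also have "\<dots> = e * nrm n (x - a)" using K(2) L by simp
      finally show ?thesis .
    qed
    then show "\<exists>d>0. \<forall>x\<in>cspace n. nrm n (x - a) < d \<longrightarrow>
      cmod (g (F x) - g (F a) - (\<Sum>i<n. k i * (x i - a i))) \<le> e * nrm n (x - a)" using d(1) by blast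
  qed
  then show ?thesis by (simp add: k_def)
qed

lemma cdiff_compose:
  assumes a: "a \<in> cspace n" and r: "r > 0"
    and im: "\<And>x. x \<in> cspace n \<Longrightarrow> nrm n (x - a) < r \<Longrightarrow> F x \<in> cspace p"
    and F: "\<And>j. j < p \<Longrightarrow> cdiff n (\<lambda>x. F x j) a" and g: "cdiff p g (F a)"
  shows "cdiff n (\<lambda>x. g (F x)) a"
proof -
  have "\<forall>j. \<exists>c. j < p \<longrightarrow> has_cgradient n (\<lambda>x. F x j) c a" using F unfolding cdiff_def by blast
  then obtain A where "\<And>j. j < p \<Longrightarrow> has_cgradient n (\<lambda>x. F x j) (A j) a" by metis
  then have A: "has_cderiv n p F A a" using has_cderiv_iff[OF a] by blast
  obtain c where "has_cgradient p g c (F a)" using g unfolding cdiff_def by blast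
  from has_cgradient_compose[OF a r _ A this] im show ?thesis unfolding cdiff_def by blast
qed

lemma holo_map_iff:
  "holo_map n p U F \<longleftrightarrow> copen n U \<and> F ` U \<subseteq> cspace p \<and> (\<forall>a\<in>U. \<forall>j<p. cdiff n (\<lambda>x. F x j) a)"
  by (simp add: holo_map_def cdiff_def)

lemma holo_mapI:
  "copen n U \<Longrightarrow> (\<And>x. x \<in> U \<Longrightarrow> F x \<in> cspace p) \<Longrightarrow>
    (\<And>a j. a \<in> U \<Longrightarrow> j < p \<Longrightarrow> cdiff n (\<lambda>x. F x j) a) \<Longrightarrow> holo_map n p U F"
  by (auto simp: holo_map_iff)

lemma holo_mapD:
  assumes "holo_map n p U F"
  shows "copen n U" "\<And>x. x \<in> U \<Longrightarrow> F x \<in> cspace p" "\<And>a j. a \<in> U \<Longrightarrow> j < p \<Longrightarrow> cdiff n (\<lambda>x. F x j) a"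
    "\<And>a. a \<in> U \<Longrightarrow> a \<in> cspace n"
  using assms copen_subset[of n U] by (auto simp: holo_map_iff)

lemma holo_map_has_cderiv:
  assumes "holo_map n p U F" "a \<in> U"
  obtains A where "has_cderiv n p F A a"
proof -
  have a: "a \<in> cspace n" using holo_mapD(4)[OF assms] .
  have "\<forall>j. \<exists>c. j < p \<longrightarrow> has_cgradient n (\<lambda>x. F x j) c a"
    using holo_mapD(3)[OF assms] unfolding cdiff_def by blast
  then obtain A where "\<And>j. j < p \<Longrightarrow> has_cgradient n (\<lambda>x. F x j) (A j) a" by metis
  then show ?thesis using has_cderiv_iff[OF a] that by blast
qed

lemma holo_map_subset: "holo_map n p U F \<Longrightarrow> copen n U' \<Longrightarrow> U' \<subseteq> U \<Longrightarrow> holo_map n p U' F"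
  by (auto simp: holo_map_iff)

lemma holo_map_cong:
  assumes F: "holo_map n p U F" and eq: "\<And>x. x \<in> U \<Longrightarrow> F x = G x"
  shows "holo_map n p U G"
proof (rule holo_mapI)
  show "copen n U" using holo_mapD(1)[OF F] .
  show "G x \<in> cspace p" if "x \<in> U" for x using holo_mapD(2)[OF F that] eq[OF that] by simp
  fix a j assume a: "a \<in> U" and j: "j < p"
  obtain e where e: "e > 0" "\<And>x. x \<in> cspace n \<Longrightarrow> nrm n (x - a) < e \<Longrightarrow> x \<in> U"
    using copen_contains_ball[OF holo_mapD(1)[OF F] a] by blast
  have "cdiff n (\<lambda>x. F x j) a \<longleftrightarrow> cdiff n (\<lambda>x. G x j) a"
    by (rule cdiff_cong[OF holo_mapD(4)[OF F a] e(1)]) (use e(2) eq in auto)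
  then show "cdiff n (\<lambda>x. G x j) a" using holo_mapD(3)[OF F a j] by simp
qed

lemma holo_map_Union:
  assumes "\<And>U. U \<in> \<U> \<Longrightarrow> holo_map n p U F"
  shows "holo_map n p (\<Union>\<U>) F"
  using assms by (auto simp: holo_map_iff intro!: openin_Union)

lemma holo_map_preimage:
  assumes F: "holo_map n p U F" and V: "copen p V"
  shows "copen n {x \<in> U. F x \<in> V}"
proof (rule copenI)
  show "{x \<in> U. F x \<in> V} \<subseteq> cspace n" using holo_mapD(4)[OF F] by auto
  fix a assume "a \<in> {x \<in> U. F x \<in> V}"
  then have a: "a \<in> U" "F a \<in> V" by auto
  obtain e where e: "e > 0" "\<And>x. x \<in> cspace n \<Longrightarrow> nrm n (x - a) < e \<Longrightarrow> x \<in> U"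
    using copen_contains_ball[OF holo_mapD(1)[OF F] a(1)] by blast
  obtain r where r: "r > 0" "\<And>y. y \<in> cspace p \<Longrightarrow> nrm p (y - F a) < r \<Longrightarrow> y \<in> V"
    using copen_contains_ball[OF V a(2)] by blast
  obtain A where "has_cderiv n p F A a" using holo_map_has_cderiv[OF F a(1)] .
  then obtain d K where K: "d > 0" "K > 0" "\<And>x. x \<in> cspace n \<Longrightarrow> nrm n (x - a) < d \<Longrightarrow> nrm p (F x - F a) \<le> K * nrm n (x - a)"
    using has_cderiv_lipschitz by blast
  define s where "s = Min {e, d, r / K}"
  have s: "s > 0" "s \<le> e" "s \<le> d" "s \<le> r / K" using e(1) r(1) K(1,2) by (auto simp: s_def)
  have "x \<in> U \<and> F x \<in> V" if x: "x \<in> cspace n" "nrm n (x - a) < s" for x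
  proof -
    have xU: "x \<in> U" using e(2)[OF x(1)] x(2) s(2) by simp
    have "nrm p (F x - F a) \<le> K * nrm n (x - a)" using K(3)[OF x(1)] x(2) s(3) by simp
    also have "\<dots> < K * (r / K)" using x(2) s(4) K(2) by (intro mult_strict_left_mono) auto
    also have "\<dots> = r" using K(2) by simp
    finally show ?thesis using r(2) holo_mapD(2)[OF F xU] xU by blast
  qed
  then show "\<exists>e>0. \<forall>x\<in>cspace n. nrm n (x - a) < e \<longrightarrow> x \<in> {x \<in> U. F x \<in> V}" using s(1) by blast
qed

lemma holo_map_comp:
  assumes F: "holo_map n p U F" and G: "holo_map p q V G"
  shows "holo_map n q {x \<in> U. F x \<in> V} (\<lambda>x. G (F x))"
proof (rule holo_mapI)
  show "copen n {x \<in> U. F x \<in> V}" by (rule holo_map_preimage[OF F holo_mapD(1)[OF G]])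
  show "G (F x) \<in> cspace q" if "x \<in> {x \<in> U. F x \<in> V}" for x using that holo_mapD(2)[OF G] by auto
  fix a j assume a: "a \<in> {x \<in> U. F x \<in> V}" and j: "j < q"
  then have aU: "a \<in> U" by simp
  obtain e where e: "e > 0" "\<And>x. x \<in> cspace n \<Longrightarrow> nrm n (x - a) < e \<Longrightarrow> x \<in> U"
    using copen_contains_ball[OF holo_mapD(1)[OF F] aU] by blast
  show "cdiff n (\<lambda>x. G (F x) j) a"
    by (rule cdiff_compose[where p = p and r = e and g = "\<lambda>y. G y j", OF holo_mapD(4)[OF F aU] e(1)])
       (use e(2) holo_mapD(2,3)[OF F] holo_mapD(3)[OF G] a j in auto)
qed

lemma line_derivative:
  assumes a: "a \<in> cspace n" and v: "v \<in> cspace n"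
    and g: "has_cgradient n g c (\<lambda>i. a i + z0 * v i)"
  shows "((\<lambda>z. g (\<lambda>i. a i + z * v i)) has_field_derivative (\<Sum>i<n. c i * v i)) (at z0)"
proof -
  let ?p = "\<lambda>z i. a i + z * v i"
  let ?D = "\<Sum>i<n. c i * v i"
  have p: "?p z \<in> cspace n" for z using a v by simp
  have nz: "nrm n (?p z - ?p z0) = cmod (z - z0) * nrm n v" for z
    by (simp add: nrm_def sum_distrib_left norm_mult[symmetric] algebra_simps)
  have sz: "(\<Sum>i<n. c i * (?p z i - ?p z0 i)) = ?D * (z - z0)" for z
    unfolding sum_distrib_right by (rule sum.cong) (auto simp: algebra_simps)
  have "\<exists>d>0. \<forall>z. norm (z - z0) < d \<longrightarrow> norm (g (?p z) - g (?p z0) - ?D * (z - z0)) \<le> e * norm (z - z0)"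
    if e: "e > 0" for e
  proof -
    define e' where "e' = e / (nrm n v + 1)"
    have pos: "nrm n v + 1 > 0" using nrm_nonneg[of n v] by linarith
    have e': "e' > 0" using e pos by (simp add: e'_def)
    obtain d where d: "d > 0" "\<And>x. x \<in> cspace n \<Longrightarrow> nrm n (x - ?p z0) < d \<Longrightarrow>
        cmod (g x - g (?p z0) - (\<Sum>i<n. c i * (x i - ?p z0 i))) \<le> e' * nrm n (x - ?p z0)"
      by (rule has_cgradientD[OF p g e']) blast
    have "norm (g (?p z) - g (?p z0) - ?D * (z - z0)) \<le> e * norm (z - z0)"
      if z: "norm (z - z0) < d / (nrm n v + 1)" for z
    proof -
      have "norm (z - z0) * nrm n v \<le> norm (z - z0) * (nrm n v + 1)" by (intro mult_left_mono) auto
      also have "\<dots> < d" using z pos by (simp add: pos_less_divide_eq)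
      finally have "cmod (g (?p z) - g (?p z0) - ?D * (z - z0)) \<le> e' * (cmod (z - z0) * nrm n v)"
        using d(2)[OF p, of z] unfolding nz sz by simp
      also have "\<dots> \<le> e' * (cmod (z - z0) * (nrm n v + 1))" using e' by (intro mult_left_mono) auto
      also have "\<dots> = e * cmod (z - z0)" using pos by (simp add: e'_def)
      finally show ?thesis .
    qed
    then show ?thesis using d(1) pos by (intro exI[of _ "d / (nrm n v + 1)"]) auto
  qed
  then show ?thesis
    unfolding has_field_derivative_def has_derivative_at_alt by (simp add: bounded_linear_mult_right)
qed

text \<open>
  Let \<open>G\<close> be the difference of \<open>g\<close> and its linear approximation at \<open>a\<close>. Differentiability at \<open>a\<close> bounds
  \<open>G\<close> by \<open>\<epsilon> d\<close> on a ball of radius proportional to \<open>d\<close>. Cauchy's estimate on complex lines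
  turns this into a bound \<open>\<epsilon>\<close> for the derivatives of \<open>G\<close> on a smaller ball. So \<open>G\<close> is
  Lipschitz there with a small constant, and no continuity of the derivative has to be assumed.
\<close>
lemma strict_gradient_bound:
  assumes a: "a \<in> cspace n" and r: "r > 0"
    and g: "\<And>x. x \<in> cspace n \<Longrightarrow> nrm n (x - a) < r \<Longrightarrow> cdiff n g x"
    and c: "has_cgradient n g c a" and e: "e > 0"
  obtains d where "d > 0" "d \<le> r" "\<And>x y. x \<in> cspace n \<Longrightarrow> y \<in> cspace n \<Longrightarrow> nrm n (x - a) < d \<Longrightarrow> nrm n (y - a) < d \<Longrightarrow>
    cmod (g x - g y - (\<Sum>i<n. c i * (x i - y i))) \<le> e * nrm n (x - y)"
proof -
  define G where "G = (\<lambda>x. g x - g a - (\<Sum>i<n. c i * (x i - a i)))"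
  have e2: "e / 2 > 0" using e by simp
  obtain d0 where d0: "d0 > 0" "\<And>x. x \<in> cspace n \<Longrightarrow> nrm n (x - a) < d0 \<Longrightarrow> cmod (G x) \<le> e / 2 * nrm n (x - a)"
    unfolding G_def by (rule has_cgradientD[OF a c e2]) blast
  define d where "d = min r d0 / 4"
  have d: "d > 0" "4 * d \<le> r" "4 * d \<le> d0" using r d0(1) by (auto simp: d_def)
  have Gdiff: "cdiff n G x" if "x \<in> cspace n" "nrm n (x - a) < 4 * d" for x
    unfolding G_def using g[of x] that d(2)
    by (intro cdiff_diff cdiff_sum cdiff_mult cdiff_const cdiff_coord) auto
  have "cmod (g x - g y - (\<Sum>i<n. c i * (x i - y i))) \<le> e * nrm n (x - y)"
    if x: "x \<in> cspace n" "nrm n (x - a) < d" and y: "y \<in> cspace n" "nrm n (y - a) < d" for x y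
  proof (cases "x = y")
    case False
    define v where "v = x - y"
    define s where "s = nrm n v"
    have v: "v \<in> cspace n" using x y by (simp add: v_def)
    have "nrm n (x - y) \<noteq> 0" using nrm_eq_0D[OF _ x(1) y(1)] False by blast
    then have s: "s > 0" unfolding s_def v_def using nrm_nonneg[of n "x - y"] by linarith
    let ?p = "\<lambda>z i. y i + z * v i"
    define h where "h = (\<lambda>z. G (?p z))"
    have pin: "?p z \<in> cspace n" for z using y v by simp
    have hd: "h field_differentiable (at z)" if "nrm n (?p z - a) < 4 * d" for z
      using Gdiff[OF pin that] line_derivative[OF y(1) v] unfolding h_def cdiff_def field_differentiable_def by blast
    \<comment> \<open>Segment points are in the ball of radius \<open>d\<close>, so the Cauchy estimate has room \<open>d\<close> around them.\<close>
    have near: "nrm n (?p z - a) \<le> d + cmod (z - of_real t) * s" if t: "0 \<le> t" "t \<le> 1" for t z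
    proof -
      have "nrm n (?p (of_real t) - a) = nrm n (\<lambda>i. of_real (1 - t) * (y - a) i + of_real t * (x - a) i)"
        by (rule nrm_cong) (simp add: v_def algebra_simps)
      also have "\<dots> \<le> (1 - t) * nrm n (y - a) + t * nrm n (x - a)"
        by (rule order_trans[OF nrm_add]) (use t in \<open>simp add: nrm_scale del: minus_apply of_real_diff\<close>)
      also have "\<dots> \<le> (1 - t) * d + t * d" using t x(2) y(2) by (intro add_mono mult_left_mono) auto
      finally have 1: "nrm n (?p (of_real t) - a) \<le> d" by (simp add: algebra_simps)
      have "nrm n (?p z - ?p (of_real t)) = cmod (z - of_real t) * s"
        by (simp add: s_def nrm_def sum_distrib_left norm_mult[symmetric] algebra_simps)
      then show ?thesis using nrm_triangle[of n "?p z" a "?p (of_real t)"] 1 by simp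
    qed
    have bound: "norm (deriv h (of_real t)) \<le> e * s" if t: "0 \<le> t" "t \<le> 1" for t
    proof -
      define \<rho> where "\<rho> = d / s"
      have \<rho>: "\<rho> > 0" "\<rho> * s = d" using d s by (auto simp: \<rho>_def)
      have in2: "nrm n (?p z - a) \<le> 2 * d" if "z \<in> cball (of_real t) \<rho>" for z
      proof -
        have "cmod (z - of_real t) \<le> \<rho>" using that by (simp add: dist_norm norm_minus_commute)
        then have "cmod (z - of_real t) * s \<le> \<rho> * s" using s by (intro mult_right_mono) auto
        then show ?thesis using near[OF t, of z] \<rho>(2) by simp
      qed
      have fd: "h field_differentiable (at z)" if "z \<in> cball (of_real t) \<rho>" for z
        using hd in2[OF that] d(1) by simp
      have "norm ((deriv ^^ 1) h (of_real t)) \<le> fact 1 * (e / 2 * (2 * d)) / \<rho> ^ 1"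
      proof (rule Cauchy_inequality)
        show "h holomorphic_on ball (of_real t) \<rho>"
          unfolding holomorphic_on_def using fd field_differentiable_at_within by (metis ball_subset_cball subsetD)
        show "continuous_on (cball (of_real t) \<rho>) h"
          using fd by (intro continuous_at_imp_continuous_on ballI field_differentiable_imp_continuous_at)
        show "norm (h z) \<le> e / 2 * (2 * d)" if "norm (of_real t - z) = \<rho>" for z
        proof -
          have le: "nrm n (?p z - a) \<le> 2 * d" using that by (intro in2) (simp add: dist_norm)
          then have "nrm n (?p z - a) < d0" using d by simp
          then have "norm (h z) \<le> e / 2 * nrm n (?p z - a)" unfolding h_def by (intro d0(2) pin)
          also have "\<dots> \<le> e / 2 * (2 * d)" using le e by (intro mult_left_mono) auto
          finally show ?thesis .
        qed
      qed (rule \<rho>(1))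
      then show ?thesis using s d(1) by (simp add: \<rho>_def)
    qed
    have seg: "\<exists>t. 0 \<le> t \<and> t \<le> 1 \<and> z = of_real t" if "z \<in> closed_segment 0 (1::complex)" for z
      using that by (auto simp: closed_segment_def scaleR_conv_of_real)
    have "norm (h 1 - h 0) \<le> e * s * norm (1 - 0 :: complex)"
    proof (rule field_differentiable_bound[where S = "closed_segment 0 1" and f' = "deriv h"])
      fix z :: complex assume "z \<in> closed_segment 0 1"
      then obtain t where t: "0 \<le> t" "t \<le> 1" "z = of_real t" using seg by blast
      have "h field_differentiable (at z)" using near[OF t(1,2), of z] t(3) d(1) by (intro hd) simp
      then show "(h has_field_derivative deriv h z) (at z within closed_segment 0 1)"
        by (simp add: field_differentiable_derivI has_field_derivative_at_within)
      show "norm (deriv h z) \<le> e * s" using bound[OF t(1,2)] t(3) by simp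
    qed auto
    moreover have "h 1 - h 0 = g x - g y - (\<Sum>i<n. c i * (x i - y i))"
    proof -
      have p01: "?p 1 = x" "?p 0 = y" by (auto simp: v_def)
      have "(\<Sum>i<n. c i * (x i - a i)) - (\<Sum>i<n. c i * (y i - a i)) = (\<Sum>i<n. c i * (x i - y i))"
        unfolding sum_subtractf[symmetric] by (rule sum.cong) (auto simp: algebra_simps)
      moreover have "h 1 = G x" "h 0 = G y" by (simp_all only: h_def p01)
      moreover have "G x - G y = g x - g y - ((\<Sum>i<n. c i * (x i - a i)) - (\<Sum>i<n. c i * (y i - a i)))"
        by (simp add: G_def)
      ultimately show ?thesis by (simp only:)
    qed
    ultimately show ?thesis by (simp add: s_def v_def)
  qed simp
  moreover have "d \<le> r" using d by simp
  ultimately show ?thesis using that d(1) by blast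
qed

lemma strict_derivative_bound:
  assumes F: "holo_map n p U F" and a: "a \<in> U" and A: "has_cderiv n p F A a" and e: "e > 0"
  obtains d where "d > 0" "\<And>x. x \<in> cspace n \<Longrightarrow> nrm n (x - a) < d \<Longrightarrow> x \<in> U"
    "\<And>x y. x \<in> cspace n \<Longrightarrow> y \<in> cspace n \<Longrightarrow> nrm n (x - a) < d \<Longrightarrow> nrm n (y - a) < d \<Longrightarrow>
      nrm p (F x - F y - lin p n A (x - y)) \<le> e * nrm n (x - y)"
proof -
  have ac: "a \<in> cspace n" using holo_mapD(4)[OF F a] .
  obtain r where r: "r > 0" "\<And>x. x \<in> cspace n \<Longrightarrow> nrm n (x - a) < r \<Longrightarrow> x \<in> U"
    using copen_contains_ball[OF holo_mapD(1)[OF F] a] by blast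
  define e' where "e' = e / (real p + 1)"
  have e': "e' > 0" using e by (simp add: e'_def)
  have "\<exists>d>0. j < p \<longrightarrow> (\<forall>x\<in>cspace n. \<forall>y\<in>cspace n. nrm n (x - a) < d \<longrightarrow> nrm n (y - a) < d \<longrightarrow>
      cmod (F x j - F y j - (\<Sum>i<n. A j i * (x i - y i))) \<le> e' * nrm n (x - y))" for j
  proof (cases "j < p")
    case True
    have gj: "has_cgradient n (\<lambda>x. F x j) (A j) a" using A True has_cderiv_iff[OF ac] by blast
    obtain d where "d > 0" "\<And>x y. x \<in> cspace n \<Longrightarrow> y \<in> cspace n \<Longrightarrow> nrm n (x - a) < d \<Longrightarrow> nrm n (y - a) < d \<Longrightarrow>
      cmod (F x j - F y j - (\<Sum>i<n. A j i * (x i - y i))) \<le> e' * nrm n (x - y)"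
      by (rule strict_gradient_bound[OF ac r(1) _ gj e']) (use r(2) holo_mapD(3)[OF F] True in auto)
    then show ?thesis by blast
  qed (rule exI[of _ 1], simp)
  then have "\<forall>j. \<exists>d>0. j < p \<longrightarrow> (\<forall>x\<in>cspace n. \<forall>y\<in>cspace n. nrm n (x - a) < d \<longrightarrow> nrm n (y - a) < d \<longrightarrow>
      cmod (F x j - F y j - (\<Sum>i<n. A j i * (x i - y i))) \<le> e' * nrm n (x - y))" ..
  from choice[OF this] obtain \<delta> where \<delta>0: "\<forall>j. \<delta> j > 0 \<and> (j < p \<longrightarrow> (\<forall>x\<in>cspace n. \<forall>y\<in>cspace n.
      nrm n (x - a) < \<delta> j \<longrightarrow> nrm n (y - a) < \<delta> j \<longrightarrow>
      cmod (F x j - F y j - (\<Sum>i<n. A j i * (x i - y i))) \<le> e' * nrm n (x - y)))" ..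
  then have \<delta>: "\<And>j. \<delta> j > 0" "\<And>j x y. j < p \<Longrightarrow> x \<in> cspace n \<Longrightarrow> y \<in> cspace n \<Longrightarrow> nrm n (x - a) < \<delta> j \<Longrightarrow> nrm n (y - a) < \<delta> j \<Longrightarrow>
      cmod (F x j - F y j - (\<Sum>i<n. A j i * (x i - y i))) \<le> e' * nrm n (x - y)" by simp_all
  define d where "d = Min (insert r (\<delta> ` {..<p}))"
  have d: "d > 0" "d \<le> r" "\<And>j. j < p \<Longrightarrow> d \<le> \<delta> j" using \<delta>(1) r(1) by (auto simp: d_def)
  have "nrm p (F x - F y - lin p n A (x - y)) \<le> e * nrm n (x - y)"
    if xy: "x \<in> cspace n" "y \<in> cspace n" "nrm n (x - a) < d" "nrm n (y - a) < d" for x y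
  proof -
    have "nrm p (F x - F y - lin p n A (x - y)) \<le> (\<Sum>j<p. e' * nrm n (x - y))"
      unfolding nrm_def[of p]
    proof (rule sum_mono)
      fix j assume j: "j \<in> {..<p}"
      then show "cmod ((F x - F y - lin p n A (x - y)) j) \<le> e' * nrm n (x - y)"
        using \<delta>(2)[of j x y] d(3)[of j] xy by (simp add: lin_def)
    qed
    also have "\<dots> = (real p * e') * nrm n (x - y)" by simp
    also have "\<dots> \<le> e * nrm n (x - y)"
    proof (rule mult_right_mono)
      have "real p * e' \<le> (real p + 1) * e'" using e' by simp
      then show "real p * e' \<le> e" by (simp add: e'_def)
    qed simp
    finally show ?thesis .
  qed
  then show ?thesis using d r(2) by (intro that[of d]) auto
qed

section \<open>The inverse function theorem\<close>

lemma injective_lin_inverse: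
  assumes inj: "\<And>v. v \<in> cspace N \<Longrightarrow> lin N N A v = origin \<Longrightarrow> v = origin"
  obtains B where "\<And>v. v \<in> cspace N \<Longrightarrow> lin N N B (lin N N A v) = v" "\<And>v. v \<in> cspace N \<Longrightarrow> lin N N A (lin N N B v) = v"
proof -
  define M where "M = mat N N (\<lambda>(j,i). A j i)"
  have M: "M \<in> carrier_mat N N" by (simp add: M_def)
  have det: "det M \<noteq> 0"
  proof
    assume "det M = 0"
    then obtain v where v: "\<exists>k<N. v k \<noteq> 0" "\<And>i. i < N \<Longrightarrow> (\<Sum>k<N. A i k * v k) = 0"
      unfolding M_def det_zero_iff_kernel by blast
    define w where "w = (\<lambda>k. if k < N then v k else 0)"
    have "lin N N A w = origin" using v(2) by (auto simp: lin_def w_def fun_eq_iff)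
    moreover have "w \<in> cspace N" by (simp add: w_def cspace_def)
    ultimately have "w = origin" by (rule inj[rotated])
    then show False using v(1) by (auto simp: w_def fun_eq_iff split: if_splits)
  qed
  define B where "B = (\<lambda>j i. adj_mat M $$ (j,i) / det M)"
  have adj: "adj_mat M \<in> carrier_mat N N" using adj_mat(1)[OF M] .
  have AB: "(\<Sum>k<N. A j k * B k i) = (if j = i then 1 else 0)" if "j < N" "i < N" for i j
  proof -
    have "(M * adj_mat M) $$ (j,i) = (\<Sum>k<N. A j k * adj_mat M $$ (k,i))"
      using that adj M by (simp add: M_def scalar_prod_def atLeast0LessThan)
    then have "(\<Sum>k<N. A j k * adj_mat M $$ (k,i)) = det M * (if j = i then 1 else 0)"
      unfolding adj_mat(2)[OF M] using that by simp
    then have "(\<Sum>k<N. A j k * adj_mat M $$ (k,i)) / det M = (if j = i then 1 else 0)" using det by simp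
    then show ?thesis by (simp add: B_def sum_divide_distrib)
  qed
  have BA: "(\<Sum>k<N. B j k * A k i) = (if j = i then 1 else 0)" if "j < N" "i < N" for i j
  proof -
    have "(adj_mat M * M) $$ (j,i) = (\<Sum>k<N. adj_mat M $$ (j,k) * A k i)"
      using that adj M by (simp add: M_def scalar_prod_def atLeast0LessThan)
    then have "(\<Sum>k<N. adj_mat M $$ (j,k) * A k i) = det M * (if j = i then 1 else 0)"
      unfolding adj_mat(3)[OF M] using that by simp
    then have "(\<Sum>k<N. adj_mat M $$ (j,k) * A k i) / det M = (if j = i then 1 else 0)" using det by simp
    then show ?thesis by (simp add: B_def sum_divide_distrib)
  qed
  have comp: "lin N N P (lin N N Q v) = v"
    if PQ: "\<And>i j. j < N \<Longrightarrow> i < N \<Longrightarrow> (\<Sum>k<N. P j k * Q k i) = (if j = i then 1 else 0)" and v: "v \<in> cspace N" for P Q v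
  proof
    fix j show "lin N N P (lin N N Q v) j = v j"
    proof (cases "j < N")
      case True
      have "lin N N P (lin N N Q v) j = (\<Sum>k<N. \<Sum>i<N. P j k * Q k i * v i)"
        using True by (simp add: lin_def sum_distrib_left mult.assoc)
      also have "\<dots> = (\<Sum>i<N. (\<Sum>k<N. P j k * Q k i) * v i)"
        by (subst sum.swap) (simp add: sum_distrib_right)
      also have "\<dots> = (\<Sum>i<N. if i = j then v i else 0)"
        by (rule sum.cong) (use PQ[OF True] in auto)
      also have "\<dots> = v j" using True by simp
      finally show ?thesis .
    qed (use v in \<open>simp add: lin_def cspace_def\<close>)
  qed
  show ?thesis by (rule that[of B]) (use comp[OF BA] comp[OF AB] in auto)
qed

lemma lin_diff: "lin p n A (v - w) = lin p n A v - lin p n A w"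
  by (rule ext) (simp add: lin_def sum_subtractf algebra_simps)

lemma lin_in_cspace [simp]: "lin p n A v \<in> cspace p"
  by (simp add: lin_def cspace_def)

text \<open>
  Banach's fixed point theorem on a closed ball of \<open>\<complex>\<^sup>N\<close>, whose completeness is that of the coordinates.
\<close>
lemma contraction_fixed_point:
  assumes a: "a \<in> cspace N" and R: "R \<ge> 0"
    and T: "\<And>x. x \<in> cspace N \<Longrightarrow> nrm N (x - a) \<le> R \<Longrightarrow> T x \<in> cspace N \<and> nrm N (T x - a) \<le> R"
    and con: "\<And>x y. x \<in> cspace N \<Longrightarrow> y \<in> cspace N \<Longrightarrow> nrm N (x - a) \<le> R \<Longrightarrow> nrm N (y - a) \<le> R \<Longrightarrow>
      nrm N (T x - T y) \<le> 1/2 * nrm N (x - y)"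
  obtains x where "x \<in> cspace N" "nrm N (x - a) \<le> R" "T x = x"
proof -
  define B where "B = {x \<in> cspace N. nrm N (x - a) \<le> R}"
  interpret Metric_space B "\<lambda>x y. nrm N (x - y)"
  proof
    show "nrm N (x - y) = nrm N (y - x)" for x y by (rule nrm_commute)
    show "(nrm N (x - y) = 0) = (x = y)" if "x \<in> B" "y \<in> B" for x y
      using that nrm_eq_0D[of N x y] by (auto simp: B_def)
    show "nrm N (x - z) \<le> nrm N (x - y) + nrm N (y - z)" for x y z by (rule nrm_triangle)
  qed simp
  have mcomplete
    unfolding mcomplete_def
  proof (intro allI impI)
    fix \<sigma> assume "MCauchy \<sigma>"
    then have \<sigma>: "\<And>k. \<sigma> k \<in> B" and C: "\<And>e. e > 0 \<Longrightarrow> \<exists>K. \<forall>k l. K \<le> k \<longrightarrow> K \<le> l \<longrightarrow> nrm N (\<sigma> k - \<sigma> l) < e"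
      by (auto simp: MCauchy_def)
    have "convergent (\<lambda>k. \<sigma> k i)" if i: "i < N" for i
    proof (rule Cauchy_convergent, rule metric_CauchyI)
      fix e :: real assume "e > 0"
      then obtain K where K: "\<And>k l. K \<le> k \<Longrightarrow> K \<le> l \<Longrightarrow> nrm N (\<sigma> k - \<sigma> l) < e" using C by blast
      have "dist (\<sigma> k i) (\<sigma> l i) < e" if "K \<le> k" "K \<le> l" for k l
        using K[OF that] norm_le_nrm[OF i, of "\<sigma> k - \<sigma> l"] by (simp add: dist_norm)
      then show "\<exists>K. \<forall>k\<ge>K. \<forall>l\<ge>K. dist (\<sigma> k i) (\<sigma> l i) < e" by blast
    qed
    then have "\<forall>i. \<exists>L. i < N \<longrightarrow> (\<lambda>k. \<sigma> k i) \<longlonglongrightarrow> L" by (auto simp: convergent_def)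
    then obtain L0 where L0: "\<And>i. i < N \<Longrightarrow> (\<lambda>k. \<sigma> k i) \<longlonglongrightarrow> L0 i" by metis
    define L where "L = (\<lambda>i. if i < N then L0 i else 0)"
    have L: "L \<in> cspace N" by (simp add: L_def cspace_def)
    have lim: "(\<lambda>k. nrm N (\<sigma> k - z)) \<longlonglongrightarrow> nrm N (L - z)" for z
      unfolding nrm_def minus_apply by (intro tendsto_intros) (simp add: L_def L0)
    have "nrm N (L - a) \<le> R"
      by (rule LIMSEQ_le_const2[OF lim[of a]]) (use \<sigma> in \<open>auto simp: B_def\<close>)
    then have LB: "L \<in> B" using L by (simp add: B_def)
    have "(\<lambda>k. nrm N (\<sigma> k - L)) \<longlonglongrightarrow> 0" using lim[of L] by simp
    then have "limitin mtopology \<sigma> L sequentially"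
      unfolding limit_metric_sequentially using LB \<sigma> by (auto simp: LIMSEQ_iff)
    then show "\<exists>x. limitin mtopology \<sigma> x sequentially" by blast
  qed
  moreover have "B \<noteq> {}" using a R by (auto simp: B_def)
  moreover have "T \<in> B \<rightarrow> B" using T by (auto simp: B_def)
  ultimately obtain x where "x \<in> B" "T x = x"
    by (rule Banach_fixedpoint_thm[where k = "1/2"]) (use con in \<open>auto simp: B_def\<close>)
  then show ?thesis using that by (auto simp: B_def)
qed

text \<open>
  With \<open>B\<close> the inverse of the derivative at \<open>a\<close>, the map \<open>B \<circ> F\<close> differs from the identity by a map with
  Lipschitz constant 1/2. This yields injectivity with a Lipschitz inverse, and
  solutions as fixed points. The lower bound for \<open>F\<close> also shows that its derivative is
  injective at each nearby point, which gives the derivative of the inverse there.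
\<close>
theorem holomorphic_inverse_function:
  assumes F: "holo_map N N U F" and a: "a \<in> U" and A: "has_cderiv N N F A a"
    and inj: "\<And>v. v \<in> cspace N \<Longrightarrow> lin N N A v = origin \<Longrightarrow> v = origin"
  obtains U0 V0 G where "copen N U0" "a \<in> U0" "U0 \<subseteq> U" "F a \<in> V0" "holo_map N N V0 G"
    "\<And>x. x \<in> U0 \<Longrightarrow> F x \<in> V0 \<and> G (F x) = x" "\<And>y. y \<in> V0 \<Longrightarrow> G y \<in> U0 \<and> F (G y) = y"
proof -
  have ac: "a \<in> cspace N" using holo_mapD(4)[OF F a] .
  have Fa: "F a \<in> cspace N" using holo_mapD(2)[OF F a] .
  obtain B where BA: "\<And>v. v \<in> cspace N \<Longrightarrow> lin N N B (lin N N A v) = v"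
    and AB: "\<And>v. v \<in> cspace N \<Longrightarrow> lin N N A (lin N N B v) = v"
    using injective_lin_inverse[OF inj] by blast
  obtain K where K: "K > 0" "\<And>v. nrm N (lin N N B v) \<le> K * nrm N v" using lin_bound by blast
  have e: "1 / (2 * K) > 0" using K by simp
  obtain d where d: "d > 0" "\<And>x. x \<in> cspace N \<Longrightarrow> nrm N (x - a) < d \<Longrightarrow> x \<in> U"
    "\<And>x y. x \<in> cspace N \<Longrightarrow> y \<in> cspace N \<Longrightarrow> nrm N (x - a) < d \<Longrightarrow> nrm N (y - a) < d \<Longrightarrow>
      nrm N (F x - F y - lin N N A (x - y)) \<le> 1 / (2 * K) * nrm N (x - y)"
    by (rule strict_derivative_bound[OF F a A e]) blast
  have half: "nrm N (lin N N B (F x - F y) - (x - y)) \<le> 1/2 * nrm N (x - y)"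
    if xy: "x \<in> cspace N" "y \<in> cspace N" "nrm N (x - a) < d" "nrm N (y - a) < d" for x y
  proof -
    have "lin N N B (F x - F y) - (x - y) = lin N N B (F x - F y - lin N N A (x - y))"
      unfolding lin_diff[of N N B "F x - F y" "lin N N A (x - y)"] using BA[of "x - y"] xy by simp
    then have "nrm N (lin N N B (F x - F y) - (x - y)) \<le> K * nrm N (F x - F y - lin N N A (x - y))"
      using K(2) by simp
    also have "\<dots> \<le> K * (1 / (2 * K) * nrm N (x - y))" using d(3)[OF xy] K(1) by (intro mult_left_mono) auto
    finally show ?thesis using K(1) by simp
  qed
  have lower: "nrm N (x - y) \<le> 2 * K * nrm N (F x - F y)"
    if xy: "x \<in> cspace N" "y \<in> cspace N" "nrm N (x - a) < d" "nrm N (y - a) < d" for x y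
  proof -
    have "nrm N (x - y) \<le> nrm N (lin N N B (F x - F y)) + nrm N (lin N N B (F x - F y) - (x - y))"
      using nrm_diff[of N "lin N N B (F x - F y)" "lin N N B (F x - F y) - (x - y)"] by (simp add: fun_diff_def)
    also have "\<dots> \<le> K * nrm N (F x - F y) + 1/2 * nrm N (x - y)" using K(2) half[OF xy] by (intro add_mono)
    finally show ?thesis by simp
  qed
  define \<eta> where "\<eta> = d / (8 * K)"
  have \<eta>: "\<eta> > 0" "K * \<eta> = d / 8" using d(1) K(1) by (auto simp: \<eta>_def)
  have surj: "\<exists>x\<in>cspace N. nrm N (x - a) < d \<and> F x = y" if y: "y \<in> cspace N" "nrm N (y - F a) < \<eta>" for y
  proof -
    \<comment> \<open>Newton's iteration with the derivative frozen at \<open>a\<close>.\<close>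
    define T where "T = (\<lambda>x. x - lin N N B (F x - y))"
    have Tdiff: "T x - T x' = (x - x') - lin N N B (F x - F x')" for x x'
      by (rule ext) (simp add: T_def lin_diff)
    have con: "nrm N (T x - T x') \<le> 1/2 * nrm N (x - x')"
      if "x \<in> cspace N" "x' \<in> cspace N" "nrm N (x - a) \<le> d / 2" "nrm N (x' - a) \<le> d / 2" for x x'
      unfolding Tdiff nrm_commute[of N "x - x'"] using that d(1) by (intro half) auto
    have Ta: "nrm N (T a - a) \<le> d / 8"
    proof -
      have "nrm N (T a - a) = nrm N (lin N N B (y - F a))"
        unfolding T_def lin_diff nrm_def by (intro sum.cong refl arg_cong[where f = cmod]) simp
      also have "\<dots> \<le> K * nrm N (y - F a)" by (rule K(2))
      also have "\<dots> \<le> K * \<eta>" using y(2) K(1) by (intro mult_left_mono) auto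
      finally show ?thesis using \<eta>(2) by simp
    qed
    have "\<exists>x. x \<in> cspace N \<and> nrm N (x - a) \<le> d / 2 \<and> T x = x"
    proof (rule contraction_fixed_point[OF ac, of "d / 2" T])
      fix x assume x: "x \<in> cspace N" "nrm N (x - a) \<le> d / 2"
      have "nrm N (T x - a) \<le> nrm N (T x - T a) + nrm N (T a - a)" by (rule nrm_triangle)
      also have "\<dots> \<le> 1/2 * nrm N (x - a) + d / 8" using con[OF x(1) ac x(2)] Ta d(1) by (intro add_mono) auto
      also have "\<dots> \<le> d / 2" using x(2) d(1) by simp
      finally show "T x \<in> cspace N \<and> nrm N (T x - a) \<le> d / 2" using x(1) by (simp add: T_def)
    qed (use con d(1) in auto)
    then obtain x where x: "x \<in> cspace N" "nrm N (x - a) \<le> d / 2" "T x = x" by blast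
    have "lin N N B (F x - y) = origin"
    proof
      fix i show "lin N N B (F x - y) i = 0" using fun_cong[OF x(3), of i] by (simp add: T_def)
    qed
    moreover have "F x \<in> cspace N" using holo_mapD(2)[OF F d(2)[OF x(1)]] x(2) d(1) by simp
    ultimately have "F x - y = lin N N A origin" using AB[of "F x - y"] y(1) by simp
    also have "\<dots> = origin" by (auto simp: lin_def)
    finally have "F x = y" by (simp add: fun_eq_iff)
    then show ?thesis using x d(1) by (intro bexI[of _ x]) auto
  qed
  define V0 where "V0 = {y \<in> cspace N. nrm N (y - F a) < \<eta>}"
  define W where "W = {x \<in> cspace N. nrm N (x - a) < d}"
  define U0 where "U0 = {x \<in> W. F x \<in> V0}"
  have V0: "copen N V0" unfolding V0_def by (rule copen_ball)
  have FW: "holo_map N N W F"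
    by (rule holo_map_subset[OF F]) (use copen_ball d(2) in \<open>auto simp: W_def\<close>)
  have U0: "copen N U0" unfolding U0_def by (rule holo_map_preimage[OF FW V0])
  have inU0: "x \<in> cspace N" "nrm N (x - a) < d" "F x \<in> V0" if "x \<in> U0" for x
    using that by (auto simp: U0_def W_def)
  have injF: "inj_on F U0"
  proof (rule inj_onI)
    fix x y assume xy: "x \<in> U0" "y \<in> U0" "F x = F y"
    then have "nrm N (x - y) = 0" using lower[of x y] inU0[of x] inU0[of y] nrm_nonneg[of N "x - y"] by simp
    then show "x = y" using nrm_eq_0D inU0 xy by blast
  qed
  have imF: "F ` U0 = V0"
  proof
    show "V0 \<subseteq> F ` U0"
    proof
      fix y assume "y \<in> V0"
      then obtain x where "x \<in> cspace N" "nrm N (x - a) < d" "F x = y" using surj by (auto simp: V0_def)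
      then show "y \<in> F ` U0" using \<open>y \<in> V0\<close> by (intro image_eqI[of _ _ x]) (auto simp: U0_def W_def)
    qed
  qed (use inU0 in auto)
  define G where "G = the_inv_into U0 F"
  have GF: "G (F x) = x" if "x \<in> U0" for x using injF that by (simp add: G_def the_inv_into_f_f)
  have FG: "G y \<in> U0" "F (G y) = y" if "y \<in> V0" for y
    using that imF GF by (auto simp: image_iff)
  have "holo_map N N V0 G"
  proof (rule holo_mapI)
    show "G y \<in> cspace N" if "y \<in> V0" for y using inU0 FG that by blast
    fix y j assume y: "y \<in> V0" and j: "j < N"
    define x where "x = G y"
    have x: "x \<in> U0" "F x = y" "x \<in> cspace N" using FG[OF y] inU0 by (auto simp: x_def)
    have yc: "y \<in> cspace N" using y by (simp add: V0_def)
    have xU: "x \<in> U" using inU0[OF x(1)] d(2) by blast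
    obtain A1 where A1: "has_cderiv N N F A1 x" using holo_map_has_cderiv[OF F xU] .
    have inj1: "v = origin" if v: "v \<in> cspace N" "lin N N A1 v = origin" for v
    proof (rule ccontr)
      assume "v \<noteq> origin"
      have "nrm N v \<noteq> 0" using nrm_eq_0D[of N v origin] v(1) \<open>v \<noteq> origin\<close> by (auto simp: cspace_def fun_diff_def)
      then have nv: "nrm N v > 0" using nrm_nonneg[of N v] by linarith
      have e4: "1 / (4 * K) > 0" using K by simp
      obtain d1 where d1: "d1 > 0" "\<And>z. z \<in> cspace N \<Longrightarrow> nrm N (z - x) < d1 \<Longrightarrow>
        nrm N (F z - F x - lin N N A1 (z - x)) \<le> 1 / (4 * K) * nrm N (z - x)"
        by (rule has_cderivD[OF A1 e4]) blast
      define \<delta> where "\<delta> = min d1 (d - nrm N (x - a))"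
      have \<delta>: "\<delta> > 0" "\<delta> \<le> d1" "\<delta> \<le> d - nrm N (x - a)" using d1(1) inU0(2)[OF x(1)] by (auto simp: \<delta>_def)
      define t where "t = \<delta> / (2 * nrm N v)"
      have t: "t > 0" "t * nrm N v = \<delta> / 2" using \<delta> nv by (auto simp: t_def)
      define z where "z = (\<lambda>i. x i + of_real t * v i)"
      have zx: "z - x = (\<lambda>i. of_real t * v i)" by (auto simp: z_def)
      have nzx: "nrm N (z - x) = \<delta> / 2" unfolding zx nrm_scale using t by simp
      have zc: "z \<in> cspace N" using x(3) v(1) by (simp add: z_def)
      have za: "nrm N (z - a) < d" using nrm_triangle[of N z a x] nzx \<delta> by simp
      have l0: "lin N N A1 (z - x) = origin"
      proof
        fix i
        have "lin N N A1 (z - x) i = of_real t * lin N N A1 v i"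
          unfolding zx by (simp add: lin_def sum_distrib_left mult.left_commute)
        then show "lin N N A1 (z - x) i = 0" using v(2) by simp
      qed
      have "nrm N (z - x) < d1" using nzx \<delta> by simp
      then have "nrm N (F z - F x - lin N N A1 (z - x)) \<le> 1 / (4 * K) * (\<delta> / 2)"
        using d1(2)[OF zc] by (simp only: nzx)
      moreover have "nrm N (F z - F x - lin N N A1 (z - x)) = nrm N (F z - F x)"
        unfolding l0 by (rule nrm_cong) simp
      ultimately have "nrm N (F z - F x) \<le> 1 / (4 * K) * (\<delta> / 2)" by simp
      then have "2 * K * nrm N (F z - F x) \<le> 2 * K * (1 / (4 * K) * (\<delta> / 2))"
        using K(1) by (intro mult_left_mono) auto
      then have "nrm N (z - x) \<le> \<delta> / 4"
        using lower[OF zc x(3) za inU0(2)[OF x(1)]] K(1) by simp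
      then show False using nzx \<delta>(1) by simp
    qed
    obtain B1 where B1: "\<And>v. v \<in> cspace N \<Longrightarrow> lin N N B1 (lin N N A1 v) = v"
      using injective_lin_inverse[OF inj1] by blast
    obtain K1 where K1: "K1 > 0" "\<And>v. nrm N (lin N N B1 v) \<le> K1 * nrm N v" using lin_bound by blast
    have "has_cderiv N N G B1 y" unfolding has_cderiv_def
    proof (intro allI impI)
      fix e :: real assume e: "e > 0"
      define e1 where "e1 = e / (2 * K * K1)"
      have e1: "e1 > 0" using e K(1) K1(1) by (simp add: e1_def)
      obtain d1 where d1: "d1 > 0" "\<And>z. z \<in> cspace N \<Longrightarrow> nrm N (z - x) < d1 \<Longrightarrow>
        nrm N (F z - F x - lin N N A1 (z - x)) \<le> e1 * nrm N (z - x)"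
        by (rule has_cderivD[OF A1 e1]) blast
      obtain r where r: "r > 0" "\<And>w. w \<in> cspace N \<Longrightarrow> nrm N (w - y) < r \<Longrightarrow> w \<in> V0"
        using copen_contains_ball[OF V0 y] by blast
      define \<delta> where "\<delta> = min r (d1 / (2 * K))"
      have \<delta>: "\<delta> > 0" "\<delta> \<le> r" "\<delta> \<le> d1 / (2 * K)" using r(1) d1(1) K(1) by (auto simp: \<delta>_def)
      have "nrm N (G w - G y - lin N N B1 (w - y)) \<le> e * nrm N (w - y)" if w: "w \<in> cspace N" "nrm N (w - y) < \<delta>" for w
      proof -
        have wV: "w \<in> V0" using r(2)[OF w(1)] w(2) \<delta> by simp
        define z where "z = G w"
        have z: "z \<in> U0" "F z = w" using FG[OF wV] by (auto simp: z_def)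
        have zx: "nrm N (z - x) \<le> 2 * K * nrm N (w - y)"
          using lower[of z x] inU0[OF z(1)] inU0[OF x(1)] z(2) x(2) by simp
        also have "\<dots> < 2 * K * (d1 / (2 * K))" using w(2) \<delta>(3) K(1) by (intro mult_strict_left_mono) auto
        finally have "nrm N (z - x) < d1" using K(1) by simp
        then have 1: "nrm N (w - y - lin N N A1 (z - x)) \<le> e1 * nrm N (z - x)"
          using d1(2)[OF inU0(1)[OF z(1)]] z(2) x(2) by simp
        have "nrm N (G w - G y - lin N N B1 (w - y)) = nrm N (lin N N B1 (w - y - lin N N A1 (z - x)))"
        proof -
          have "lin N N B1 (w - y - lin N N A1 (z - x)) = lin N N B1 (w - y) - (z - x)"
            unfolding lin_diff[of N N B1 "w - y"] using B1[of "z - x"] inU0(1)[OF z(1)] x(3) by simp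
          then show ?thesis unfolding z_def x_def by (simp only: nrm_commute)
        qed
        also have "\<dots> \<le> K1 * (e1 * nrm N (z - x))" by (rule order_trans[OF K1(2) mult_left_mono[OF 1]]) (use K1 in auto)
        also have "\<dots> \<le> K1 * (e1 * (2 * K * nrm N (w - y)))" using zx K1(1) e1 by (intro mult_left_mono) auto
        also have "\<dots> = e * nrm N (w - y)" using K(1) K1(1) by (simp add: e1_def)
        finally show ?thesis .
      qed
      then show "\<exists>d>0. \<forall>w\<in>cspace N. nrm N (w - y) < d \<longrightarrow> nrm N (G w - G y - lin N N B1 (w - y)) \<le> e * nrm N (w - y)"
        using \<delta>(1) by blast
    qed
    then show "cdiff N (\<lambda>w. G w j) y" using has_cderiv_iff[OF yc] j unfolding cdiff_def by blast
  qed (rule V0)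
  moreover have "F a \<in> V0" using Fa \<eta>(1) by (simp add: V0_def)
  moreover have "a \<in> U0" using ac d(1) \<open>F a \<in> V0\<close> by (simp add: U0_def W_def)
  moreover have "U0 \<subseteq> U" using inU0 d(2) by blast
  ultimately show ?thesis using U0 GF FG inU0(3) by (intro that[of U0 V0 G]) auto
qed

section \<open>Local biholomorphisms and parameters\<close>

definition tail :: "nat \<Rightarrow> (nat \<Rightarrow> complex) \<Rightarrow> nat \<Rightarrow> complex" where
  "tail r z = (\<lambda>i. z (r + i))"

definition trunc :: "nat \<Rightarrow> (nat \<Rightarrow> complex) \<Rightarrow> nat \<Rightarrow> complex" where
  "trunc m z = (\<lambda>i. if i < m then z i else 0)"

lemma join_simps [simp]: "i < r \<Longrightarrow> join r t x i = t i" "join r t x (r + i) = x i"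
  by (simp_all add: join_def)

lemma tail_join [simp]: "tail r (join r t x) = x"
  by (simp add: tail_def)

lemma join_tail [simp]: "join r z (tail r z) = z"
  by (auto simp: join_def tail_def)

lemma join_eqI: "(\<And>i. i < r \<Longrightarrow> z i = t i) \<Longrightarrow> tail r z = x \<Longrightarrow> z = join r t x"
  by (auto simp: join_def tail_def)

lemma join_inject: "join r t x = join r t x' \<longleftrightarrow> x = x'"
  by (metis tail_join)

lemma join_in_cspace [simp]: "x \<in> cspace n \<Longrightarrow> join r t x \<in> cspace (r + n)"
  by (auto simp: cspace_def join_def)

lemma tail_in_cspace [simp]: "z \<in> cspace (r + n) \<Longrightarrow> tail r z \<in> cspace n"
  by (simp add: cspace_def tail_def)

lemma trunc_in_cspace [simp]: "trunc m z \<in> cspace m"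
  by (simp add: cspace_def trunc_def)

lemma trunc_id: "z \<in> cspace m \<Longrightarrow> trunc m z = z"
  by (auto simp: cspace_def trunc_def)

lemma origin_in_cspace [simp]: "origin \<in> cspace n"
  by (simp add: cspace_def)

lemma id_times_apply: "id_times r f z = join r z (f (tail r z))"
  by (simp add: id_times_def tail_def)

lemma holo_trunc: "holo_map q m (cspace q) (trunc m)"
  by (rule holo_mapI) (auto simp: trunc_def intro: copen_cspace cdiff_coord, simp add: cspace_def)

lemma holo_tail: "holo_map (r + n) n (cspace (r + n)) (tail r)"
  by (rule holo_mapI) (auto simp: tail_def intro: copen_cspace cdiff_coord, simp add: cspace_def)

lemma holo_join_origin: "holo_map n (r + n) (cspace n) (join r origin)"
proof (rule holo_mapI)
  fix a j assume "a \<in> cspace n" "j < r + n"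
  then show "cdiff n (\<lambda>x. join r origin x j) a"
    unfolding join_def by (intro cdiff_if cdiff_const cdiff_coord)
qed (auto intro: copen_cspace)

lemma holo_slice: "holo_map (r + n) (r + n) (cspace (r + n)) (\<lambda>z. join r origin (tail r z))"
proof -
  have "{z \<in> cspace (r + n). tail r z \<in> cspace n} = cspace (r + n)" by auto
  then show ?thesis using holo_map_comp[OF holo_tail holo_join_origin, of r n r] by simp
qed

lemma holo_id_times:
  assumes "holo_map n p \<omega> f"
  shows "holo_map (r + n) (r + p) {z \<in> cspace (r + n). tail r z \<in> \<omega>} (id_times r f)"
proof (rule holo_mapI)
  have H: "holo_map (r + n) p {z \<in> cspace (r + n). tail r z \<in> \<omega>} (\<lambda>z. f (tail r z))"
    by (rule holo_map_comp[OF holo_tail assms])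
  show "copen (r + n) {z \<in> cspace (r + n). tail r z \<in> \<omega>}" using holo_mapD(1)[OF H] .
  show "id_times r f z \<in> cspace (r + p)" if "z \<in> {z \<in> cspace (r + n). tail r z \<in> \<omega>}" for z
    using holo_mapD(2)[OF H that] by (simp add: id_times_apply)
  fix a j assume a: "a \<in> {z \<in> cspace (r + n). tail r z \<in> \<omega>}" and j: "j < r + p"
  have "cdiff (r + n) (\<lambda>z. if j < r then z j else f (tail r z) (j - r)) a"
    using holo_mapD(3)[OF H a, of "j - r"] a j by (intro cdiff_if cdiff_coord) auto
  then show "cdiff (r + n) (\<lambda>z. id_times r f z j) a" by (simp add: id_times_apply join_def)
qed

lemma copen_Int: "copen n U \<Longrightarrow> copen n V \<Longrightarrow> copen n (U \<inter> V)"
  by (rule openin_Int)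

lemma cspace_mono: "n \<le> m \<Longrightarrow> x \<in> cspace n \<Longrightarrow> x \<in> cspace m"
  by (simp add: cspace_def)

lemma line_in_copen:
  assumes "copen n W" "a \<in> W" "v \<in> cspace n"
  obtains e where "e > 0" "\<And>z. cmod z < e \<Longrightarrow> (\<lambda>i. a i + z * v i) \<in> W"
proof -
  have a: "a \<in> cspace n" using copen_subset[OF assms(1)] assms(2) by auto
  obtain d where d: "d > 0" "\<And>x. x \<in> cspace n \<Longrightarrow> nrm n (x - a) < d \<Longrightarrow> x \<in> W"
    using copen_contains_ball[OF assms(1,2)] by blast
  have pos: "nrm n v + 1 > 0" using nrm_nonneg[of n v] by linarith
  have "(\<lambda>i. a i + z * v i) \<in> W" if z: "cmod z < d / (nrm n v + 1)" for z
  proof (rule d(2))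
    have "(\<lambda>i. a i + z * v i) - a = (\<lambda>i. z * v i)" by auto
    then have "nrm n ((\<lambda>i. a i + z * v i) - a) = cmod z * nrm n v" by (simp only: nrm_scale)
    also have "\<dots> \<le> cmod z * (nrm n v + 1)" by (intro mult_left_mono) auto
    also have "\<dots> < d" using z pos by (simp add: pos_less_divide_eq)
    finally show "nrm n ((\<lambda>i. a i + z * v i) - a) < d" .
  qed (use a assms(3) in simp)
  then show ?thesis using that[of "d / (nrm n v + 1)"] d(1) pos by simp
qed

text \<open>
  Derivatives are computed along complex lines, where the calculus of one variable is available.
\<close>
lemma has_cderiv_line_unique:
  assumes A: "has_cderiv n p F A a" and a: "a \<in> cspace n" "v \<in> cspace n" and j: "j < p"
    and W: "copen n W" "a \<in> W"
    and eq: "\<And>z. (\<lambda>i. a i + z * v i) \<in> W \<Longrightarrow> F (\<lambda>i. a i + z * v i) j = h z"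
    and h: "(h has_field_derivative D) (at 0)"
  shows "lin p n A v j = D"
proof -
  obtain e where e: "e > 0" "\<And>z. cmod z < e \<Longrightarrow> (\<lambda>i. a i + z * v i) \<in> W"
    using line_in_copen[OF W a(2)] by blast
  have "has_cgradient n (\<lambda>x. F x j) (A j) (\<lambda>i. a i + 0 * v i)"
    using A has_cderiv_iff[OF a(1)] j by simp
  from line_derivative[OF a this]
  have "((\<lambda>z. F (\<lambda>i. a i + z * v i) j) has_field_derivative lin p n A v j) (at 0)"
    using j by (simp add: lin_def)
  then have "(h has_field_derivative lin p n A v j) (at 0)"
    by (rule has_field_derivative_transform_within[OF _ e(1)]) (use eq e(2) in \<open>auto simp: dist_norm\<close>)
  then show ?thesis using h by (rule DERIV_unique)
qed

lemma finite_separated: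
  assumes "finite P" "P \<subseteq> cspace n"
  obtains \<epsilon> where "\<epsilon> > 0" "\<And>a b x. a \<in> P \<Longrightarrow> b \<in> P \<Longrightarrow> nrm n (x - a) < \<epsilon> \<Longrightarrow> nrm n (x - b) < \<epsilon> \<Longrightarrow> a = b"
proof -
  define E where "E = insert 1 ((\<lambda>(a,b). nrm n (a - b) / 2) ` {(a,b) \<in> P \<times> P. a \<noteq> b})"
  have "finite {(a,b) \<in> P \<times> P. a \<noteq> b}"
    by (rule finite_subset[of _ "P \<times> P"]) (use assms(1) in auto)
  then have E: "finite E" "E \<noteq> {}" by (simp_all add: E_def)
  have pos: "nrm n (a - b) > 0" if "a \<in> P" "b \<in> P" "a \<noteq> b" for a b
  proof -
    have "nrm n (a - b) \<noteq> 0" using nrm_eq_0D that assms(2) by blast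
    then show ?thesis using nrm_nonneg[of n "a - b"] by linarith
  qed
  have "Min E > 0" using E pos by (auto simp: E_def)
  moreover have "a = b" if ab: "a \<in> P" "b \<in> P" "nrm n (x - a) < Min E" "nrm n (x - b) < Min E" for a b x
  proof (rule ccontr)
    assume "a \<noteq> b"
    then have "nrm n (a - b) / 2 \<in> E" using ab by (auto simp: E_def)
    then have "Min E \<le> nrm n (a - b) / 2" by (rule Min_le[OF E(1)])
    moreover have "nrm n (a - b) \<le> nrm n (x - a) + nrm n (x - b)"
      using nrm_triangle[of n a b x] by (simp add: nrm_commute)
    ultimately show False using ab by simp
  qed
  ultimately show ?thesis using that by blast
qed

text \<open>
  The local inverses at the points of \<open>P\<close> are glued. Source and target neighbourhoods of
  different points are kept disjoint, so that the union is injective.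
\<close>
lemma biholo_germ_fixed_points:
  assumes \<Phi>: "holo_map N N \<Omega> \<Phi>" and P: "finite P" "P \<subseteq> \<Omega>" and fixp: "\<And>a. a \<in> P \<Longrightarrow> \<Phi> a = a"
    and inj: "\<And>a A v. a \<in> P \<Longrightarrow> has_cderiv N N \<Phi> A a \<Longrightarrow> v \<in> cspace N \<Longrightarrow> lin N N A v = origin \<Longrightarrow> v = origin"
  shows "biholo_germ N P P \<Phi>"
proof -
  have Pc: "P \<subseteq> cspace N" using P(2) holo_mapD(4)[OF \<Phi>] by blast
  obtain \<epsilon> where \<epsilon>: "\<epsilon> > 0" "\<And>a b x. a \<in> P \<Longrightarrow> b \<in> P \<Longrightarrow> nrm N (x - a) < \<epsilon> \<Longrightarrow> nrm N (x - b) < \<epsilon> \<Longrightarrow> a = b"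
    using finite_separated[OF P(1) Pc] by blast
  have "\<exists>U V G. copen N U \<and> a \<in> U \<and> U \<subseteq> \<Omega> \<and> a \<in> V \<and> holo_map N N V G \<and>
      (\<forall>x\<in>U. \<Phi> x \<in> V \<and> G (\<Phi> x) = x \<and> nrm N (x - a) < \<epsilon> \<and> nrm N (\<Phi> x - a) < \<epsilon>) \<and>
      (\<forall>y\<in>V. G y \<in> U \<and> \<Phi> (G y) = y)" if a: "a \<in> P" for a
  proof -
    define \<Omega>' where "\<Omega>' = {x \<in> \<Omega>. \<Phi> x \<in> {x \<in> cspace N. nrm N (x - a) < \<epsilon>}} \<inter> {x \<in> cspace N. nrm N (x - a) < \<epsilon>}"
    have "copen N \<Omega>'" unfolding \<Omega>'_def by (intro copen_Int holo_map_preimage[OF \<Phi>] copen_ball)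
    then have \<Phi>': "holo_map N N \<Omega>' \<Phi>" by (rule holo_map_subset[OF \<Phi>]) (auto simp: \<Omega>'_def)
    have a': "a \<in> \<Omega>'" using a P Pc fixp[OF a] \<epsilon>(1) by (auto simp: \<Omega>'_def)
    obtain A where A: "has_cderiv N N \<Phi> A a" using holo_map_has_cderiv[OF \<Phi>' a'] .
    obtain U V G where UVG: "copen N U" "a \<in> U" "U \<subseteq> \<Omega>'" "\<Phi> a \<in> V" "holo_map N N V G"
      "\<And>x. x \<in> U \<Longrightarrow> \<Phi> x \<in> V \<and> G (\<Phi> x) = x" "\<And>y. y \<in> V \<Longrightarrow> G y \<in> U \<and> \<Phi> (G y) = y"
      using holomorphic_inverse_function[OF \<Phi>' a' A inj[OF a A]] by blast
    show ?thesis
    proof (rule exI[of _ U], rule exI[of _ V], rule exI[of _ G], intro conjI ballI)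
      show "U \<subseteq> \<Omega>" using UVG(3) by (auto simp: \<Omega>'_def)
      show "a \<in> V" using UVG(4) fixp[OF a] by simp
      show "nrm N (x - a) < \<epsilon>" "nrm N (\<Phi> x - a) < \<epsilon>" if "x \<in> U" for x
        using that UVG(3) by (auto simp: \<Omega>'_def)
    qed (use UVG in auto)
  qed
  then have ex: "\<forall>a\<in>P. \<exists>U V G. copen N U \<and> a \<in> U \<and> U \<subseteq> \<Omega> \<and> a \<in> V \<and> holo_map N N V G \<and>
      (\<forall>x\<in>U. \<Phi> x \<in> V \<and> G (\<Phi> x) = x \<and> nrm N (x - a) < \<epsilon> \<and> nrm N (\<Phi> x - a) < \<epsilon>) \<and>
      (\<forall>y\<in>V. G y \<in> U \<and> \<Phi> (G y) = y)" ..
  from bchoice[OF ex] obtain U where ex: "\<forall>a\<in>P. \<exists>V G. copen N (U a) \<and> a \<in> U a \<and> U a \<subseteq> \<Omega> \<and> a \<in> V \<and>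
      holo_map N N V G \<and>
      (\<forall>x\<in>U a. \<Phi> x \<in> V \<and> G (\<Phi> x) = x \<and> nrm N (x - a) < \<epsilon> \<and> nrm N (\<Phi> x - a) < \<epsilon>) \<and>
      (\<forall>y\<in>V. G y \<in> U a \<and> \<Phi> (G y) = y)" ..
  from bchoice[OF ex] obtain V where ex: "\<forall>a\<in>P. \<exists>G. copen N (U a) \<and> a \<in> U a \<and> U a \<subseteq> \<Omega> \<and> a \<in> V a \<and>
      holo_map N N (V a) G \<and>
      (\<forall>x\<in>U a. \<Phi> x \<in> V a \<and> G (\<Phi> x) = x \<and> nrm N (x - a) < \<epsilon> \<and> nrm N (\<Phi> x - a) < \<epsilon>) \<and>
      (\<forall>y\<in>V a. G y \<in> U a \<and> \<Phi> (G y) = y)" ..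
  from bchoice[OF ex] obtain G where all: "\<forall>a\<in>P. copen N (U a) \<and> a \<in> U a \<and> U a \<subseteq> \<Omega> \<and> a \<in> V a \<and>
      holo_map N N (V a) (G a) \<and>
      (\<forall>x\<in>U a. \<Phi> x \<in> V a \<and> G a (\<Phi> x) = x \<and> nrm N (x - a) < \<epsilon> \<and> nrm N (\<Phi> x - a) < \<epsilon>) \<and>
      (\<forall>y\<in>V a. G a y \<in> U a \<and> \<Phi> (G a y) = y)" ..
  have U: "copen N (U a)" "a \<in> U a" "U a \<subseteq> \<Omega>" and V: "a \<in> V a" and G: "holo_map N N (V a) (G a)"
    if "a \<in> P" for a
    using bspec[OF all that] by simp_all
  have UV: "\<Phi> x \<in> V a \<and> G a (\<Phi> x) = x \<and> nrm N (x - a) < \<epsilon> \<and> nrm N (\<Phi> x - a) < \<epsilon>"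
    if "a \<in> P" "x \<in> U a" for a x
    using bspec[OF all that(1)] that(2) by simp
  have VU: "G a y \<in> U a \<and> \<Phi> (G a y) = y" if "a \<in> P" "y \<in> V a" for a y
    using bspec[OF all that(1)] that(2) by simp
  define UU where "UU = (\<Union>a\<in>P. U a)"
  define VV where "VV = (\<Union>a\<in>P. V a)"
  have inj\<Phi>: "inj_on \<Phi> UU"
  proof (rule inj_onI)
    fix x y assume "x \<in> UU" "y \<in> UU" and eq: "\<Phi> x = \<Phi> y"
    then obtain a b where ab: "a \<in> P" "x \<in> U a" "b \<in> P" "y \<in> U b" by (auto simp: UU_def)
    have "nrm N (\<Phi> x - a) < \<epsilon>" "nrm N (\<Phi> x - b) < \<epsilon>"
      using UV[OF ab(1,2)] UV[OF ab(3,4)] unfolding eq by blast+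
    then have "a = b" by (rule \<epsilon>(2)[OF ab(1,3)])
    then have "G a (\<Phi> x) = x" "G a (\<Phi> y) = y" using UV[OF ab(1,2)] UV[OF ab(3,4)] by blast+
    then show "x = y" by (metis eq)
  qed
  have im: "\<Phi> ` UU = VV"
  proof
    show "VV \<subseteq> \<Phi> ` UU"
    proof
      fix y assume "y \<in> VV"
      then obtain a where a: "a \<in> P" "y \<in> V a" by (auto simp: VV_def)
      then show "y \<in> \<Phi> ` UU" using VU[OF a] by (intro image_eqI[of _ _ "G a y"]) (auto simp: UU_def)
    qed
  qed (use UV in \<open>auto simp: UU_def VV_def\<close>)
  have inv: "inv_into UU \<Phi> y = G a y" if a: "a \<in> P" "y \<in> V a" for a y
    using VU[OF a] a inj\<Phi> by (intro inv_into_f_eq) (auto simp: UU_def)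
  have 1: "holo_map N N VV (inv_into UU \<Phi>)"
    unfolding VV_def
  proof (rule holo_map_Union)
    fix X assume "X \<in> V ` P"
    then obtain a where a: "a \<in> P" "X = V a" by blast
    show "holo_map N N X (inv_into UU \<Phi>)"
      unfolding a(2) by (rule holo_map_cong[OF G[OF a(1)]]) (use inv a in auto)
  qed
  have 2: "holo_map N N UU \<Phi>"
    by (rule holo_map_subset[OF \<Phi>]) (use U in \<open>auto simp: UU_def intro!: openin_Union\<close>)
  have 3: "\<Phi> ` P = P" using fixp by auto
  have 4: "P \<subseteq> UU" "P \<subseteq> VV" using U V by (auto simp: UU_def VV_def)
  have 5: "bij_betw \<Phi> UU VV" using inj\<Phi> im by (simp add: bij_betw_def)
  show ?thesis unfolding biholo_germ_def
    by (rule exI[of _ UU], rule exI[of _ VV]) (simp add: 1 2 3 4 5)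
qed

text \<open>
  In block form the derivative is triangular with identities on the diagonal.
\<close>
lemma biholo_germ_unfolding_id:
  assumes \<Phi>: "holo_map (r + n) (r + n) \<Omega> \<Phi>" and S: "finite S" "\<And>s. s \<in> S \<Longrightarrow> join r origin s \<in> \<Omega>" "S \<subseteq> cspace n"
    and par: "\<And>z k. z \<in> \<Omega> \<Longrightarrow> k < r \<Longrightarrow> \<Phi> z k = z k"
    and id: "\<And>x. join r origin x \<in> \<Omega> \<Longrightarrow> \<Phi> (join r origin x) = join r origin x"
  shows "biholo_germ (r + n) (join r origin ` S) (join r origin ` S) \<Phi>"
proof (rule biholo_germ_fixed_points[OF \<Phi>])
  show "finite (join r origin ` S)" "join r origin ` S \<subseteq> \<Omega>" using S by auto
  show "\<Phi> a = a" if "a \<in> join r origin ` S" for a using that S id by auto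
  fix a A v assume a: "a \<in> join r origin ` S" and A: "has_cderiv (r + n) (r + n) \<Phi> A a"
    and v: "v \<in> cspace (r + n)" "lin (r + n) (r + n) A v = origin"
  have a\<Omega>: "a \<in> \<Omega>" using a S by auto
  have ac: "a \<in> cspace (r + n)" using holo_mapD(4)[OF \<Phi> a\<Omega>] .
  have \<Omega>: "copen (r + n) \<Omega>" using holo_mapD(1)[OF \<Phi>] .
  have der: "((\<lambda>z. a k + z * v k) has_field_derivative v k) (at 0)" for k
    by (auto intro!: derivative_eq_intros)
  have vr: "v k = 0" if k: "k < r" for k
  proof -
    have "lin (r + n) (r + n) A v k = v k"
      by (rule has_cderiv_line_unique[OF A ac v(1) _ \<Omega> a\<Omega> _ der]) (use k par in auto)
    then show ?thesis using v(2) by simp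
  qed
  have ar: "a k = 0" if "k < r" for k using a that by auto
  have line: "(\<lambda>i. a i + z * v i) = join r origin (tail r (\<lambda>i. a i + z * v i))" for z
    by (rule join_eqI) (auto simp: vr ar)
  show "v = origin"
  proof
    fix k show "v k = 0"
    proof (cases "k < r + n")
      case True
      have "lin (r + n) (r + n) A v k = v k"
      proof (rule has_cderiv_line_unique[OF A ac v(1) True \<Omega> a\<Omega> _ der])
        fix z assume "(\<lambda>i. a i + z * v i) \<in> \<Omega>"
        then have "\<Phi> (\<lambda>i. a i + z * v i) = (\<lambda>i. a i + z * v i)" using id line[of z] by metis
        then show "\<Phi> (\<lambda>i. a i + z * v i) k = a k + z * v k" by simp
      qed
      then show ?thesis using v(2) by simp
    qed (use v(1) in \<open>simp add: cspace_def\<close>)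
  qed
qed

section \<open>Stability of normal crossings\<close>

locale normal_crossing_unfolding =
  fixes n p r :: nat and S :: "(nat \<Rightarrow> complex) set" and y :: "nat \<Rightarrow> complex"
    and f F :: "(nat \<Rightarrow> complex) \<Rightarrow> nat \<Rightarrow> complex"
    and D :: "(nat \<Rightarrow> complex) \<Rightarrow> (nat \<Rightarrow> complex) \<Rightarrow> nat \<Rightarrow> complex"
    and \<nu> :: "(nat \<Rightarrow> complex) \<Rightarrow> nat \<Rightarrow> nat \<Rightarrow> complex"
    and \<omega> \<Omega> :: "(nat \<Rightarrow> complex) set"
  assumes np: "n \<le> p" and finS: "finite S" and yc: "y \<in> cspace p"
    and f: "holo_map n p \<omega> f" and S\<omega>: "S \<subseteq> \<omega>" and fS: "\<And>s. s \<in> S \<Longrightarrow> f s = y"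
    and F: "holo_map (r + n) (r + p) \<Omega> F" and S\<Omega>: "\<And>s. s \<in> S \<Longrightarrow> join r origin s \<in> \<Omega>"
    and Fpar: "\<And>z k. z \<in> \<Omega> \<Longrightarrow> k < r \<Longrightarrow> F z k = z k"
    and F0: "\<And>x. x \<in> \<omega> \<Longrightarrow> F (join r origin x) = join r origin (f x)"
    and D: "\<And>s v j. s \<in> S \<Longrightarrow> v \<in> cspace n \<Longrightarrow> j < p \<Longrightarrow>
      ((\<lambda>z. f (\<lambda>i. s i + z * v i) j) has_field_derivative D s v j) (at 0)"
    and \<nu>c: "\<And>s i. s \<in> S \<Longrightarrow> i < p - n \<Longrightarrow> \<nu> s i \<in> cspace p"
    and complement: "\<And>s v w. s \<in> S \<Longrightarrow> v \<in> cspace n \<Longrightarrow>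
      (\<And>j. j < p \<Longrightarrow> D s v j + (\<Sum>i<p-n. w i * \<nu> s i j) = 0) \<Longrightarrow> v = origin \<and> (\<forall>i<p-n. w i = 0)"
    and cross: "\<And>s s' i. s \<in> S \<Longrightarrow> s' \<in> S \<Longrightarrow> s \<noteq> s' \<Longrightarrow> i < p - n \<Longrightarrow>
      \<exists>v\<in>cspace n. \<forall>j<p. \<nu> s i j = D s' v j"
begin

abbreviation base :: "(nat \<Rightarrow> complex) \<Rightarrow> nat \<Rightarrow> complex" where "base \<equiv> join r origin"

lemma rnp: "r + n \<le> r + p" "r + n + (p - n) = r + p" using np by auto

lemma Sc: "s \<in> S \<Longrightarrow> s \<in> cspace n" using S\<omega> holo_mapD(4)[OF f] by auto

lemma base_big: "x \<in> cspace n \<Longrightarrow> base x \<in> cspace (r + p)"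
  using cspace_mono[OF rnp(1)] by simp

text \<open>
  The last \<open>p - n\<close> coordinates of the argument are coefficients of the normal vectors \<open>\<nu> s\<close>, so that
  a branch of the unfolding becomes a local biholomorphism of \<open>\<complex>\<^sup>r\<^sup>+\<^sup>p\<close>.
\<close>
definition chart :: "(nat \<Rightarrow> complex) \<Rightarrow> (nat \<Rightarrow> complex) \<Rightarrow> nat \<Rightarrow> complex" where
  "chart s z = (\<lambda>k. F (trunc (r + n) z) k + (if k < r \<or> r + p \<le> k then 0 else \<Sum>i<p-n. z (r + n + i) * \<nu> s i (k - r)))"

definition chart_dom :: "(nat \<Rightarrow> complex) set" where
  "chart_dom = {z \<in> cspace (r + p). trunc (r + n) z \<in> \<Omega>}"

lemma holo_chart: "holo_map (r + p) (r + p) chart_dom (chart s)"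
proof (rule holo_mapI)
  have H: "holo_map (r + p) (r + p) chart_dom (\<lambda>z. F (trunc (r + n) z))"
    unfolding chart_dom_def by (rule holo_map_comp[OF holo_trunc F])
  show "copen (r + p) chart_dom" using holo_mapD(1)[OF H] .
  show "chart s z \<in> cspace (r + p)" if "z \<in> chart_dom" for z
    using holo_mapD(2)[OF H that] by (simp add: chart_def cspace_def)
  fix a j assume a: "a \<in> chart_dom" and j: "j < r + p"
  have ac: "a \<in> cspace (r + p)" using a by (simp add: chart_dom_def)
  show "cdiff (r + p) (\<lambda>z. chart s z j) a"
    unfolding chart_def
    by (intro cdiff_add[OF ac] cdiff_if[OF ac] cdiff_sum[OF ac] cdiff_mult[OF ac] cdiff_const[OF ac] cdiff_coord[OF ac]
        holo_mapD(3)[OF H a j])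
qed

lemma base_chart_dom: "s \<in> S \<Longrightarrow> base s \<in> chart_dom"
  using S\<Omega> Sc base_big by (simp add: chart_dom_def trunc_id)

lemma chart_par: "z \<in> chart_dom \<Longrightarrow> k < r \<Longrightarrow> chart s z k = z k"
  using Fpar[of "trunc (r + n) z" k] by (simp add: chart_dom_def chart_def trunc_def)

lemma chart_source: "z \<in> cspace (r + n) \<Longrightarrow> chart s z = F z"
  by (auto simp: chart_def trunc_id cspaceD fun_eq_iff)

lemma chart_base: "s \<in> S \<Longrightarrow> chart s (base s) = base y"
  using chart_source[of "base s" s] Sc F0 S\<omega> fS by auto

text \<open>
  The coefficients of the normal vectors in an argument \<open>v\<close> of the chart; \<open>xpart v\<close> is the point of the source.
\<close>
definition wpart :: "(nat \<Rightarrow> complex) \<Rightarrow> nat \<Rightarrow> complex" where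
  "wpart v = (\<lambda>i. v (r + n + i))"

definition xpart :: "(nat \<Rightarrow> complex) \<Rightarrow> nat \<Rightarrow> complex" where
  "xpart v = (\<lambda>i. if i < n then v (r + i) else 0)"

lemma xpart_cspace [simp]: "xpart v \<in> cspace n" by (simp add: xpart_def cspace_def)

lemma chart_derivative:
  assumes s: "s \<in> S" and A: "has_cderiv (r + p) (r + p) (chart s) A (base s)" and v: "v \<in> cspace (r + p)"
  shows "k < r \<Longrightarrow> lin (r + p) (r + p) A v k = v k"
    and "(\<And>k. k < r \<Longrightarrow> v k = 0) \<Longrightarrow> j < p \<Longrightarrow>
      lin (r + p) (r + p) A v (r + j) = D s (xpart v) j + (\<Sum>i<p-n. wpart v i * \<nu> s i j)"
proof -
  have ac: "base s \<in> cspace (r + p)" using base_big[OF Sc[OF s]] .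
  have cd: "copen (r + p) chart_dom" using holo_mapD(1)[OF holo_chart] .
  note uniq = has_cderiv_line_unique[OF A ac v]
  show "lin (r + p) (r + p) A v k = v k" if k: "k < r"
  proof (rule uniq[OF _ cd base_chart_dom[OF s]])
    show "((\<lambda>z. base s k + z * v k) has_field_derivative v k) (at 0)"
      by (auto intro!: derivative_eq_intros)
  qed (use chart_par k in auto)
  assume v0: "\<And>k. k < r \<Longrightarrow> v k = 0" and j: "j < p"
  let ?l = "\<lambda>z i. base s i + z * v i"
  let ?W = "{z \<in> chart_dom. trunc n (tail r z) \<in> \<omega>}"
  have sn: "s \<in> cspace n" using Sc[OF s] .
  have tt: "trunc n (tail r (?l z)) = (\<lambda>i. s i + z * xpart v i)" for z
    by (auto simp: trunc_def tail_def xpart_def cspaceD[OF sn])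
  have tr: "trunc (r + n) (?l z) = base (\<lambda>i. s i + z * xpart v i)" for z
    by (auto simp: trunc_def join_def xpart_def v0 cspaceD[OF sn])
  have "holo_map (r + p) n {z \<in> cspace (r + p). tail r z \<in> cspace p} (\<lambda>z. trunc n (tail r z))"
    by (rule holo_map_comp[OF holo_tail holo_trunc])
  then have "holo_map (r + p) n chart_dom (\<lambda>z. trunc n (tail r z))"
    by (rule holo_map_subset[OF _ cd]) (auto simp: chart_dom_def)
  then have W: "copen (r + p) ?W" by (rule holo_map_preimage[OF _ holo_mapD(1)[OF f]])
  have aW: "base s \<in> ?W" using base_chart_dom[OF s] s S\<omega> by (auto simp: trunc_id[OF sn])
  show "lin (r + p) (r + p) A v (r + j) = D s (xpart v) j + (\<Sum>i<p-n. wpart v i * \<nu> s i j)"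
  proof (rule uniq[OF _ W aW])
    show "r + j < r + p" using j by simp
    show "((\<lambda>z. f (\<lambda>i. s i + z * xpart v i) j + (\<Sum>i<p-n. (z * wpart v i) * \<nu> s i j))
       has_field_derivative D s (xpart v) j + (\<Sum>i<p-n. wpart v i * \<nu> s i j)) (at 0)"
      by (auto intro!: derivative_eq_intros D[OF s _ j])
    fix z assume z: "?l z \<in> ?W"
    have x: "(\<lambda>i. s i + z * xpart v i) \<in> \<omega>" using z tt by simp
    have "base s (r + n + i) = 0" for i using sn by (simp add: join_def cspaceD)
    then show "chart s (?l z) (r + j) = f (\<lambda>i. s i + z * xpart v i) j + (\<Sum>i<p-n. (z * wpart v i) * \<nu> s i j)"
      using j unfolding chart_def tr F0[OF x] by (simp add: wpart_def)
  qed
qed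

lemma xw_zero:
  assumes "v \<in> cspace (r + p)" "\<And>k. k < r \<Longrightarrow> v k = 0" "xpart v = origin" "\<And>i. i < p - n \<Longrightarrow> wpart v i = 0"
  shows "v = origin"
proof
  fix k
  consider "k < r" | "r \<le> k" "k < r + n" | "r + n \<le> k" "k < r + p" | "r + p \<le> k" by linarith
  then show "v k = 0"
  proof cases
    case 2 then show ?thesis using fun_cong[OF assms(3), of "k - r"] by (auto simp: xpart_def split: if_splits)
  next
    case 3 then show ?thesis using assms(4)[of "k - r - n"] by (auto simp: wpart_def)
  qed (use assms in \<open>auto simp: cspaceD\<close>)
qed

lemma chart_inverse:
  assumes s: "s \<in> S"
  shows "\<exists>U V K. copen (r + p) U \<and> base s \<in> U \<and> U \<subseteq> chart_dom \<and> base y \<in> V \<and>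
    holo_map (r + p) (r + p) V K \<and> (\<forall>z\<in>U. chart s z \<in> V \<and> K (chart s z) = z) \<and>
    (\<forall>u\<in>V. K u \<in> U \<and> chart s (K u) = u)"
proof -
  obtain A where A: "has_cderiv (r + p) (r + p) (chart s) A (base s)"
    using holo_map_has_cderiv[OF holo_chart base_chart_dom[OF s]] .
  have "v = origin" if v: "v \<in> cspace (r + p)" "lin (r + p) (r + p) A v = origin" for v
  proof -
    have v0: "v k = 0" if "k < r" for k using chart_derivative(1)[OF s A v(1) that] v(2) by simp
    have "xpart v = origin \<and> (\<forall>i<p-n. wpart v i = 0)"
      by (rule complement[OF s xpart_cspace]) (use chart_derivative(2)[OF s A v(1) v0] v(2) in simp)
    then show ?thesis by (intro xw_zero[OF v(1) v0]) simp_all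
  qed
  then have inj: "\<And>v. v \<in> cspace (r + p) \<Longrightarrow> lin (r + p) (r + p) A v = origin \<Longrightarrow> v = origin" .
  from holomorphic_inverse_function[OF holo_chart base_chart_dom[OF s] A inj] obtain U V K where
    UVK: "copen (r + p) U" "base s \<in> U" "U \<subseteq> chart_dom" "chart s (base s) \<in> V" "holo_map (r + p) (r + p) V K"
    "\<And>z. z \<in> U \<Longrightarrow> chart s z \<in> V \<and> K (chart s z) = z" "\<And>u. u \<in> V \<Longrightarrow> K u \<in> U \<and> chart s (K u) = u"
    by blast
  show ?thesis
    by (rule exI[of _ U], rule exI[of _ V], rule exI[of _ K]) (use UVK chart_base[OF s] in simp)
qed

end

locale normal_crossing_charts = normal_crossing_unfolding +
  fixes U V and K :: "(nat \<Rightarrow> complex) \<Rightarrow> (nat \<Rightarrow> complex) \<Rightarrow> nat \<Rightarrow> complex"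
  assumes U: "\<And>s. s \<in> S \<Longrightarrow> copen (r + p) (U s)" "\<And>s. s \<in> S \<Longrightarrow> join r origin s \<in> U s"
      "\<And>s. s \<in> S \<Longrightarrow> U s \<subseteq> chart_dom"
    and V: "\<And>s. s \<in> S \<Longrightarrow> join r origin y \<in> V s"
    and K: "\<And>s. s \<in> S \<Longrightarrow> holo_map (r + p) (r + p) (V s) (K s)"
    and KE: "\<And>s z. s \<in> S \<Longrightarrow> z \<in> U s \<Longrightarrow> chart s z \<in> V s \<and> K s (chart s z) = z"
    and EK: "\<And>s u. s \<in> S \<Longrightarrow> u \<in> V s \<Longrightarrow> K s u \<in> U s \<and> chart s (K s u) = u"
begin

text \<open>
  The image of the branch at \<open>s\<close> is locally the common zero set of the \<open>g s i\<close>.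
\<close>
definition g :: "(nat \<Rightarrow> complex) \<Rightarrow> nat \<Rightarrow> (nat \<Rightarrow> complex) \<Rightarrow> complex" where
  "g s i u = K s u (r + n + i)"

abbreviation b :: "nat \<Rightarrow> complex" where "b \<equiv> join r origin y"

lemma bc: "b \<in> cspace (r + p)" using yc by simp

lemma K_base: "s \<in> S \<Longrightarrow> K s b = base s"
  using KE[OF _ U(2)] chart_base by metis

lemma g_base: "s \<in> S \<Longrightarrow> g s i b = 0"
  using cspaceD[OF Sc, of s "n + i"] by (simp add: g_def K_base) (simp add: join_def)

lemma K_par:
  assumes "s \<in> S" "u \<in> V s" "k < r"
  shows "K s u k = u k"
proof -
  have "K s u \<in> chart_dom" using EK[OF assms(1,2)] U(3)[OF assms(1)] by blast
  from chart_par[OF this assms(3), of s] show ?thesis using EK[OF assms(1,2)] by simp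
qed

lemma g_cdiff: "s \<in> S \<Longrightarrow> i < p - n \<Longrightarrow> u \<in> V s \<Longrightarrow> cdiff (r + p) (g s i) u"
  unfolding g_def using holo_mapD(3)[OF K, of s u "r + n + i"] np by simp

definition c :: "(nat \<Rightarrow> complex) \<Rightarrow> nat \<Rightarrow> nat \<Rightarrow> complex" where
  "c s i = (SOME c. has_cgradient (r + p) (g s i) c b)"

lemma c: "s \<in> S \<Longrightarrow> i < p - n \<Longrightarrow> has_cgradient (r + p) (g s i) (c s i) b"
  unfolding c_def using g_cdiff[OF _ _ V] unfolding cdiff_def by (rule someI_ex)

text \<open>
  The differential of \<open>g s i\<close> at the base point, restricted to the target directions.
\<close>
definition \<gamma> :: "(nat \<Rightarrow> complex) \<Rightarrow> nat \<Rightarrow> (nat \<Rightarrow> complex) \<Rightarrow> complex" where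
  "\<gamma> s i w = (\<Sum>l<p. c s i (r + l) * w l)"

lemma sum_shift: "(\<Sum>k<r+p. h k) = (\<Sum>k<r. h k) + (\<Sum>l<p. h (r + l))" for h :: "nat \<Rightarrow> complex"
proof -
  have "{..<r+p} = {..<r} \<union> (\<lambda>l. r + l) ` {..<p}"
  proof
    show "{..<r+p} \<subseteq> {..<r} \<union> (\<lambda>l. r + l) ` {..<p}"
    proof
      fix k assume k: "k \<in> {..<r+p}"
      show "k \<in> {..<r} \<union> (\<lambda>l. r + l) ` {..<p}"
      proof (cases "k < r")
        case False
        then show ?thesis using k by (intro UnI2 image_eqI[of _ _ "k - r"]) auto
      qed simp
    qed
  qed auto
  then have "(\<Sum>k<r+p. h k) = (\<Sum>k\<in>{..<r}. h k) + (\<Sum>k\<in>(\<lambda>l. r + l) ` {..<p}. h k)"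
    by (simp only:) (rule sum.union_disjoint, auto)
  also have "(\<Sum>k\<in>(\<lambda>l. r + l) ` {..<p}. h k) = (\<Sum>l<p. h (r + l))" by (subst sum.reindex) auto
  finally show ?thesis .
qed

text \<open>
  Differentiate the identity that \<open>g s i\<close> of the chart is the \<open>i\<close>-th normal coordinate.
\<close>
lemma \<gamma>_chart:
  assumes s: "s \<in> S" and i: "i < p - n" and v: "v \<in> cspace (r + p)" "\<And>k. k < r \<Longrightarrow> v k = 0"
  shows "\<gamma> s i (\<lambda>j. D s (xpart v) j + (\<Sum>i<p-n. wpart v i * \<nu> s i j)) = wpart v i"
proof -
  have ac: "base s \<in> cspace (r + p)" using base_big[OF Sc[OF s]] .
  have aU: "base s \<in> U s" using U(2)[OF s] .
  obtain A where A: "has_cderiv (r + p) (r + p) (chart s) A (base s)"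
    using holo_map_has_cderiv[OF holo_chart base_chart_dom[OF s]] .
  obtain e where e: "e > 0" "\<And>x. x \<in> cspace (r + p) \<Longrightarrow> nrm (r + p) (x - base s) < e \<Longrightarrow> x \<in> U s"
    using copen_contains_ball[OF U(1)[OF s] aU] by blast
  have im: "chart s x \<in> cspace (r + p)" if "x \<in> cspace (r + p)" "nrm (r + p) (x - base s) < e" for x
    using holo_mapD(2)[OF holo_chart] U(3)[OF s] e(2)[OF that] by blast
  have "has_cgradient (r + p) (\<lambda>z. g s i (chart s z)) (\<lambda>k. \<Sum>j<r+p. c s i j * A j k) (base s)"
    by (rule has_cgradient_compose[OF ac e(1) im A]) (use c[OF s i] chart_base[OF s] in auto)
  then have "has_cgradient (r + p) (\<lambda>z. g s i (chart s z)) (\<lambda>k. \<Sum>j<r+p. c s i j * A j k) (\<lambda>i. base s i + 0 * v i)"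
    by simp
  from line_derivative[OF ac v(1) this]
  have 1: "((\<lambda>z. g s i (chart s (\<lambda>i. base s i + z * v i))) has_field_derivative
      (\<Sum>k<r+p. (\<Sum>j<r+p. c s i j * A j k) * v k)) (at 0)" .
  obtain e' where e': "e' > 0" "\<And>z. cmod z < e' \<Longrightarrow> (\<lambda>i. base s i + z * v i) \<in> U s"
    using line_in_copen[OF U(1)[OF s] aU v(1)] by blast
  have d1: "((\<lambda>z. z * wpart v i) has_field_derivative (\<Sum>k<r+p. (\<Sum>j<r+p. c s i j * A j k) * v k)) (at 0)"
  proof (rule has_field_derivative_transform_within[OF 1 e'(1)])
    fix z :: complex assume "dist z 0 < e'"
    then have "(\<lambda>i. base s i + z * v i) \<in> U s" using e'(2)[of z] by (simp add: dist_norm)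
    from KE[OF s this] have "g s i (chart s (\<lambda>i. base s i + z * v i)) = base s (r + n + i) + z * v (r + n + i)"
      by (simp add: g_def)
    also have "base s (r + n + i) = 0" using Sc[OF s] by (simp add: join_def cspaceD)
    finally show "g s i (chart s (\<lambda>i. base s i + z * v i)) = z * wpart v i" by (simp add: wpart_def)
  qed simp
  have d2: "((\<lambda>z. z * wpart v i) has_field_derivative wpart v i) (at 0)"
    by (auto intro!: derivative_eq_intros)
  have "wpart v i = (\<Sum>k<r+p. (\<Sum>j<r+p. c s i j * A j k) * v k)" by (rule DERIV_unique[OF d2 d1])
  also have "\<dots> = (\<Sum>k<r+p. \<Sum>j<r+p. c s i j * (A j k * v k))" by (simp add: sum_distrib_right mult.assoc)
  also have "\<dots> = (\<Sum>j<r+p. \<Sum>k<r+p. c s i j * (A j k * v k))" by (rule sum.swap)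
  also have "\<dots> = (\<Sum>j<r+p. c s i j * lin (r + p) (r + p) A v j)"
    by (rule sum.cong) (auto simp: lin_def sum_distrib_left)
  also have "\<dots> = (\<Sum>j<r. c s i j * lin (r + p) (r + p) A v j) + (\<Sum>l<p. c s i (r + l) * lin (r + p) (r + p) A v (r + l))"
    by (rule sum_shift)
  also have "(\<Sum>j<r. c s i j * lin (r + p) (r + p) A v j) = 0"
    using chart_derivative(1)[OF s A v(1)] v(2) by simp
  also have "(\<Sum>l<p. c s i (r + l) * lin (r + p) (r + p) A v (r + l)) =
      \<gamma> s i (\<lambda>j. D s (xpart v) j + (\<Sum>i<p-n. wpart v i * \<nu> s i j))"
    unfolding \<gamma>_def by (rule sum.cong) (use chart_derivative(2)[OF s A v] in auto)
  finally show ?thesis by simp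
qed

lemma D_zero: assumes "s \<in> S" "j < p" shows "D s origin j = 0"
proof -
  have d1: "((\<lambda>z. f (\<lambda>i. s i + z * 0) j) has_field_derivative D s origin j) (at 0)"
    using D[OF assms(1) origin_in_cspace assms(2)] .
  have d2: "((\<lambda>z. f (\<lambda>i. s i + z * 0) j) has_field_derivative 0) (at (0::complex))" by simp
  show ?thesis by (rule DERIV_unique[OF d1 d2])
qed

text \<open>
  By the crossing hypothesis \<open>\<nu> s' i'\<close> is tangent to the branch at \<open>s\<close> if \<open>s \<noteq> s'\<close>, where \<open>g s i\<close> vanishes.
  So the \<open>\<nu> s i\<close> are dual to the differentials of all the equations together.
\<close>
lemma \<gamma>_\<nu>:
  assumes s: "s \<in> S" "s' \<in> S" and i: "i < p - n" "i' < p - n"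
  shows "\<gamma> s i (\<nu> s' i') = (if s = s' \<and> i = i' then 1 else 0)"
proof (cases "s = s'")
  case True
  define v where "v = (\<lambda>k. if k = r + n + i' then 1 else (0::complex))"
  have v: "v \<in> cspace (r + p)" "\<And>k. k < r \<Longrightarrow> v k = 0" using i np by (auto simp: v_def cspace_def)
  have x: "xpart v = origin" by (auto simp: xpart_def v_def)
  have w: "wpart v = (\<lambda>k. if k = i' then 1 else 0)" by (auto simp: wpart_def v_def)
  have "(\<Sum>i<p-n. wpart v i * \<nu> s i j) = \<nu> s i' j" for j
  proof -
    have "(\<Sum>i<p-n. wpart v i * \<nu> s i j) = (\<Sum>i<p-n. if i = i' then \<nu> s i j else 0)"
      unfolding w by (rule sum.cong) auto
    then show ?thesis using i(2) by simp
  qed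
  then have "\<gamma> s i (\<nu> s i') = \<gamma> s i (\<lambda>j. D s (xpart v) j + (\<Sum>i<p-n. wpart v i * \<nu> s i j))"
    unfolding \<gamma>_def using D_zero[OF s(1)] by (simp add: x)
  also have "\<dots> = wpart v i" by (rule \<gamma>_chart[OF s(1) i(1) v])
  finally show ?thesis using True w by simp
next
  case False
  then obtain x where x: "x \<in> cspace n" "\<And>j. j < p \<Longrightarrow> \<nu> s' i' j = D s x j"
    using cross[OF s(2,1) _ i(2)] by auto
  define v where "v = base x"
  have v: "v \<in> cspace (r + p)" "\<And>k. k < r \<Longrightarrow> v k = 0" using base_big[OF x(1)] by (auto simp: v_def)
  have xv: "xpart v = x" using x(1) by (auto simp: v_def xpart_def cspaceD fun_eq_iff)
  have w: "wpart v i = 0" for i using x(1) by (simp add: v_def wpart_def join_def cspaceD)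
  have "\<gamma> s i (\<nu> s' i') = \<gamma> s i (\<lambda>j. D s (xpart v) j + (\<Sum>i<p-n. wpart v i * \<nu> s i j))"
    unfolding \<gamma>_def by (rule sum.cong) (use x(2) xv w in auto)
  also have "\<dots> = 0" using \<gamma>_chart[OF s(1) i(1) v] w by simp
  finally show ?thesis using False by simp
qed

definition \<Gamma> :: "(nat \<Rightarrow> complex) \<Rightarrow> nat \<Rightarrow> (nat \<Rightarrow> complex) \<Rightarrow> complex" where
  "\<Gamma> s i u = \<gamma> s i (\<lambda>l. u (r + l) - y l)"

definition slice :: "(nat \<Rightarrow> complex) \<Rightarrow> nat \<Rightarrow> complex" where
  "slice u = base (tail r u)"

text \<open>
  Since the \<open>\<gamma> s i\<close> and \<open>\<nu> s i\<close> are dual, this change of coordinates turns the function \<open>g s i (q u)\<close> into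
  the affine function \<open>\<Gamma> s i\<close>. It is used with \<open>q\<close> the identity, for the equations of the
  unfolding, and with \<open>q = slice\<close>, for those of the constant unfolding.
\<close>
definition flat :: "((nat \<Rightarrow> complex) \<Rightarrow> nat \<Rightarrow> complex) \<Rightarrow> (nat \<Rightarrow> complex) \<Rightarrow> nat \<Rightarrow> complex" where
  "flat q u = (\<lambda>k. u k + (if k < r \<or> r + p \<le> k then 0 else
     \<Sum>s\<in>S. \<Sum>i<p-n. (g s i (q u) - \<Gamma> s i u) * \<nu> s i (k - r)))"

lemma \<gamma>_cong: "(\<And>l. l < p \<Longrightarrow> w l = w' l) \<Longrightarrow> \<gamma> s i w = \<gamma> s i w'"
  by (simp add: \<gamma>_def)

lemma \<gamma>_add: "\<gamma> s i (\<lambda>l. w l + w' l) = \<gamma> s i w + \<gamma> s i w'"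
  by (simp add: \<gamma>_def sum.distrib distrib_left)

lemma \<gamma>_sum: "\<gamma> s i (\<lambda>l. \<Sum>x\<in>X. a x * w x l) = (\<Sum>x\<in>X. a x * \<gamma> s i (w x))"
  unfolding \<gamma>_def sum_distrib_left by (subst sum.swap) (simp add: mult.left_commute)

lemma \<Gamma>_flat:
  assumes s: "s \<in> S" and i: "i < p - n"
  shows "\<Gamma> s i (flat q u) = g s i (q u)"
proof -
  let ?a = "\<lambda>s i. g s i (q u) - \<Gamma> s i u"
  have "\<Gamma> s i (flat q u) = \<gamma> s i (\<lambda>l. (u (r + l) - y l) + (\<Sum>s'\<in>S. 1 * (\<Sum>i'<p-n. ?a s' i' * \<nu> s' i' l)))"
    unfolding \<Gamma>_def[of s i "flat q u"] by (rule \<gamma>_cong) (simp add: flat_def)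
  also have "\<dots> = \<Gamma> s i u + (\<Sum>s'\<in>S. \<Sum>i'<p-n. ?a s' i' * \<gamma> s i (\<nu> s' i'))"
    unfolding \<gamma>_add \<gamma>_sum by (simp add: \<Gamma>_def)
  also have "(\<Sum>s'\<in>S. \<Sum>i'<p-n. ?a s' i' * \<gamma> s i (\<nu> s' i')) = (\<Sum>s'\<in>S. if s' = s then ?a s i else 0)"
  proof (rule sum.cong[OF refl])
    fix s' assume s': "s' \<in> S"
    have "(\<Sum>i'<p-n. ?a s' i' * \<gamma> s i (\<nu> s' i')) = (\<Sum>i'<p-n. if i' = i then (if s' = s then ?a s i else 0) else 0)"
      by (rule sum.cong) (use \<gamma>_\<nu>[OF s s' i] in auto)
    then show "(\<Sum>i'<p-n. ?a s' i' * \<gamma> s i (\<nu> s' i')) = (if s' = s then ?a s i else 0)" using i by simp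
  qed
  also have "\<dots> = ?a s i" using s finS by simp
  finally show ?thesis by simp
qed

definition charted :: "(nat \<Rightarrow> complex) set" where "charted = cspace (r + p) \<inter> (\<Inter>s\<in>S. V s)"

lemma charted: "copen (r + p) charted" "b \<in> charted"
proof -
  show "copen (r + p) charted"
  proof (cases "S = {}")
    case False
    have "copen (r + p) (\<Inter>s\<in>S. V s)"
      using finS False holo_mapD(1)[OF K] by (intro openin_INT2) auto
    then show ?thesis unfolding charted_def by (intro copen_Int copen_cspace)
  next
    case True
    then have "charted = cspace (r + p)" unfolding charted_def by simp
    then show ?thesis by (simp only: copen_cspace)
  qed
qed (use V bc in \<open>auto simp: charted_def\<close>)

lemma \<Gamma>_cdiff: "a \<in> cspace (r + p) \<Longrightarrow> cdiff (r + p) (\<Gamma> s i) a"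
  unfolding \<Gamma>_def \<gamma>_def by (intro cdiff_sum cdiff_mult cdiff_diff cdiff_const cdiff_coord)

lemma holo_flat:
  assumes q: "holo_map (r + p) (r + p) (cspace (r + p)) q"
  shows "holo_map (r + p) (r + p) {u \<in> cspace (r + p). q u \<in> charted} (flat q)"
proof (rule holo_mapI)
  show "copen (r + p) {u \<in> cspace (r + p). q u \<in> charted}" by (rule holo_map_preimage[OF q charted(1)])
  show "flat q u \<in> cspace (r + p)" if "u \<in> {u \<in> cspace (r + p). q u \<in> charted}" for u
    using that by (auto simp: flat_def cspace_def)
  fix a j assume a: "a \<in> {u \<in> cspace (r + p). q u \<in> charted}" and j: "j < r + p"
  have ac: "a \<in> cspace (r + p)" using a by simp
  have gq: "cdiff (r + p) (\<lambda>u. g s i (q u)) a" if "s \<in> S" "i < p - n" for s i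
    by (rule cdiff_compose[where r = 1 and p = "r + p", OF ac])
       (use a that holo_mapD(2)[OF q] holo_mapD(3)[OF q ac] g_cdiff[OF that] in \<open>auto simp: charted_def\<close>)
  show "cdiff (r + p) (\<lambda>u. flat q u j) a"
    unfolding flat_def
    by (intro cdiff_add[OF ac] cdiff_if[OF ac] cdiff_sum[OF ac] cdiff_mult[OF ac] cdiff_diff[OF ac]
        cdiff_const[OF ac] cdiff_coord[OF ac] gq \<Gamma>_cdiff[OF ac]) auto
qed

lemma flat_par: "k < r \<Longrightarrow> flat q u k = u k"
  by (simp add: flat_def)

lemma flat_base: assumes "q b = b" shows "flat q b = b"
proof -
  have "\<Gamma> s i b = 0" for s i by (simp add: \<Gamma>_def \<gamma>_def)
  then show ?thesis by (auto simp: flat_def assms g_base)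
qed

text \<open>
  The correction in \<open>flat\<close> has derivative 0 in the target directions, as \<open>\<gamma>\<close> is the differential of \<open>g\<close>.
\<close>
lemma flat_derivative_injective:
  assumes q: "holo_map (r + p) (r + p) (cspace (r + p)) q"
    and q0: "\<And>u. u \<in> cspace (r + p) \<Longrightarrow> (\<And>k. k < r \<Longrightarrow> u k = 0) \<Longrightarrow> q u = u"
    and A: "has_cderiv (r + p) (r + p) (flat q) A b"
    and v: "v \<in> cspace (r + p)" "lin (r + p) (r + p) A v = origin"
  shows "v = origin"
proof -
  note uniq = has_cderiv_line_unique[OF A bc v(1)]
  have v0: "v k = 0" if k: "k < r" for k
  proof -
    have "lin (r + p) (r + p) A v k = v k"
    proof (rule uniq[OF _ copen_cspace bc])
      show "((\<lambda>z. b k + z * v k) has_field_derivative v k) (at 0)"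
        by (auto intro!: derivative_eq_intros)
    qed (use k flat_par in auto)
    then show ?thesis using v(2) by simp
  qed
  let ?l = "\<lambda>z i. b i + z * v i"
  have lc: "?l z \<in> cspace (r + p)" for z using bc v(1) by simp
  have ql: "q (?l z) = ?l z" for z by (rule q0[OF lc]) (simp add: v0)
  have dg: "((\<lambda>z. g s i (?l z)) has_field_derivative \<gamma> s i (tail r v)) (at 0)" if "s \<in> S" "i < p - n" for s i
  proof -
    have "has_cgradient (r + p) (g s i) (c s i) (\<lambda>k. b k + 0 * v k)" using c[OF that] by simp
    from line_derivative[OF bc v(1) this]
    have "((\<lambda>z. g s i (?l z)) has_field_derivative (\<Sum>k<r+p. c s i k * v k)) (at 0)" .
    moreover have "(\<Sum>k<r+p. c s i k * v k) = \<gamma> s i (tail r v)"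
      unfolding sum_shift by (simp add: v0 \<gamma>_def tail_def)
    ultimately show ?thesis by simp
  qed
  have \<Gamma>l: "\<Gamma> s i (?l z) = z * \<gamma> s i (tail r v)" for s i z
    by (simp add: \<Gamma>_def \<gamma>_def tail_def sum_distrib_left mult.left_commute)
  have "v (r + j) = 0" if j: "j < p" for j
  proof -
    have "lin (r + p) (r + p) A v (r + j) = v (r + j)"
    proof (rule uniq[OF _ copen_cspace bc])
      show "flat q (?l z) (r + j) = b (r + j) + z * v (r + j) +
        (\<Sum>s\<in>S. \<Sum>i<p-n. (g s i (?l z) - z * \<gamma> s i (tail r v)) * \<nu> s i j)" for z
        using j unfolding flat_def ql \<Gamma>l by simp
      have "((\<lambda>z. b (r + j) + z * v (r + j) +
        (\<Sum>s\<in>S. \<Sum>i<p-n. (g s i (?l z) - z * \<gamma> s i (tail r v)) * \<nu> s i j)) has_field_derivative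
          (0 + 1 * v (r + j) + (\<Sum>s\<in>S. \<Sum>i<p-n. (\<gamma> s i (tail r v) - 1 * \<gamma> s i (tail r v)) * \<nu> s i j))) (at 0)"
        by (intro DERIV_add DERIV_sum DERIV_cmult_right DERIV_diff DERIV_const DERIV_ident dg) auto
      then show "((\<lambda>z. b (r + j) + z * v (r + j) +
        (\<Sum>s\<in>S. \<Sum>i<p-n. (g s i (?l z) - z * \<gamma> s i (tail r v)) * \<nu> s i j)) has_field_derivative v (r + j)) (at 0)"
        by simp
    qed (use j in auto)
    then show ?thesis using v(2) by simp
  qed
  then have vj: "v (r + j) = 0" for j
    using cspaceD[OF v(1), of "r + j"] by (cases "j < p") simp_all
  then have "tail r v = origin" by (simp add: tail_def)
  then have "v = join r origin origin" using v0 by (intro join_eqI) auto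
  then show ?thesis by (auto simp: join_def)
qed

end

context normal_crossing_charts begin

lemma slice_base: "slice (base x) = base x"
  by (simp add: slice_def)

lemma holo_slice': "holo_map (r + p) (r + p) (cspace (r + p)) slice"
  using holo_slice[of r p] by (simp add: slice_def[abs_def])

lemma holo_ident: "holo_map q q (cspace q) (\<lambda>u. u)"
  by (rule holo_map_cong[OF holo_trunc]) (simp add: trunc_id)

text \<open>
  With \<open>H = flat (\<lambda>u. u)\<close> and \<open>H0 = flat slice\<close>, the map \<open>\<Psi> = H0\<^sup>-\<^sup>1 \<circ> H\<close> satisfies
  \<open>g s i (slice (\<Psi> u)) = g s i u\<close>, because both sides are \<open>\<Gamma> s i (H u)\<close>. So \<open>\<Psi>\<close> maps the image of the unfolding to
  the image of the constant unfolding. \<open>\<Theta>\<close> is the inverse of \<open>\<Psi>\<close>.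
\<close>
lemma target_straightening:
  obtains \<Psi> \<Omega>' \<Theta> W where "holo_map (r + p) (r + p) \<Omega>' \<Psi>" "b \<in> \<Omega>'"
    "\<And>u k. u \<in> \<Omega>' \<Longrightarrow> k < r \<Longrightarrow> \<Psi> u k = u k" "\<And>x. base x \<in> \<Omega>' \<Longrightarrow> \<Psi> (base x) = base x"
    "biholo_germ (r + p) {b} {b} \<Psi>"
    "holo_map (r + p) (r + p) W \<Theta>" "b \<in> W" "\<And>v. v \<in> W \<Longrightarrow> \<Psi> (\<Theta> v) = v"
    "\<And>v k. v \<in> W \<Longrightarrow> k < r \<Longrightarrow> \<Theta> v k = v k" "\<And>x. base x \<in> W \<Longrightarrow> \<Theta> (base x) = base x"
    "\<And>v s. v \<in> W \<Longrightarrow> s \<in> S \<Longrightarrow> \<Theta> v \<in> V s"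
    "\<And>v s i. v \<in> W \<Longrightarrow> s \<in> S \<Longrightarrow> i < p - n \<Longrightarrow> g s i (\<Theta> v) = g s i (slice v)"
proof -
  define H where "H = flat (\<lambda>u. u)"
  define H0 where "H0 = flat slice"
  let ?dH = "{u \<in> cspace (r + p). u \<in> charted}" and ?dS = "{u \<in> cspace (r + p). slice u \<in> charted}"
  have hH: "holo_map (r + p) (r + p) ?dH H" unfolding H_def by (rule holo_flat[OF holo_ident])
  have hH0: "holo_map (r + p) (r + p) ?dS H0" unfolding H0_def by (rule holo_flat[OF holo_slice'])
  have sb: "slice b = b" by (simp add: slice_base)
  have Hb: "H b = b" unfolding H_def by (rule flat_base) simp
  have H0b: "H0 b = b" unfolding H0_def by (rule flat_base[of slice, OF sb])
  have b0: "b \<in> ?dS" using bc charted(2) sb by simp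
  obtain A where A: "has_cderiv (r + p) (r + p) H0 A b" using holo_map_has_cderiv[OF hH0 b0] .
  have s0: "slice u = u" if "\<And>k. k < r \<Longrightarrow> u k = 0" for u
    unfolding slice_def using that by (intro join_eqI[symmetric]) auto
  have inj: "v = origin" if "v \<in> cspace (r + p)" "lin (r + p) (r + p) A v = origin" for v
    by (rule flat_derivative_injective[OF holo_slice' s0 A[unfolded H0_def] that])
  from holomorphic_inverse_function[OF hH0 b0 A inj] obtain U0 V0 Q where
    Q: "copen (r + p) U0" "b \<in> U0" "U0 \<subseteq> ?dS" "H0 b \<in> V0" "holo_map (r + p) (r + p) V0 Q"
    "\<And>u. u \<in> U0 \<Longrightarrow> H0 u \<in> V0 \<and> Q (H0 u) = u" "\<And>w. w \<in> V0 \<Longrightarrow> Q w \<in> U0 \<and> H0 (Q w) = w"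
    by blast
  define \<Omega>' where "\<Omega>' = {u \<in> ?dH. H u \<in> V0} \<inter> U0"
  define \<Psi> where "\<Psi> = (\<lambda>u. Q (H u))"
  have h\<Psi>': "holo_map (r + p) (r + p) {u \<in> ?dH. H u \<in> V0} \<Psi>"
    unfolding \<Psi>_def by (rule holo_map_comp[OF hH Q(5)])
  have o\<Omega>: "copen (r + p) \<Omega>'" unfolding \<Omega>'_def by (rule copen_Int[OF holo_mapD(1)[OF h\<Psi>'] Q(1)])
  have h\<Psi>: "holo_map (r + p) (r + p) \<Omega>' \<Psi>"
    by (rule holo_map_subset[OF h\<Psi>' o\<Omega>]) (simp add: \<Omega>'_def)
  have b\<Omega>: "b \<in> \<Omega>'" using bc charted(2) Hb H0b Q(2,4) by (simp add: \<Omega>'_def)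
  have H0\<Psi>: "H0 (\<Psi> u) = H u" if "u \<in> \<Omega>'" for u
    using Q(7)[of "H u"] that by (simp add: \<Omega>'_def \<Psi>_def)
  have \<Psi>par: "\<Psi> u k = u k" if u: "u \<in> \<Omega>'" and k: "k < r" for u k
  proof -
    have "\<Psi> u k = H0 (\<Psi> u) k" unfolding H0_def using k by (simp add: flat_par)
    also have "\<dots> = u k" unfolding H0\<Psi>[OF u] H_def using k by (simp add: flat_par)
    finally show ?thesis .
  qed
  have \<Psi>id: "\<Psi> (base x) = base x" if x: "base x \<in> \<Omega>'" for x
  proof -
    have "H (base x) = H0 (base x)" unfolding H_def H0_def flat_def slice_base ..
    then show ?thesis using Q(6)[of "base x"] x by (simp add: \<Psi>_def \<Omega>'_def)
  qed
  have bi: "biholo_germ (r + p) {b} {b} \<Psi>"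
    using biholo_germ_unfolding_id[OF h\<Psi>, of "{y}"] b\<Omega> yc \<Psi>par \<Psi>id by simp
  then obtain UB VB where B: "b \<in> UB" "b \<in> VB" "holo_map (r + p) (r + p) UB \<Psi>" "bij_betw \<Psi> UB VB"
    "holo_map (r + p) (r + p) VB (inv_into UB \<Psi>)" unfolding biholo_germ_def by auto
  define \<Theta> where "\<Theta> = inv_into UB \<Psi>"
  have \<Theta>\<Psi>: "\<Theta> (\<Psi> u) = u" if "u \<in> UB" for u
    unfolding \<Theta>_def using B(4) that by (simp add: bij_betw_def)
  have \<Psi>\<Theta>: "\<Psi> (\<Theta> v) = v" if "v \<in> VB" for v
    unfolding \<Theta>_def using B(4) that by (simp add: bij_betw_def f_inv_into_f)
  have \<Theta>b: "\<Theta> b = b" using \<Theta>\<Psi>[OF B(1)] \<Psi>id[OF b\<Omega>] by simp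
  define W where "W = {v \<in> VB. \<Theta> v \<in> \<Omega>'} \<inter> (UB \<inter> \<Omega>')"
  have hVB: "holo_map (r + p) (r + p) VB \<Theta>" using B(5) by (simp only: \<Theta>_def)
  have "copen (r + p) W" unfolding W_def
    by (intro copen_Int holo_map_preimage[OF hVB o\<Omega>] o\<Omega> holo_mapD(1)[OF B(3)])
  then have hW: "holo_map (r + p) (r + p) W \<Theta>"
    by (rule holo_map_subset[OF hVB]) (auto simp: W_def)
  have W: "v \<in> VB" "\<Theta> v \<in> \<Omega>'" "v \<in> UB" "v \<in> \<Omega>'" if "v \<in> W" for v using that by (auto simp: W_def)
  show ?thesis
  proof (rule that[OF h\<Psi> b\<Omega> \<Psi>par \<Psi>id bi hW])
    show "b \<in> W" using B(1,2) b\<Omega> \<Theta>b by (simp add: W_def)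
    show "\<Psi> (\<Theta> v) = v" if "v \<in> W" for v using \<Psi>\<Theta> W(1)[OF that] .
    show "\<Theta> v k = v k" if "v \<in> W" "k < r" for v k
      using \<Psi>par[OF W(2)[OF that(1)] that(2)] \<Psi>\<Theta>[OF W(1)[OF that(1)]] by simp
    show "\<Theta> (base x) = base x" if "base x \<in> W" for x
      using \<Theta>\<Psi>[OF W(3)[OF that]] \<Psi>id[OF W(4)[OF that]] by simp
    show "\<Theta> v \<in> V s" if "v \<in> W" "s \<in> S" for v s
      using W(2)[OF that(1)] that(2) by (auto simp: \<Omega>'_def charted_def)
    show "g s i (\<Theta> v) = g s i (slice v)" if v: "v \<in> W" and s: "s \<in> S" "i < p - n" for v s i
    proof -
      have "g s i (slice v) = \<Gamma> s i (H0 v)" unfolding H0_def \<Gamma>_flat[OF s] ..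
      also have "H0 v = H (\<Theta> v)" using H0\<Psi>[OF W(2)[OF v]] \<Psi>\<Theta>[OF W(1)[OF v]] by simp
      also have "\<Gamma> s i (H (\<Theta> v)) = g s i (\<Theta> v)" unfolding H_def \<Gamma>_flat[OF s] ..
      finally show ?thesis by simp
    qed
  qed auto
qed

text \<open>
  \<open>\<Theta>\<close> maps \<open>id_times r f z\<close> into the image of the unfolding, and the inverse chart of the branch lifts
  this point to the source. The lifts at the points of \<open>S\<close> are defined on disjoint
  neighbourhoods and together form \<open>\<Phi>\<close>.
\<close>
lemma charted_unfolding_trivial: "trivial_unfolding r n p S y f F"
proof -
  obtain \<Psi> \<Omega>' \<Theta> W where h\<Psi>: "holo_map (r + p) (r + p) \<Omega>' \<Psi>" "b \<in> \<Omega>'"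
    "\<And>u k. u \<in> \<Omega>' \<Longrightarrow> k < r \<Longrightarrow> \<Psi> u k = u k" "\<And>x. base x \<in> \<Omega>' \<Longrightarrow> \<Psi> (base x) = base x"
    "biholo_germ (r + p) {b} {b} \<Psi>"
    and hW: "holo_map (r + p) (r + p) W \<Theta>" "b \<in> W" "\<And>v. v \<in> W \<Longrightarrow> \<Psi> (\<Theta> v) = v"
    "\<And>v k. v \<in> W \<Longrightarrow> k < r \<Longrightarrow> \<Theta> v k = v k" "\<And>x. base x \<in> W \<Longrightarrow> \<Theta> (base x) = base x"
    and \<Theta>V: "\<And>v s. v \<in> W \<Longrightarrow> s \<in> S \<Longrightarrow> \<Theta> v \<in> V s"
    and g\<Theta>: "\<And>v s i. v \<in> W \<Longrightarrow> s \<in> S \<Longrightarrow> i < p - n \<Longrightarrow> g s i (\<Theta> v) = g s i (slice v)"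
    by (rule target_straightening) blast
  let ?P = "base ` S"
  have Pc: "finite ?P" "?P \<subseteq> cspace (r + n)" using finS Sc by auto
  obtain \<epsilon> where \<epsilon>: "\<epsilon> > 0" "\<And>a b x. a \<in> ?P \<Longrightarrow> b \<in> ?P \<Longrightarrow> nrm (r + n) (x - a) < \<epsilon> \<Longrightarrow> nrm (r + n) (x - b) < \<epsilon> \<Longrightarrow> a = b"
    using finite_separated[OF Pc] by blast
  define If where "If = id_times r f"
  have hI: "holo_map (r + n) (r + p) {z \<in> cspace (r + n). tail r z \<in> \<omega>} If"
    unfolding If_def by (rule holo_id_times[OF f])
  define DI where "DI = {z \<in> {z \<in> cspace (r + n). tail r z \<in> \<omega>}. If z \<in> W}"
  have hTI: "holo_map (r + n) (r + p) DI (\<lambda>z. \<Theta> (If z))" unfolding DI_def by (rule holo_map_comp[OF hI hW(1)])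
  define lift where "lift = (\<lambda>s z. trunc (r + n) (K s (\<Theta> (If z))))"
  define N0 where "N0 = (\<lambda>s. {z \<in> DI. \<Theta> (If z) \<in> V s})"
  have hK: "holo_map (r + n) (r + p) (N0 s) (\<lambda>z. K s (\<Theta> (If z)))" if "s \<in> S" for s
    unfolding N0_def by (rule holo_map_comp[OF hTI K[OF that]])
  have hl0: "holo_map (r + n) (r + n) (N0 s) (lift s)" if "s \<in> S" for s
  proof -
    have "holo_map (r + n) (r + n) {z \<in> N0 s. K s (\<Theta> (If z)) \<in> cspace (r + p)} (\<lambda>z. trunc (r + n) (K s (\<Theta> (If z))))"
      by (rule holo_map_comp[OF hK[OF that] holo_trunc])
    moreover have "{z \<in> N0 s. K s (\<Theta> (If z)) \<in> cspace (r + p)} = N0 s"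
      using holo_mapD(2)[OF hK[OF that]] by blast
    ultimately show ?thesis by (simp add: lift_def)
  qed
  have hsl: "holo_map (r + n) (r + p) (cspace (r + n)) (\<lambda>z. base (tail r z))"
  proof -
    have "holo_map (r + n) (r + p) {z \<in> cspace (r + n). base (tail r z) \<in> cspace (r + n)} (\<lambda>z. (base (tail r z)))"
    proof (rule holo_mapI)
      have "{z \<in> cspace (r + n). base (tail r z) \<in> cspace (r + n)} = cspace (r + n)" by auto
      then show "copen (r + n) {z \<in> cspace (r + n). base (tail r z) \<in> cspace (r + n)}" by (simp only: copen_cspace)
    next
      fix x assume "x \<in> {z \<in> cspace (r + n). base (tail r z) \<in> cspace (r + n)}"
      then show "base (tail r x) \<in> cspace (r + p)" using cspace_mono[OF rnp(1)] by blast
    next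
      fix a j assume "a \<in> {z \<in> cspace (r + n). base (tail r z) \<in> cspace (r + n)}"
      then show "cdiff (r + n) (\<lambda>x. base (tail r x) j) a"
        unfolding join_def tail_def by (intro cdiff_if cdiff_const cdiff_coord) auto
    qed
    moreover have "{z \<in> cspace (r + n). base (tail r z) \<in> cspace (r + n)} = cspace (r + n)" by auto
    ultimately show ?thesis by (simp only:)
  qed
  define Nb where "Nb = (\<lambda>s. N0 s \<inter> {z \<in> cspace (r + n). base (tail r z) \<in> U s} \<inter> {z \<in> cspace (r + n). nrm (r + n) (z - base s) < \<epsilon>})"
  have oN: "copen (r + n) (Nb s)" if "s \<in> S" for s
    unfolding Nb_def by (intro copen_Int copen_ball holo_map_preimage[OF hsl U(1)[OF that]] holo_mapD(1)[OF hl0[OF that]])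
  have hl: "holo_map (r + n) (r + n) (Nb s) (lift s)" if "s \<in> S" for s
    by (rule holo_map_subset[OF hl0[OF that] oN[OF that]]) (auto simp: Nb_def)
  have If_base: "If (base x) = base (f x)" for x
    unfolding If_def id_times_apply tail_join by (auto simp: join_def)
  have baseN: "base s \<in> Nb s" if s: "s \<in> S" for s
  proof -
    have "base s \<in> DI" using Sc[OF s] s S\<omega> fS[OF s] hW(2) by (auto simp: DI_def If_base)
    then show ?thesis using \<Theta>V[of "If (base s)" s] s \<epsilon>(1) Sc[OF s] U(2)[OF s] by (simp add: Nb_def N0_def DI_def)
  qed
  \<comment> \<open>All equations \<open>g s i\<close> vanish at \<open>\<Theta> (If z)\<close>, since they vanish at its slice \<open>chart s (base x)\<close>.
    So this point has no normal coordinates in the chart.\<close>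
  have main: "\<Psi> (F (lift s z)) = If z" "\<And>k. k < r \<Longrightarrow> lift s z k = z k" if s: "s \<in> S" and z: "z \<in> Nb s" for s z
  proof -
    define x where "x = tail r z"
    define u where "u = \<Theta> (If z)"
    have zc: "z \<in> cspace (r + n)" and x\<omega>: "x \<in> \<omega>" and IW: "If z \<in> W" and uV: "u \<in> V s" and xU: "base x \<in> U s"
      using z by (auto simp: Nb_def N0_def DI_def x_def u_def)
    have xc: "x \<in> cspace n" using zc by (simp add: x_def)
    have "slice (If z) = base (f x)" by (simp add: slice_def If_def id_times_apply x_def)
    also have "\<dots> = chart s (base x)" using chart_source[of "base x" s] xc F0[OF x\<omega>] by simp
    finally have sl: "slice (If z) = chart s (base x)" .
    have gu: "K s u (r + n + i) = 0" if "i < p - n" for i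
    proof -
      have "K s u (r + n + i) = g s i (slice (If z))" using g\<Theta>[OF IW s that] by (simp add: g_def u_def)
      also have "\<dots> = base x (r + n + i)" unfolding sl g_def using KE[OF s xU] by simp
      also have "\<dots> = 0" using xc by (simp add: join_def cspaceD)
      finally show ?thesis .
    qed
    have Kc: "K s u \<in> cspace (r + n)"
    proof -
      have "K s u \<in> cspace (r + p)" by (rule holo_mapD(2)[OF K[OF s] uV])
      moreover have "K s u k = 0" if "r + n \<le> k" "k < r + p" for k
        using gu[of "k - (r + n)"] that by simp
      ultimately show ?thesis unfolding cspace_def by (auto simp: not_less) (metis not_less)
    qed
    have lK: "lift s z = K s u" unfolding lift_def u_def[symmetric] by (rule trunc_id[OF Kc])
    have "F (lift s z) = chart s (K s u)" unfolding lK using chart_source[OF Kc] by simp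
    also have "\<dots> = u" using EK[OF s uV] by simp
    finally have "F (lift s z) = u" .
    then show "\<Psi> (F (lift s z)) = If z" using hW(3)[OF IW] by (simp add: u_def)
    show "lift s z k = z k" if k: "k < r" for k
    proof -
      have "lift s z k = u k" unfolding lK by (rule K_par[OF s uV k])
      also have "\<dots> = If z k" unfolding u_def by (rule hW(4)[OF IW k])
      also have "\<dots> = z k" using k by (simp add: If_def id_times_apply)
      finally show ?thesis .
    qed
  qed
  have lift_base: "lift s (base x) = base x" if s: "s \<in> S" and x: "base x \<in> Nb s" for s x
  proof -
    have xc: "base x \<in> cspace (r + n)" and x\<omega>: "x \<in> \<omega>" and IW: "If (base x) \<in> W" and xU: "base x \<in> U s"
      using x by (auto simp: Nb_def N0_def DI_def)
    have "\<Theta> (If (base x)) = base (f x)" using hW(5)[of "f x"] IW by (simp add: If_base)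
    also have "\<dots> = chart s (base x)" using chart_source[OF xc, of s] F0[OF x\<omega>] by simp
    finally have "K s (\<Theta> (If (base x))) = base x" using KE[OF s xU] by simp
    then show ?thesis unfolding lift_def using trunc_id[OF xc] by simp
  qed
  define \<Omega>S where "\<Omega>S = (\<Union>s\<in>S. Nb s)"
  define \<Phi> where "\<Phi> = (\<lambda>z. lift (SOME s. s \<in> S \<and> z \<in> Nb s) z)"
  have \<Phi>: "\<Phi> z = lift s z" if s: "s \<in> S" and z: "z \<in> Nb s" for s z
  proof -
    define t where "t = (SOME s. s \<in> S \<and> z \<in> Nb s)"
    have t: "t \<in> S \<and> z \<in> Nb t" unfolding t_def by (rule someI[of _ s]) (use s z in simp)
    have "base t = base s" using t s z by (intro \<epsilon>(2)[of _ _ z]) (auto simp: Nb_def)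
    then have "t = s" by (simp add: join_inject)
    then show ?thesis by (simp add: \<Phi>_def t_def)
  qed
  have h\<Phi>: "holo_map (r + n) (r + n) \<Omega>S \<Phi>"
    unfolding \<Omega>S_def
  proof (rule holo_map_Union)
    fix X assume "X \<in> Nb ` S"
    then obtain s where s: "s \<in> S" "X = Nb s" by blast
    show "holo_map (r + n) (r + n) X \<Phi>"
      unfolding s(2) by (rule holo_map_cong[OF hl[OF s(1)]]) (simp add: \<Phi>[OF s(1)])
  qed
  have S\<Omega>S: "base s \<in> \<Omega>S" if "s \<in> S" for s using baseN[OF that] that by (auto simp: \<Omega>S_def)
  have \<Phi>par: "\<Phi> z k = z k" if "z \<in> \<Omega>S" "k < r" for z k
    using that main(2) \<Phi> by (auto simp: \<Omega>S_def)
  have \<Phi>id: "\<Phi> (base x) = base x" if "base x \<in> \<Omega>S" for x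
    using that lift_base \<Phi> by (auto simp: \<Omega>S_def)
  have o\<Omega>S: "copen (r + n) \<Omega>S" using holo_mapD(1)[OF h\<Phi>] .
  have bi\<Phi>: "biholo_germ (r + n) ?P ?P \<Phi>"
    by (rule biholo_germ_unfolding_id[OF h\<Phi> finS S\<Omega>S _ \<Phi>par \<Phi>id]) (use Sc in auto)
  have un\<Phi>: "unfolding_of r n n S S id \<Phi>"
    unfolding unfolding_of_def holo_germ_def germ_eq_def
  proof (intro conjI)
    show "?P \<subseteq> cspace (r + n)" using Pc by simp
    show "\<Phi> ` ?P \<subseteq> ?P" using \<Phi>id S\<Omega>S by auto
    show "\<exists>U. ?P \<subseteq> U \<and> holo_map (r + n) (r + n) U \<Phi>" using h\<Phi> S\<Omega>S by (intro exI[of _ \<Omega>S]) auto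
    show "\<exists>U. copen (r + n) U \<and> ?P \<subseteq> U \<and> (\<forall>z\<in>U. \<forall>i<r. \<Phi> z i = z i)"
      using o\<Omega>S S\<Omega>S \<Phi>par by (intro exI[of _ \<Omega>S]) auto
    show "\<exists>U. copen n U \<and> S \<subseteq> U \<and> (\<forall>x\<in>U. \<Phi> (base x) = base (id x))"
      using holo_map_preimage[OF holo_join_origin o\<Omega>S] S\<Omega>S Sc \<Phi>id
      by (intro exI[of _ "{x \<in> cspace n. base x \<in> \<Omega>S}"]) auto
  qed
  have un\<Psi>: "unfolding_of r p p {y} {y} id \<Psi>"
    unfolding unfolding_of_def holo_germ_def germ_eq_def
  proof (intro conjI)
    have o: "copen (r + p) \<Omega>'" using holo_mapD(1)[OF h\<Psi>(1)] .
    show "base ` {y} \<subseteq> cspace (r + p)" using bc by simp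
    show "\<Psi> ` base ` {y} \<subseteq> base ` {y}" using h\<Psi>(2,4) by auto
    show "\<exists>U. base ` {y} \<subseteq> U \<and> holo_map (r + p) (r + p) U \<Psi>" using h\<Psi>(1,2) by (intro exI[of _ \<Omega>']) auto
    show "\<exists>U. copen (r + p) U \<and> base ` {y} \<subseteq> U \<and> (\<forall>z\<in>U. \<forall>i<r. \<Psi> z i = z i)"
      using o h\<Psi>(2,3) by (intro exI[of _ \<Omega>']) auto
    show "\<exists>U. copen p U \<and> {y} \<subseteq> U \<and> (\<forall>x\<in>U. \<Psi> (base x) = base (id x))"
      using holo_map_preimage[OF holo_join_origin o] h\<Psi>(2,4) yc
      by (intro exI[of _ "{x \<in> cspace p. base x \<in> \<Omega>'}"]) auto
  qed
  have ge: "germ_eq (r + n) ?P (id_times r f) (\<Psi> \<circ> F \<circ> \<Phi>)"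
    unfolding germ_eq_def
  proof (intro exI[of _ \<Omega>S] conjI ballI)
    show "?P \<subseteq> \<Omega>S" using S\<Omega>S by auto
    fix z assume "z \<in> \<Omega>S"
    then obtain s where s: "s \<in> S" "z \<in> Nb s" by (auto simp: \<Omega>S_def)
    show "id_times r f z = (\<Psi> \<circ> F \<circ> \<Phi>) z" using main(1)[OF s] \<Phi>[OF s] by (simp add: If_def)
  qed (rule o\<Omega>S)
  show ?thesis unfolding trivial_unfolding_def A_equivalent_via_def
    using un\<Phi> un\<Psi> bi\<Phi> h\<Psi>(5) ge by blast
qed

end

context normal_crossing_unfolding begin

lemma trivial_unfolding: "trivial_unfolding r n p S y f F"
proof -
  let ?Q = "\<lambda>s U V K. copen (r + p) U \<and> base s \<in> U \<and> U \<subseteq> chart_dom \<and> base y \<in> V \<and> holo_map (r + p) (r + p) V K \<and>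
    (\<forall>z\<in>U. chart s z \<in> V \<and> K (chart s z) = z) \<and> (\<forall>u\<in>V. K u \<in> U \<and> chart s (K u) = u)"
  have ex: "\<forall>s\<in>S. \<exists>U V K. ?Q s U V K"
    using chart_inverse by simp
  from bchoice[OF ex] obtain U where ex: "\<forall>s\<in>S. \<exists>V K. ?Q s (U s) V K" ..
  from bchoice[OF ex] obtain V where ex: "\<forall>s\<in>S. \<exists>K. ?Q s (U s) (V s) K" ..
  from bchoice[OF ex] obtain K where all: "\<forall>s\<in>S. ?Q s (U s) (V s) (K s)" ..
  interpret normal_crossing_charts n p r S y f F D \<nu> \<omega> \<Omega> U V K
  proof
    show "copen (r + p) (U s)" "base s \<in> U s" "U s \<subseteq> chart_dom" "base y \<in> V s" "holo_map (r + p) (r + p) (V s) (K s)"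
      if "s \<in> S" for s using bspec[OF all that] by simp_all
    show "chart s z \<in> V s \<and> K s (chart s z) = z" if "s \<in> S" "z \<in> U s" for s z
      using bspec[OF all that(1)] that(2) by simp
    show "K s u \<in> U s \<and> chart s (K s u) = u" if "s \<in> S" "u \<in> V s" for s u
      using bspec[OF all that(1)] that(2) by simp
  qed
  show ?thesis by (rule charted_unfolding_trivial)
qed

end

text \<open>
  Here \<open>D s\<close> is the derivative of \<open>f\<close> at \<open>s\<close>. The vectors \<open>\<nu> s i\<close> span a complement of its image and are
  tangent to all other branches; such vectors exist if and only if the branches are immersed
  with normal crossings. For \<open>n = p\<close> there are none, and the condition is that all
  branches are local biholomorphisms.
\<close>
theorem normal_crossing_stable:
  assumes np: "n \<le> p" and mg: "multigerm n p S y f"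
    and D: "\<And>s v j. s \<in> S \<Longrightarrow> v \<in> cspace n \<Longrightarrow> j < p \<Longrightarrow>
      ((\<lambda>z. f (\<lambda>i. s i + z * v i) j) has_field_derivative D s v j) (at 0)"
    and \<nu>: "\<And>s i. s \<in> S \<Longrightarrow> i < p - n \<Longrightarrow> \<nu> s i \<in> cspace p"
    and complement: "\<And>s v w. s \<in> S \<Longrightarrow> v \<in> cspace n \<Longrightarrow>
      (\<And>j. j < p \<Longrightarrow> D s v j + (\<Sum>i<p-n. w i * \<nu> s i j) = 0) \<Longrightarrow> v = origin \<and> (\<forall>i<p-n. w i = 0)"
    and cross: "\<And>s s' i. s \<in> S \<Longrightarrow> s' \<in> S \<Longrightarrow> s \<noteq> s' \<Longrightarrow> i < p - n \<Longrightarrow>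
      \<exists>v\<in>cspace n. \<forall>j<p. \<nu> s i j = D s' v j"
  shows "stable_multigerm n p S y f"
  unfolding stable_multigerm_def
proof (intro conjI allI impI)
  show "multigerm n p S y f" by (rule mg)
  have yc: "y \<in> cspace p" and finS: "finite S" and fS: "f ` S \<subseteq> {y}"
    using mg by (auto simp: multigerm_def holo_germ_def)
  obtain \<omega>0 where \<omega>0: "S \<subseteq> \<omega>0" "holo_map n p \<omega>0 f" using mg by (auto simp: multigerm_def holo_germ_def)
  fix r F assume unf: "unfolding_of r n p S {y} f F"
  have "\<exists>U. join r origin ` S \<subseteq> U \<and> holo_map (r + n) (r + p) U F"
    using unf by (simp add: unfolding_of_def holo_germ_def)
  then obtain \<Omega>0 where F: "join r origin ` S \<subseteq> \<Omega>0" "holo_map (r + n) (r + p) \<Omega>0 F" by (elim exE conjE)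
  have "\<exists>U. copen (r + n) U \<and> join r origin ` S \<subseteq> U \<and> (\<forall>z\<in>U. \<forall>i<r. F z i = z i)"
    using unf by (simp add: unfolding_of_def)
  then obtain \<Omega>1 where F1: "copen (r + n) \<Omega>1" "join r origin ` S \<subseteq> \<Omega>1" "\<forall>z\<in>\<Omega>1. \<forall>i<r. F z i = z i"
    by (elim exE conjE)
  have "\<exists>U. copen n U \<and> S \<subseteq> U \<and> (\<forall>x\<in>U. F (join r origin x) = join r origin (f x))"
    using unf by (simp add: unfolding_of_def germ_eq_def)
  then obtain \<omega>1 where F2: "copen n \<omega>1" "S \<subseteq> \<omega>1" "\<forall>x\<in>\<omega>1. F (join r origin x) = join r origin (f x)"
    by (elim exE conjE)
  have o: "copen (r + n) (\<Omega>0 \<inter> \<Omega>1)" "copen n (\<omega>0 \<inter> \<omega>1)"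
    using holo_mapD(1)[OF F(2)] holo_mapD(1)[OF \<omega>0(2)] F1(1) F2(1) by (auto intro: copen_Int)
  interpret normal_crossing_unfolding n p r S y f F D \<nu> "\<omega>0 \<inter> \<omega>1" "\<Omega>0 \<inter> \<Omega>1"
  proof
    show "holo_map n p (\<omega>0 \<inter> \<omega>1) f" by (rule holo_map_subset[OF \<omega>0(2) o(2)]) simp
    show "holo_map (r + n) (r + p) (\<Omega>0 \<inter> \<Omega>1) F" by (rule holo_map_subset[OF F(2) o(1)]) simp
    show "S \<subseteq> \<omega>0 \<inter> \<omega>1" using \<omega>0(1) F2(2) by simp
    show "f s = y" if "s \<in> S" for s using fS that by blast
    show "join r origin s \<in> \<Omega>0 \<inter> \<Omega>1" if "s \<in> S" for s using F(1) F1(2) that by blast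
    show "F z k = z k" if "z \<in> \<Omega>0 \<inter> \<Omega>1" "k < r" for z k using F1(3) that by simp
    show "F (join r origin x) = join r origin (f x)" if "x \<in> \<omega>0 \<inter> \<omega>1" for x using F2(3) that by simp
    show "v = origin \<and> (\<forall>i<p-n. w i = 0)"
      if "s \<in> S" "v \<in> cspace n" "\<And>j. j < p \<Longrightarrow> D s v j + (\<Sum>i<p-n. w i * \<nu> s i j) = 0" for s v w
      by (rule complement[OF that])
  qed (rule np finS yc D \<nu> cross; assumption)+
  show "trivial_unfolding r n p S y f F" by (rule trivial_unfolding)
qed

section \<open>Powers of linear forms in general position\<close>

lemma compact_polydisc: "compact {x \<in> cspace n. \<forall>i<n. cmod (x i) \<le> R}"
proof -
  define B where "B = (\<lambda>i::nat. if i < n then cball 0 R else {0::complex})"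
  have "{x \<in> cspace n. \<forall>i<n. cmod (x i) \<le> R} = PiE UNIV B"
  proof (intro equalityI subsetI)
    fix x assume "x \<in> PiE UNIV B"
    then have x: "x i \<in> B i" for i by auto
    have "cmod (x i) \<le> R" if "i < n" for i using x[of i] that by (simp add: B_def)
    moreover have "x i = 0" if "i \<ge> n" for i using x[of i] that by (simp add: B_def)
    ultimately show "x \<in> {x \<in> cspace n. \<forall>i<n. cmod (x i) \<le> R}" by (simp add: cspace_def)
  qed (auto simp: B_def cspace_def)
  moreover have "compactin (product_topology (\<lambda>i::nat. euclidean :: complex topology) UNIV) (PiE UNIV B)"
    by (subst compactin_PiE) (auto simp: B_def)
  ultimately show ?thesis by (simp add: euclidean_product_topology)
qed

text \<open>
  Compact sets have compact preimages, because these are closed and contained in a polydisc.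
\<close>
lemma proper_map_of_growth:
  assumes cont: "continuous_on UNIV f" and im: "\<And>x. x \<in> cspace n \<Longrightarrow> f x \<in> cspace p"
    and growth: "\<And>R. \<exists>R'. \<forall>x\<in>cspace n. (\<forall>k<p. cmod (f x k) \<le> R) \<longrightarrow> (\<forall>i<n. cmod (x i) \<le> R')"
  shows "proper_map (top_of_set (cspace n)) (top_of_set (cspace p)) f"
proof (rule compact_imp_proper_map)
  have metr: "metrizable_space (top_of_set (cspace p))"
    by (intro metrizable_space_subtopology metrizable_space_euclidean)
  show "k_space (top_of_set (cspace p))" using metr by (rule metrizable_imp_k_space)
  show "kc_space (top_of_set (cspace p))" using metr by (intro Hausdorff_imp_kc_space metrizable_imp_Hausdorff_space)
  show "f \<in> topspace (top_of_set (cspace n)) \<rightarrow> topspace (top_of_set (cspace p))" using im by auto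
  have "continuous_map (top_of_set (cspace n)) (top_of_set (cspace p)) f"
    using continuous_on_subset[OF cont subset_UNIV] im by (auto simp: continuous_map_in_subtopology)
  then show "continuous_map (top_of_set (cspace n)) (top_of_set (cspace p)) f \<or> kc_space (top_of_set (cspace n))" ..
  fix C assume "compactin (top_of_set (cspace p)) C"
  then have C: "compact C" "C \<subseteq> cspace p" by (auto simp: compactin_subtopology)
  have "\<exists>r. \<forall>y\<in>C. cmod (y k) \<le> r" for k
  proof -
    have "continuous_on C (\<lambda>y. y k)" by (rule continuous_on_subset[OF continuous_on_product_coordinates]) simp
    then have "bounded ((\<lambda>y. y k) ` C)" by (intro compact_imp_bounded compact_continuous_image C)
    then show ?thesis by (auto simp: bounded_iff)
  qed
  then have "\<forall>k. \<exists>r. \<forall>y\<in>C. cmod (y k) \<le> r" ..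
  from choice[OF this] obtain r where r: "\<forall>k. \<forall>y\<in>C. cmod (y k) \<le> r k" ..
  define R where "R = Max (insert 0 (r ` {..<p}))"
  have R: "cmod (y k) \<le> R" if "y \<in> C" "k < p" for y k
  proof -
    have "cmod (y k) \<le> r k" using r that by blast
    also have "\<dots> \<le> R" unfolding R_def using that by (intro Max_ge) auto
    finally show ?thesis .
  qed
  from growth[of R] obtain R' where R': "\<forall>x\<in>cspace n. (\<forall>k<p. cmod (f x k) \<le> R) \<longrightarrow> (\<forall>i<n. cmod (x i) \<le> R')" ..
  have "{x \<in> cspace n. f x \<in> C} = {x \<in> cspace n. \<forall>i<n. cmod (x i) \<le> R'} \<inter> (f -` C)"
    using R' R by auto
  moreover have "closed (f -` C)"
    by (rule continuous_closed_vimage[OF compact_imp_closed[OF C(1)]])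
       (use cont in \<open>simp add: continuous_on_eq_continuous_at\<close>)
  ultimately have "compact {x \<in> cspace n. f x \<in> C}" using compact_Int_closed[OF compact_polydisc] by simp
  then show "compactin (top_of_set (cspace n)) {x \<in> topspace (top_of_set (cspace n)). f x \<in> C}"
    by (auto simp: compactin_subtopology)
qed

lemma common_denominator:
  fixes Q :: "rat set"
  assumes "finite Q"
  shows "\<exists>d::int. d > 0 \<and> (\<forall>q\<in>Q. \<exists>a::int. of_int d * q = of_int a)"
  using assms
proof (induction Q)
  case (insert q Q)
  then obtain d :: int where d: "d > 0" "\<forall>q\<in>Q. \<exists>a::int. of_int d * q = of_int a" by blast
  obtain a c where ac: "quotient_of q = (a, c)" by (cases "quotient_of q")
  have c: "c > 0" "q = of_int a / of_int c" using quotient_of_denom_pos[OF ac] quotient_of_div[OF ac] by auto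
  have "\<exists>a'::int. of_int (d * c) * x = of_int a'" if "x \<in> insert q Q" for x
  proof (cases "x = q")
    case True
    then have "of_int (d * c) * x = of_int (d * a)" using c by simp
    then show ?thesis by (rule exI)
  next
    case False
    then have "x \<in> Q" using that by simp
    from bspec[OF d(2) this] obtain a' :: int where a': "of_int d * x = of_int a'" ..
    have "of_int (d * c) * x = of_int c * (of_int d * x)" by simp
    then have "of_int (d * c) * x = of_int (c * a')" unfolding a' by simp
    then show ?thesis by (rule exI)
  qed
  then show ?case using d(1) c(1) by (intro exI[of _ "d * c"]) auto
qed (auto intro: exI[of _ 1])

locale linear_form_powers =
  fixes n :: nat and H :: "rat mat" and m r :: "nat \<Rightarrow> nat"
  assumes n1: "n \<ge> 1" and H: "H \<in> carrier_mat (n - 1) n" and rank: "all_submatrices_maximal_rank H"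
    and mpos: "\<And>i. i < n \<Longrightarrow> m i > 0" and rpos: "\<And>j. j < n - 1 \<Longrightarrow> r j > 0"
    and mm: "\<And>i k. i < n \<Longrightarrow> k < n \<Longrightarrow> i \<noteq> k \<Longrightarrow> coprime (m i) (m k)"
    and rr: "\<And>j l. j < n - 1 \<Longrightarrow> l < n - 1 \<Longrightarrow> j \<noteq> l \<Longrightarrow> coprime (r j) (r l)"
    and mr: "\<And>i j. i < n \<Longrightarrow> j < n - 1 \<Longrightarrow> coprime (m i) (r j)"
begin

definition M :: "nat \<Rightarrow> nat" where "M k = (if k < n then m k else r (k - n))"

text \<open>
  The coordinates of the embedding of \<open>\<complex>\<^sup>n\<close> into \<open>\<complex>\<^sup>N\<close>: first \<open>x\<close>, then \<open>Hx\<close>. Values at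
  indices from \<open>N\<close> on have no meaning.
\<close>
definition Z :: "(nat \<Rightarrow> complex) \<Rightarrow> nat \<Rightarrow> complex" where
  "Z x k = (if k < n then x k else \<Sum>i<n. of_rat (H $$ (k - n, i)) * x i)"

abbreviation f :: "(nat \<Rightarrow> complex) \<Rightarrow> nat \<Rightarrow> complex" where "f \<equiv> power_map n H m r"

lemma f_apply: "f x k = (if k < 2*n-1 then Z x k ^ M k else 0)"
proof -
  have "(map_mat of_rat H *\<^sub>v vec n x) $ j = (\<Sum>i<n. of_rat (H $$ (j, i)) * x i)" if "j < n - 1" for j
    using H that by (simp add: scalar_prod_def atLeast0LessThan)
  then show ?thesis using n1 by (auto simp: power_map_def Z_def M_def)
qed

definition den :: int where
  "den = (SOME d. d > 0 \<and> (\<forall>q\<in>(\<lambda>(j,i). H $$ (j,i)) ` ({..<n-1} \<times> {..<n}). \<exists>a::int. of_int d * q = of_int a))"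

lemma den: "den > 0" "\<And>i j. j < n - 1 \<Longrightarrow> i < n \<Longrightarrow> \<exists>a::int. of_int den * H $$ (j,i) = of_int a"
proof -
  have "den > 0 \<and> (\<forall>q\<in>(\<lambda>(j,i). H $$ (j,i)) ` ({..<n-1} \<times> {..<n}). \<exists>a::int. of_int den * q = of_int a)"
    unfolding den_def by (rule someI_ex) (rule common_denominator, simp)
  then show "den > 0" "\<And>i j. j < n - 1 \<Longrightarrow> i < n \<Longrightarrow> \<exists>a::int. of_int den * H $$ (j,i) = of_int a" by auto
qed

text \<open>
  The columns of \<open>den * (H | -1)\<close>, where the factor makes the entries of \<open>H\<close> integers.
\<close>
definition b :: "nat \<Rightarrow> nat \<Rightarrow> int" where
  "b k j = (if k < n then \<lfloor>of_int den * H $$ (j,k)\<rfloor> else if k = n + j then - den else 0)"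

lemma b_sum:
  assumes j: "j < n - 1"
  shows "(\<Sum>k<2*n-1. of_int (b k j) * z k) = of_int den * ((\<Sum>i<n. of_rat (H $$ (j,i)) * z i) - z (n + j) :: complex)"
proof -
  have bi: "of_int (b i j) = (of_int den * of_rat (H $$ (j,i)) :: complex)" if i: "i < n" for i
  proof -
    obtain a :: int where a: "of_int den * H $$ (j,i) = of_int a" using den(2)[OF j i] by blast
    then have "b i j = a" using i by (simp add: b_def)
    moreover have "of_rat (of_int den * H $$ (j,i)) = (of_int a :: complex)" unfolding a by simp
    ultimately show ?thesis by (simp add: of_rat_mult)
  qed
  have "n \<le> 2*n-1" using n1 by simp
  then have un: "{..<2*n-1} = {..<n} \<union> {n..<2*n-1}" by auto
  have "(\<Sum>k<2*n-1. of_int (b k j) * z k) = (\<Sum>k\<in>{..<n}. of_int (b k j) * z k) + (\<Sum>k\<in>{n..<2*n-1}. of_int (b k j) * z k)"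
    by (subst un, subst sum.union_disjoint) auto
  also have "(\<Sum>k\<in>{n..<2*n-1}. of_int (b k j) * z k) = (\<Sum>k\<in>{n..<2*n-1}. if k = n + j then - of_int den * z k else 0)"
    by (rule sum.cong) (auto simp: b_def)
  also have "\<dots> = - of_int den * z (n + j)" using j by simp
  also have "(\<Sum>k\<in>{..<n}. of_int (b k j) * z k) = of_int den * (\<Sum>i<n. of_rat (H $$ (j,i)) * z i)"
    unfolding sum_distrib_left by (rule sum.cong) (auto simp: bi)
  finally show ?thesis by (simp add: algebra_simps)
qed

lemma relation_iff:
  "(\<forall>j<n-1. (\<Sum>k<2*n-1. of_int (b k j) * z k) = (0::complex)) \<longleftrightarrow> (\<forall>k<2*n-1. z k = Z z k)"
proof -
  have "(\<forall>j<n-1. (\<Sum>k<2*n-1. of_int (b k j) * z k) = (0::complex)) \<longleftrightarrow>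
      (\<forall>j<n-1. z (n + j) = (\<Sum>i<n. of_rat (H $$ (j,i)) * z i))"
    using b_sum[of _ z] den(1) by auto
  also have "\<dots> \<longleftrightarrow> (\<forall>k<2*n-1. z k = Z z k)"
  proof (intro iffI allI impI)
    fix k assume *: "\<forall>j<n-1. z (n + j) = (\<Sum>i<n. of_rat (H $$ (j,i)) * z i)" and k: "k < 2*n-1"
    show "z k = Z z k"
    proof (cases "k < n")
      case False
      then show ?thesis using *[rule_format, of "k - n"] k by (simp add: Z_def)
    qed (simp add: Z_def)
  next
    fix j assume *: "\<forall>k<2*n-1. z k = Z z k" and j: "j < n - 1"
    show "z (n + j) = (\<Sum>i<n. of_rat (H $$ (j,i)) * z i)" using *[rule_format, of "n + j"] j by (simp add: Z_def)
  qed
  finally show ?thesis .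
qed

lemma Z_restrict: "Z (Z x) k = Z x k"
  by (simp add: Z_def)

text \<open>
  A minor of \<open>H\<close> that does not vanish over the rationals does not vanish over the complex numbers.
\<close>
lemma square_minor_injective:
  assumes I: "I \<subseteq> {..<n}" "I \<noteq> {}" and J: "J \<subseteq> {..<n-1}" "card J = card I"
    and z: "\<And>j. j \<in> J \<Longrightarrow> (\<Sum>i\<in>I. of_rat (H $$ (j,i)) * z i) = (0::complex)" and i: "i \<in> I"
  shows "z i = 0"
proof -
  let ?q = "card I"
  have fin: "finite I" "finite J" using I(1) J(1) finite_subset by blast+
  have J0: "J \<noteq> {}" using I(2) J(2) fin by auto
  have cI: "card {i. i < dim_col H \<and> i \<in> I} = ?q" "card {j. j < dim_row H \<and> j \<in> J} = ?q"
  proof -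
    have "{i. i < dim_col H \<and> i \<in> I} = I" "{j. j < dim_row H \<and> j \<in> J} = J" using I(1) J(1) H by auto
    then show "card {i. i < dim_col H \<and> i \<in> I} = ?q" "card {j. j < dim_row H \<and> j \<in> J} = ?q" using J(2) by simp_all
  qed
  define B where "B = submatrix H J I"
  have B: "B \<in> carrier_mat ?q ?q" using cI by (simp add: B_def submatrix_def)
  have "vec_space.rank (card J) B = min (card J) (card I)"
  proof -
    have "dim_row H = n - 1" "dim_col H = n" using H by auto
    then have "J \<subseteq> {..<dim_row H} \<and> I \<subseteq> {..<dim_col H} \<and> J \<noteq> {} \<and> I \<noteq> {}" using I J J0 by simp
    then show ?thesis using rank unfolding B_def all_submatrices_maximal_rank_def by (elim allE impE)
  qed
  then have "vec_space.rank ?q B = ?q" using J(2) by simp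
  then have "det B \<noteq> 0" using vec_space.det_rank_iff[OF B] by blast
  have pI: "pick I c \<in> I" if "c < ?q" for c using pick_in_set_le[OF that] .
  have pJ: "pick J c \<in> J" if "c < ?q" for c using pick_in_set_le[of c J] that J(2) by simp
  have bij: "bij_betw (pick I) {..<?q} I"
    unfolding bij_betw_def
  proof
    have "I \<subseteq> pick I ` {..<?q}"
    proof
      fix i assume i: "i \<in> I"
      have "{a\<in>I. a < i} \<subset> I" using i by auto
      then have "card {a\<in>I. a < i} < ?q" using fin by (intro psubset_card_mono)
      then show "i \<in> pick I ` {..<?q}" using pick_card_in_set[OF i] by (intro image_eqI[of _ _ "card {a\<in>I. a < i}"]) auto
    qed
    then show im: "pick I ` {..<?q} = I" using pI by auto
    show "inj_on (pick I) {..<?q}" by (rule eq_card_imp_inj_on) (simp_all add: im)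
  qed
  define C where "C = map_mat (of_rat :: rat \<Rightarrow> complex) B"
  have "det C = of_rat (det B)" unfolding C_def by simp
  then have dC: "det C \<noteq> 0" using \<open>det B \<noteq> 0\<close> by simp
  have C: "C = mat ?q ?q (\<lambda>(a,c). of_rat (H $$ (pick J a, pick I c)))"
    unfolding C_def B_def submatrix_def using cI by (intro eq_matI) auto
  have "i \<in> pick I ` {..<?q}" using bij i by (simp add: bij_betw_def)
  then obtain c where "i = pick I c" "c \<in> {..<?q}" by (rule imageE)
  then have c: "c < ?q" "pick I c = i" by simp_all
  show ?thesis
  proof (rule ccontr)
    assume "z i \<noteq> 0"
    have "(\<Sum>c<?q. of_rat (H $$ (pick J a, pick I c)) * z (pick I c)) = 0" if "a < ?q" for a
    proof -
      have "(\<Sum>c<?q. of_rat (H $$ (pick J a, pick I c)) * z (pick I c)) = (\<Sum>i\<in>I. of_rat (H $$ (pick J a, i)) * z i)"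
        using sum.reindex_bij_betw[OF bij, of "\<lambda>i. of_rat (H $$ (pick J a, i)) * z i"] by simp
      then show ?thesis using z[OF pJ[OF that]] by simp
    qed
    then have "det C = 0" unfolding C det_zero_iff_kernel
      using c \<open>z i \<noteq> 0\<close> by (intro exI[of _ "\<lambda>c. z (pick I c)"]) auto
    then show False using dC by simp
  qed
qed

sublocale generic_power_map n b M
proof
  show "n \<ge> 1" by (rule n1)
  show "M k > 0" if "k < 2*n-1" for k using that mpos rpos[of "k - n"] by (auto simp: M_def)
  show "coprime (M k) (M l)" if "k < 2*n-1" "l < 2*n-1" "k \<noteq> l" for k l
    using that mm[of k l] rr[of "k - n" "l - n"] mr[of k "l - n"] mr[of l "k - n"]
    by (auto simp: M_def coprime_commute)
  fix z :: "nat \<Rightarrow> complex" and k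
  assume rel: "\<And>j. j < n - 1 \<Longrightarrow> (\<Sum>k<2*n-1. of_int (b k j) * z k) = 0"
    and card: "card {k\<in>{..<2*n-1}. z k \<noteq> 0} < n" and k: "k < 2*n-1"
  have zZ: "z k = Z z k" if "k < 2*n-1" for k using rel relation_iff that by blast
  define I where "I = {i\<in>{..<n}. z i \<noteq> 0}"
  define J where "J = {j\<in>{..<n-1}. z (n + j) \<noteq> 0}"
  have fin: "finite I" "finite J" by (auto simp: I_def J_def)
  have "I \<union> (\<lambda>j. n + j) ` J \<subseteq> {k\<in>{..<2*n-1}. z k \<noteq> 0}" by (auto simp: I_def J_def)
  then have "card (I \<union> (\<lambda>j. n + j) ` J) \<le> card {k\<in>{..<2*n-1}. z k \<noteq> 0}" by (intro card_mono) auto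
  moreover have "card (I \<union> (\<lambda>j. n + j) ` J) = card I + card J"
    by (subst card_Un_disjoint) (use fin in \<open>auto simp: I_def card_image\<close>)
  ultimately have cIJ: "card I + card J < n" using card by simp
  have "I = {}"
  proof (rule ccontr)
    assume I0: "I \<noteq> {}"
    have "card ({..<n-1} - J) = n - 1 - card J"
      by (subst card_Diff_subset) (use fin in \<open>auto simp: J_def\<close>)
    then have "card I \<le> card ({..<n-1} - J)" using cIJ by simp
    then obtain J' where J': "J' \<subseteq> {..<n-1} - J" "card J' = card I" by (rule obtain_subset_with_card_n)
    obtain i where i: "i \<in> I" using I0 by blast
    have "z i = 0"
    proof (rule square_minor_injective[OF _ I0 _ J'(2) _ i])
      fix j assume j: "j \<in> J'"
      then have j': "j < n - 1" "z (n + j) = 0" using J'(1) by (auto simp: J_def)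
      have "(\<Sum>i\<in>I. of_rat (H $$ (j,i)) * z i) = (\<Sum>i<n. of_rat (H $$ (j,i)) * z i)"
        by (rule sum.mono_neutral_left) (auto simp: I_def)
      also have "\<dots> = z (n + j)" using zZ[of "n + j"] j' by (simp add: Z_def)
      finally show "(\<Sum>i\<in>I. of_rat (H $$ (j,i)) * z i) = 0" using j' by simp
    qed (use J'(1) in \<open>auto simp: I_def\<close>)
    then show False using i by (simp add: I_def)
  qed
  then have "z i = 0" if "i < n" for i using that by (auto simp: I_def)
  then have "Z z k = 0" by (simp add: Z_def)
  then show "z k = 0" using zZ[OF k] by simp
qed

lemma inE_iff: "inE z \<longleftrightarrow> (\<forall>k<N. z k = Z z k)"
  unfolding inE_def by (rule relation_iff)

lemma inE_cong: "(\<And>k. k < N \<Longrightarrow> z k = w k) \<Longrightarrow> inE z \<longleftrightarrow> inE w"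
  by (simp add: inE_def)

lemma inE_Z: "inE (Z x)"
  unfolding inE_iff by (simp add: Z_restrict)

lemma Z_line: "Z (\<lambda>i. x i + c * v i) k = Z x k + c * Z v k"
proof -
  have "(\<Sum>i<n. of_rat (H $$ (k - n, i)) * (x i + c * v i)) =
      (\<Sum>i<n. of_rat (H $$ (k - n, i)) * x i) + c * (\<Sum>i<n. of_rat (H $$ (k - n, i)) * v i)"
    unfolding sum_distrib_left sum.distrib[symmetric] by (rule sum.cong) (auto simp: algebra_simps)
  then show ?thesis by (simp add: Z_def)
qed

lemma Z_eq_0D:
  assumes "x \<in> cspace n" "\<And>k. k < N \<Longrightarrow> Z x k = 0"
  shows "x = origin"
proof
  fix i show "x i = 0"
    using assms(2)[of i] cspaceD[OF assms(1), of i] n1 by (cases "i < n") (auto simp: Z_def)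
qed

lemma f_source: "i < n \<Longrightarrow> f x i = x i ^ m i"
  using n1 by (simp add: f_apply Z_def M_def)

lemma f_origin: "f origin = origin"
  using Mpos by (auto simp: f_apply Z_def fun_eq_iff zero_power)

lemma f_in_cspace [simp]: "f x \<in> cspace N"
  by (simp add: cspace_def f_apply)

lemma holo_f: "holo_map n N (cspace n) f"
proof (rule holo_mapI)
  fix a j assume a: "a \<in> cspace n" and j: "j < N"
  have "cdiff n (\<lambda>x. Z x j) a"
    unfolding Z_def using a by (intro cdiff_if cdiff_coord cdiff_sum cdiff_mult cdiff_const)
  then show "cdiff n (\<lambda>x. f x j) a" using cdiff_power[OF a] j by (simp add: f_apply)
qed (rule copen_cspace f_in_cspace)+

lemma continuous_f: "continuous_on UNIV f"
proof (rule continuous_on_coordinatewise_then_product)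
  fix k
  have "continuous_on UNIV (\<lambda>x. Z x k)"
    unfolding Z_def by (cases "k < n") (auto intro!: continuous_intros continuous_on_product_coordinates)
  then show "continuous_on UNIV (\<lambda>x. f x k)"
    by (cases "k < N") (auto simp: f_apply intro: continuous_intros)
qed

definition D :: "(nat \<Rightarrow> complex) \<Rightarrow> (nat \<Rightarrow> complex) \<Rightarrow> nat \<Rightarrow> complex" where
  "D s v k = (if k < N then of_nat (M k) * Z s k ^ (M k - 1) * Z v k else 0)"

lemma D: "k < N \<Longrightarrow> ((\<lambda>z. f (\<lambda>i. s i + z * v i) k) has_field_derivative D s v k) (at 0)"
  unfolding f_apply Z_line D_def by (auto intro!: derivative_eq_intros)

lemma D_cspace [simp]: "D s v \<in> cspace N"
  by (simp add: D_def cspace_def)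

lemma D_nonzero: "k < N \<Longrightarrow> Z s k \<noteq> 0 \<Longrightarrow> D s v k = 0 \<Longrightarrow> Z v k = 0"
  using Mpos[of k] by (simp add: D_def)

definition ratio :: "(nat \<Rightarrow> complex) \<Rightarrow> (nat \<Rightarrow> complex) \<Rightarrow> nat \<Rightarrow> complex" where
  "ratio x x' k = (if Z x k = 0 then 1 else Z x' k / Z x k)"

lemma support_large:
  assumes "x \<in> cspace n" "x \<noteq> origin"
  shows "card {k\<in>{..<N}. Z x k \<noteq> 0} \<ge> n"
proof (rule ccontr)
  assume "\<not> ?thesis"
  then have small: "card {k\<in>{..<N}. Z x k \<noteq> 0} < n" by simp
  have "x = origin" by (rule Z_eq_0D[OF assms(1)]) (rule inE_zero[OF inE_Z small])
  then show False using assms(2) by simp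
qed

text \<open>
  Two points of a fibre differ by roots of unity in each coordinate. Where the coordinates vanish
  the ratio is 1 by convention, so that \<open>ratio \<noteq> 1\<close> exactly where the coordinates differ.
\<close>
lemma fibre_ratio:
  assumes x: "x \<in> cspace n" "x' \<in> cspace n" and eq: "f x = f x'"
  shows "k < N \<Longrightarrow> ratio x x' k ^ M k = 1" "k < N \<Longrightarrow> ratio x x' k * Z x k = Z x' k"
    and "x \<noteq> x' \<Longrightarrow> card {k\<in>{..<N}. ratio x x' k \<noteq> 1} \<ge> n" "inE (\<lambda>k. ratio x x' k * Z x k)"
proof -
  have pw: "Z x k ^ M k = Z x' k ^ M k" if "k < N" for k using fun_cong[OF eq, of k] that by (simp add: f_apply)
  show 1: "ratio x x' k * Z x k = Z x' k" if k: "k < N" for k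
  proof (cases "Z x k = 0")
    case True
    then have "Z x' k ^ M k = 0" using pw[OF k] Mpos[OF k] by (simp add: zero_power)
    then show ?thesis using True by simp
  qed (simp add: ratio_def)
  show "ratio x x' k ^ M k = 1" if k: "k < N" for k
  proof (cases "Z x k = 0")
    case False
    have "ratio x x' k ^ M k = Z x' k ^ M k / Z x k ^ M k" using False by (simp add: ratio_def power_divide)
    then show ?thesis unfolding pw[OF k, symmetric] using False by simp
  qed (simp add: ratio_def)
  have "inE (\<lambda>k. ratio x x' k * Z x k) \<longleftrightarrow> inE (Z x')"
    by (rule inE_cong) (rule 1)
  then show "inE (\<lambda>k. ratio x x' k * Z x k)" using inE_Z by simp
  assume ne: "x \<noteq> x'"
  define w where "w = (\<lambda>i. x i + (-1) * x' i)"
  have "w \<in> cspace n" unfolding w_def by (rule cspace_add_scale[OF x])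
  moreover have "w \<noteq> origin"
  proof
    assume w0: "w = origin"
    have "x i = x' i" for i using fun_cong[OF w0, of i] by (simp add: w_def)
    then show False using ne by blast
  qed
  ultimately have "card {k\<in>{..<N}. Z w k \<noteq> 0} \<ge> n" by (rule support_large)
  moreover have "{k\<in>{..<N}. Z w k \<noteq> 0} \<subseteq> {k\<in>{..<N}. ratio x x' k \<noteq> 1}"
  proof
    fix k assume k: "k \<in> {k\<in>{..<N}. Z w k \<noteq> 0}"
    then have "Z x k \<noteq> Z x' k" unfolding w_def Z_line by auto
    then show "k \<in> {k\<in>{..<N}. ratio x x' k \<noteq> 1}" using 1[of k] k by auto
  qed
  then have "card {k\<in>{..<N}. Z w k \<noteq> 0} \<le> card {k\<in>{..<N}. ratio x x' k \<noteq> 1}" by (intro card_mono) auto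
  ultimately show "card {k\<in>{..<N}. ratio x x' k \<noteq> 1} \<ge> n" by linarith
qed

lemma fibre_card:
  assumes n: "n \<ge> 2" and x: "x \<in> cspace n" "x' \<in> cspace n" "x'' \<in> cspace n"
    and eq: "f x' = f x" "f x'' = f x" and nz: "x \<noteq> origin" and ne: "x \<noteq> x'" "x \<noteq> x''"
  shows "x' = x''"
proof (rule ccontr)
  assume ne': "x' \<noteq> x''"
  note r1 = fibre_ratio[OF x(1,2) eq(1)[symmetric]] and r2 = fibre_ratio[OF x(1,3) eq(2)[symmetric]]
  define w where "w = (\<lambda>i. x' i + (-1) * x'' i)"
  have "w \<in> cspace n" unfolding w_def by (rule cspace_add_scale[OF x(2,3)])
  moreover have "w \<noteq> origin"
  proof
    assume w0: "w = origin"
    have "x' i = x'' i" for i using fun_cong[OF w0, of i] by (simp add: w_def)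
    then show False using ne' by blast
  qed
  ultimately have "card {k\<in>{..<N}. Z w k \<noteq> 0} \<ge> n" by (rule support_large)
  moreover have "{k\<in>{..<N}. Z w k \<noteq> 0} \<subseteq> {k\<in>{..<N}. ratio x x' k \<noteq> ratio x x'' k}"
  proof
    fix k assume k: "k \<in> {k\<in>{..<N}. Z w k \<noteq> 0}"
    then have "Z x' k \<noteq> Z x'' k" unfolding w_def Z_line by auto
    then show "k \<in> {k\<in>{..<N}. ratio x x' k \<noteq> ratio x x'' k}" using r1(2)[of k] r2(2)[of k] k by auto
  qed
  then have "card {k\<in>{..<N}. Z w k \<noteq> 0} \<le> card {k\<in>{..<N}. ratio x x' k \<noteq> ratio x x'' k}" by (intro card_mono) auto
  ultimately have T3: "card {k\<in>{..<N}. ratio x x' k \<noteq> ratio x x'' k} \<ge> n" by linarith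
  have "Z x k = 0" if "k < N" for k
    by (rule no_triple_point[OF n r1(1) r2(1) r1(3)[OF ne(1)] r2(3)[OF ne(2)] T3 inE_Z r1(4) r2(4) that])
  then have "x = origin" by (rule Z_eq_0D[OF x(1)])
  then show False using nz by simp
qed

lemma double_point_nonzero:
  assumes n: "n \<ge> 2" and x: "x \<in> cspace n" "x' \<in> cspace n" and eq: "f x = f x'" and nz: "x \<noteq> origin" and ne: "x \<noteq> x'"
    and k: "k < N"
  shows "Z x k \<noteq> 0"
proof
  assume "Z x k = 0"
  note r = fibre_ratio[OF x eq]
  have "Z x l = 0" if "l < N" for l
    by (rule double_point_line[OF n r(1) r(3)[OF ne] inE_Z r(4) k \<open>Z x k = 0\<close> that])
  then have "x = origin" by (rule Z_eq_0D[OF x(1)])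
  then show False using nz by simp
qed

text \<open>
  The condition on the derivatives says that \<open>Z v'\<close> is \<open>- ratio\<close> times \<open>Z v\<close>. So \<open>Z v\<close> solves the same
  equations as \<open>Z x\<close>, and it vanishes if one of its coordinates does. Hence the tangent
  spaces meet in a line, and \<open>v' 0 = 0\<close> defines a complement of this line in one of them.
\<close>
lemma double_point_transverse:
  assumes n: "n \<ge> 2" and x: "x \<in> cspace n" "x' \<in> cspace n" and eq: "f x = f x'" and nz: "x \<noteq> origin" and ne: "x \<noteq> x'"
    and v: "v \<in> cspace n" "v' \<in> cspace n" and D: "\<And>k. k < N \<Longrightarrow> D x v k + D x' v' k = 0" and v0: "v' 0 = 0"
  shows "v = origin \<and> v' = origin"
proof -
  note r = fibre_ratio[OF x eq]
  have Zx: "Z x k \<noteq> 0" if "k < N" for k using double_point_nonzero[OF n x eq nz ne that] .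
  have Zv: "ratio x x' k * Z v k = - Z v' k" if k: "k < N" for k
  proof -
    define t where "t = ratio x x' k"
    have t1: "t ^ M k = 1" using r(1)[OF k] by (simp add: t_def)
    have t0: "t \<noteq> 0" using t1 Mpos[OF k] by (auto simp: zero_power)
    have tinv: "t * t ^ (M k - 1) = 1" using t1 Mpos[OF k] by (metis power_eq_if neq0_conv)
    define q where "q = of_nat (M k) * Z x k ^ (M k - 1)"
    have q0: "q \<noteq> 0" using Zx[OF k] Mpos[OF k] by (simp add: q_def)
    have "Z x' k = t * Z x k" using r(2)[OF k] by (simp add: t_def)
    then have "q * Z v k + q * t ^ (M k - 1) * Z v' k = 0"
      using D[OF k] k by (simp add: q_def D_def power_mult_distrib algebra_simps)
    then have "q * (Z v k + t ^ (M k - 1) * Z v' k) = 0" by (simp add: algebra_simps)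
    then have "Z v k + t ^ (M k - 1) * Z v' k = 0" using q0 by simp
    then have "t * (Z v k + t ^ (M k - 1) * Z v' k) = 0" by simp
    then have "t * Z v k + (t * t ^ (M k - 1)) * Z v' k = 0" by (simp add: algebra_simps)
    then have "t * Z v k + Z v' k = 0" by (simp only: tinv mult_1)
    then show ?thesis by (simp add: t_def eq_neg_iff_add_eq_0)
  qed
  have N0: "0 < N" using n by simp
  have "inE (\<lambda>k. ratio x x' k * Z v k) \<longleftrightarrow> inE (\<lambda>k. 0 * Z v' k + (-1) * Z v' k)"
    by (rule inE_cong) (simp add: Zv)
  then have E: "inE (\<lambda>k. ratio x x' k * Z v k)" using inE_comb[OF inE_Z inE_Z] by blast
  have "ratio x x' 0 * Z v 0 = 0" using Zv[OF N0] v0 n1 by (simp add: Z_def)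
  moreover have "ratio x x' 0 \<noteq> 0" using r(1)[OF N0] Mpos[OF N0] by (auto simp: zero_power)
  ultimately have z0: "Z v 0 = 0" by simp
  have Zv0: "Z v k = 0" if "k < N" for k
    by (rule double_point_line[OF n r(1) r(3)[OF ne] inE_Z E N0 z0 that])
  then have Zv'0: "Z v' k = 0" if "k < N" for k using Zv[OF that] that by simp
  show ?thesis using Z_eq_0D[OF v(1) Zv0] Z_eq_0D[OF v(2) Zv'0] by (rule conjI)
qed

definition unit :: "nat \<Rightarrow> nat \<Rightarrow> complex" where "unit k = (\<lambda>i. if i = k then 1 else 0)"

lemma Z_sum: "Z (\<lambda>i. \<Sum>a\<in>A. w a * e a i) k = (\<Sum>a\<in>A. w a * Z (e a) k)"
  unfolding Z_def by (auto simp: sum_distrib_left mult.left_commute intro: sum.swap)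

lemma D_sum: "D s (\<lambda>i. \<Sum>a\<in>A. w a * e a i) k = (\<Sum>a\<in>A. w a * D s (e a) k)"
  by (simp add: D_def Z_sum sum_distrib_left mult.left_commute)

text \<open>
  The normal vectors for a single branch are unit vectors outside \<open>n\<close> coordinates that are
  non-zero at the point. For a double point they are the images, under the derivative of the other
  branch, of the unit vectors except the first.
\<close>
lemma stable_fibre:
  assumes S: "finite S" "S \<subseteq> cspace n" "\<And>s. s \<in> S \<Longrightarrow> f s = y" and y: "y \<in> cspace N" "y \<noteq> origin"
  shows "stable_multigerm n N S y f"
proof -
  have mg: "multigerm n N S y f"
    unfolding multigerm_def holo_germ_def using S y holo_f by (auto intro!: exI[of _ "cspace n"])
  have nz: "s \<noteq> origin" if "s \<in> S" for s using S(3)[OF that] y f_origin by auto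
  have nN: "n \<le> N" "N - n = n - 1" using n1 by auto
  have immersion: "v = origin"
    if A: "A \<subseteq> {..<N}" "card A = n" "\<And>k. k \<in> A \<Longrightarrow> Z v k = 0" and v: "v \<in> cspace n" for A v
  proof (rule ccontr)
    assume "v \<noteq> origin"
    have "{k\<in>{..<N}. Z v k \<noteq> 0} \<subseteq> {..<N} - A" using A by auto
    then have "card {k\<in>{..<N}. Z v k \<noteq> 0} \<le> card ({..<N} - A)" by (intro card_mono) auto
    also have "\<dots> = N - n" using A by (subst card_Diff_subset) (auto intro: finite_subset)
    finally show False using support_large[OF v \<open>v \<noteq> origin\<close>] n1 by simp
  qed
  have A: "\<exists>A\<subseteq>{k\<in>{..<N}. Z s k \<noteq> 0}. card A = n" if "s \<in> S" for s
    using obtain_subset_with_card_n[OF support_large[OF _ nz[OF that]]] S(2) that by (metis subsetD)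
  consider "n = 1" | "n \<ge> 2" "S = {}" | s where "n \<ge> 2" "S = {s}" | s t where "n \<ge> 2" "S = {s,t}" "s \<noteq> t"
  proof (cases "n = 1 \<or> S = {}")
    case True then show ?thesis using that n1 by (cases "n = 1") auto
  next
    case False
    then have n2: "n \<ge> 2" using n1 by simp
    obtain s where s: "s \<in> S" using False by blast
    show ?thesis
    proof (cases "S = {s}")
      case False
      then obtain t where t: "t \<in> S" "t \<noteq> s" using s by blast
      have "u \<in> {s,t}" if u: "u \<in> S" for u
        using fibre_card[OF n2, of s t u] S s t u nz[OF s] by (metis insert_iff subsetD)
      then have "S = {s,t}" using s t by blast
      then show ?thesis using that n2 t by blast
    qed (use that n2 in blast)
  qed
  then show ?thesis
  proof cases
    case 1
    show ?thesis
    proof (rule normal_crossing_stable[where D = D and \<nu> = "\<lambda>s i. origin", OF nN(1) mg])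
      fix s v w assume s: "s \<in> S" and v: "v \<in> cspace n"
        and eq: "\<And>j. j < N \<Longrightarrow> D s v j + (\<Sum>i<N-n. w i * 0) = 0"
      obtain A where A: "A \<subseteq> {k\<in>{..<N}. Z s k \<noteq> 0}" "card A = n" using A[OF s] by blast
      have "v = origin"
        by (rule immersion[OF _ A(2) _ v]) (use A(1) D_nonzero[of _ s v] eq in auto)
      then show "v = origin \<and> (\<forall>i<N-n. w i = 0)" using 1 by simp
    qed (use 1 D in auto)
  next
    case 2
    show ?thesis
      by (rule normal_crossing_stable[where D = D and \<nu> = "\<lambda>s i. origin", OF nN(1) mg]) (use 2 in auto)
  next
    case (3 s)
    then have s: "s \<in> S" by simp
    obtain A where A: "A \<subseteq> {k\<in>{..<N}. Z s k \<noteq> 0}" "card A = n" using A[OF s] by blast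
    have cB: "card ({..<N} - A) = n - 1"
      using A nN by (subst card_Diff_subset) (auto intro: finite_subset)
    obtain \<kappa> where \<kappa>: "bij_betw \<kappa> {..<n-1} ({..<N} - A)"
      using ex_bij_betw_nat_finite[of "{..<N} - A"] cB by (auto simp: atLeast0LessThan)
    have \<kappa>in: "\<kappa> i < N" "\<kappa> i \<notin> A" if "i < n - 1" for i using \<kappa> that by (auto simp: bij_betw_def)
    have \<kappa>inj: "\<kappa> i = \<kappa> j \<longleftrightarrow> i = j" if "i < n - 1" "j < n - 1" for i j
      using \<kappa> that by (auto simp: bij_betw_def inj_on_def)
    show ?thesis
    proof (rule normal_crossing_stable[where D = D and \<nu> = "\<lambda>s i. unit (\<kappa> i)", OF nN(1) mg])
      show "unit (\<kappa> i) \<in> cspace N" if "i < N - n" for i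
        using \<kappa>in(1)[of i] that nN by (auto simp: unit_def cspace_def)
      fix s' v w assume s': "s' \<in> S" and v: "v \<in> cspace n"
        and eq: "\<And>j. j < N \<Longrightarrow> D s' v j + (\<Sum>i<N-n. w i * unit (\<kappa> i) j) = 0"
      have ss: "s' = s" using s' 3 by simp
      have v0: "v = origin"
      proof (rule immersion[OF _ A(2) _ v])
        fix k assume k: "k \<in> A"
        have "(\<Sum>i<N-n. w i * unit (\<kappa> i) k) = 0"
          by (rule sum.neutral) (use \<kappa>in(2) k nN in \<open>auto simp: unit_def\<close>)
        then show "Z v k = 0" using eq[of k] k A(1) ss by (intro D_nonzero[of k s]) auto
      qed (use A(1) in auto)
      have "w i = 0" if i: "i < N - n" for i
      proof -
        have "D s' v (\<kappa> i) = 0" unfolding v0 by (simp add: D_def Z_def)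
        moreover have "(\<Sum>l<N-n. w l * unit (\<kappa> l) (\<kappa> i)) = (\<Sum>l<N-n. if l = i then w l else 0)"
          by (rule sum.cong) (use \<kappa>inj i nN in \<open>auto simp: unit_def\<close>)
        ultimately show ?thesis using eq[of "\<kappa> i"] \<kappa>in(1)[of i] i nN by simp
      qed
      then show "v = origin \<and> (\<forall>i<N-n. w i = 0)" using v0 by blast
    qed (use 3 D in auto)
  next
    case (4 s t)
    define other where "other = (\<lambda>x. if x = s then t else s)"
    have o: "other x \<in> S" "other x \<noteq> x" "x' \<noteq> x \<Longrightarrow> x' = other x" if "x \<in> S" "x' \<in> S" for x x'
      using that 4 by (auto simp: other_def)
    have ec: "unit (Suc i) \<in> cspace n" if "i < N - n" for i using that nN by (auto simp: unit_def cspace_def)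
    show ?thesis
    proof (rule normal_crossing_stable[where D = D and \<nu> = "\<lambda>x i. D (other x) (unit (Suc i))", OF nN(1) mg])
      fix x v w assume x: "x \<in> S" and v: "v \<in> cspace n"
        and eq: "\<And>j. j < N \<Longrightarrow> D x v j + (\<Sum>i<N-n. w i * D (other x) (unit (Suc i)) j) = 0"
      define v' where "v' = (\<lambda>l. \<Sum>i<N-n. w i * unit (Suc i) l)"
      have v'c: "v' \<in> cspace n" unfolding cspace_def v'_def
        using nN by (auto simp: unit_def intro!: sum.neutral)
      have "v = origin \<and> v' = origin"
      proof (rule double_point_transverse[OF 4(1) _ _ _ nz[OF x] _ v v'c])
        show "x \<in> cspace n" "other x \<in> cspace n" using S(2) x o(1)[OF x x] by auto
        show "f x = f (other x)" using S(3) x o(1)[OF x x] by simp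
        show "x \<noteq> other x" using o(2)[OF x x] by simp
        show "D x v k + D (other x) v' k = 0" if "k < N" for k using eq[OF that] unfolding v'_def D_sum .
        show "v' 0 = 0" by (simp add: v'_def unit_def)
      qed
      then have v0: "v = origin" and v'0: "v' = origin" by auto
      have "w i = 0" if i: "i < N - n" for i
      proof -
        have "v' (Suc i) = (\<Sum>l<N-n. if l = i then w l else 0)"
          unfolding v'_def by (rule sum.cong) (auto simp: unit_def)
        then show ?thesis using v'0 i by simp
      qed
      then show "v = origin \<and> (\<forall>i<N-n. w i = 0)" using v0 by blast
    next
      fix x x' i assume x: "x \<in> S" "x' \<in> S" "x \<noteq> x'" and i: "i < N - n"
      have "x' = other x" using o(3)[OF x(1,2)] x(3) by simp
      then show "\<exists>v\<in>cspace n. \<forall>j<N. D (other x) (unit (Suc i)) j = D x' v j"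
        using ec[OF i] by (intro bexI[of _ "unit (Suc i)"]) auto
    qed (rule D D_cspace; assumption?)+
  qed
qed

lemma proper_f: "proper_map (top_of_set (cspace n)) (top_of_set (cspace N)) f"
proof (rule proper_map_of_growth[OF continuous_f])
  fix R :: real
  have "cmod (x i) \<le> max R 1" if x: "\<forall>k<N. cmod (f x k) \<le> R" and i: "i < n" for x i
  proof (rule ccontr)
    assume "\<not> ?thesis"
    then have big: "cmod (x i) > R" "cmod (x i) > 1" by auto
    have "cmod (x i) ^ 1 \<le> cmod (x i) ^ m i" using big mpos[OF i] by (intro power_increasing) auto
    also have "\<dots> = cmod (f x i)" using i by (simp add: f_source norm_power)
    also have "\<dots> \<le> R" using x i n1 by simp
    finally show False using big by simp
  qed
  then show "\<exists>R'. \<forall>x\<in>cspace n. (\<forall>k<N. cmod (f x k) \<le> R) \<longrightarrow> (\<forall>i<n. cmod (x i) \<le> R')" by blast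
qed (rule f_in_cspace)

lemma finite_fibre: "finite {x \<in> cspace n. f x = y}"
proof -
  define E where "E = PiE {..<n} (\<lambda>i. {w. w ^ m i = y i})"
  have "finite E" unfolding E_def by (intro finite_PiE) (auto intro: finite_nth_roots mpos)
  moreover have "(\<lambda>x. restrict x {..<n}) ` {x \<in> cspace n. f x = y} \<subseteq> E"
  proof
    fix g assume "g \<in> (\<lambda>x. restrict x {..<n}) ` {x \<in> cspace n. f x = y}"
    then obtain x where x: "x \<in> cspace n" "f x = y" "g = restrict x {..<n}" by blast
    have "x i ^ m i = y i" if "i < n" for i
      using fun_cong[OF x(2), of i] that by (simp add: f_source)
    then show "g \<in> E" using x(3) by (auto simp: E_def)
  qed
  moreover have "inj_on (\<lambda>x. restrict x {..<n}) {x \<in> cspace n. f x = y}"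
  proof (rule inj_onI)
    fix x x' assume x: "x \<in> {x \<in> cspace n. f x = y}" "x' \<in> {x \<in> cspace n. f x = y}"
      and e: "restrict x {..<n} = restrict x' {..<n}"
    show "x = x'"
    proof
      fix i show "x i = x' i"
        using fun_cong[OF e, of i] x by (cases "i < n") (auto simp: cspaceD)
    qed
  qed
  ultimately show ?thesis by (meson finite_imageD finite_subset)
qed

lemma zero_fibre: assumes "x \<in> cspace n" "f x = origin" shows "x = origin"
proof
  fix i show "x i = 0"
  proof (cases "i < n")
    case True
    then have "x i ^ m i = 0" using fun_cong[OF assms(2), of i] by (simp add: f_source)
    then show ?thesis by simp
  qed (use assms(1) in \<open>simp add: cspaceD\<close>)
qed

text \<open>
  The first \<open>n\<close> components are powers of the coordinates. So the map is globally proper and finite, and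
  the preimage of a small ball is small.
\<close>
lemma A_finite_power_map: "A_finite n N f"
  unfolding A_finite_def
proof (intro allI impI)
  fix W assume W: "copen n W \<and> origin \<in> W"
  obtain \<delta> where \<delta>: "\<delta> > 0" "\<And>x. x \<in> cspace n \<Longrightarrow> nrm n (x - origin) < \<delta> \<Longrightarrow> x \<in> W"
    using copen_contains_ball[of n W origin] W by blast
  define \<eta> where "\<eta> = min 1 (\<delta> / n)"
  have \<eta>: "\<eta> > 0" "\<eta> \<le> 1" "n * \<eta> \<le> \<delta>" using \<delta>(1) n1 by (auto simp: \<eta>_def min_def field_simps)
  define \<epsilon> where "\<epsilon> = \<eta> ^ (\<Sum>i<n. m i)"
  have \<epsilon>0: "\<epsilon> > 0" using \<eta> by (simp add: \<epsilon>_def)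
  define V where "V = {y \<in> cspace N. nrm N (y - origin) < \<epsilon>}"
  define U where "U = {x \<in> cspace n. f x \<in> V}"
  have V: "copen N V" unfolding V_def by (rule copen_ball)
  have U: "copen n U" unfolding U_def by (rule holo_map_preimage[OF holo_f V])
  have UW: "U \<subseteq> W"
  proof
    fix x assume "x \<in> U"
    then have x: "x \<in> cspace n" "nrm N (f x - origin) < \<epsilon>" by (auto simp: U_def V_def)
    have small: "cmod (x i) < \<eta>" if i: "i < n" for i
    proof (rule power_less_imp_less_base)
      have "cmod (x i) ^ m i = cmod ((f x - origin) i)" using i by (simp add: f_source norm_power)
      also have "\<dots> \<le> nrm N (f x - origin)" using i n1 by (intro norm_le_nrm) simp
      also have "\<dots> < \<epsilon>" by (rule x(2))
      also have "\<epsilon> \<le> \<eta> ^ m i" unfolding \<epsilon>_def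
        using \<eta> i by (intro power_decreasing member_le_sum) auto
      finally show "cmod (x i) ^ m i < \<eta> ^ m i" .
    qed (use \<eta> in simp)
    have "nrm n (x - origin) < (\<Sum>i<n. \<eta>)"
      unfolding nrm_def
    proof (rule sum_strict_mono)
      have "0 \<in> {..<n}" using n1 by simp
      then show "{..<n} \<noteq> {}" by blast
    qed (use small in auto)
    also have "\<dots> \<le> \<delta>" using \<eta>(3) by simp
    finally show "x \<in> W" using \<delta>(2) x(1) by blast
  qed
  have fibre: "{x \<in> U. f x = y} = {x \<in> cspace n. f x = y}" if "y \<in> V" for y using that by (auto simp: U_def)
  have fin: "finite_representative n N f U V"
    unfolding finite_representative_def
  proof (intro conjI ballI)
    show "holo_map n N U f" by (rule holo_map_subset[OF holo_f U]) (auto simp: U_def)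
    show "copen N V" by (rule V)
    show oV: "origin \<in> V" using \<epsilon>0 by (simp add: V_def)
    show "f ` U \<subseteq> V" by (auto simp: U_def)
    have "proper_map (subtopology (top_of_set (cspace n)) U) (subtopology (top_of_set (cspace N)) V) f"
      by (rule proper_map_restriction[OF proper_f]) (simp add: U_def)
    moreover have "cspace n \<inter> U = U" "cspace N \<inter> V = V" by (auto simp: U_def V_def)
    ultimately show "proper_map (top_of_set U) (top_of_set V) f" by (simp add: subtopology_subtopology)
    show "finite {x \<in> U. f x = y}" if "y \<in> V" for y unfolding fibre[OF that] by (rule finite_fibre)
    show "{x \<in> U. f x = origin} = {origin}"
      unfolding fibre[OF oV] using zero_fibre f_origin by auto
  qed
  show "\<exists>U V. U \<subseteq> W \<and> finite_representative n N f U V \<and>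
      (\<forall>y\<in>V - {origin}. stable_multigerm n N {x \<in> U. f x = y} y f)"
  proof (rule exI[of _ U], rule exI[of _ V], intro conjI ballI UW fin)
    fix y assume y: "y \<in> V - {origin}"
    then have "{x \<in> U. f x = y} = {x \<in> cspace n. f x = y}" using fibre by simp
    moreover have "stable_multigerm n N {x \<in> cspace n. f x = y} y f"
      by (rule stable_fibre) (use finite_fibre y in \<open>auto simp: V_def\<close>)
    ultimately show "stable_multigerm n N {x \<in> U. f x = y} y f" by simp
  qed
qed

end

theorem theorem9p7:
  fixes n :: nat and H :: "rat mat" and m r :: "nat \<Rightarrow> nat"
  assumes "n \<ge> 1"
    and "H \<in> carrier_mat (n - 1) n"
    and "all_submatrices_maximal_rank H"
    and "\<And>i. i < n \<Longrightarrow> m i > 0"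
    and "\<And>j. j < n - 1 \<Longrightarrow> r j > 0"
    and "\<And>i k. i < n \<Longrightarrow> k < n \<Longrightarrow> i \<noteq> k \<Longrightarrow> coprime (m i) (m k)"
    and "\<And>j l. j < n - 1 \<Longrightarrow> l < n - 1 \<Longrightarrow> j \<noteq> l \<Longrightarrow> coprime (r j) (r l)"
    and "\<And>i j. i < n \<Longrightarrow> j < n - 1 \<Longrightarrow> coprime (m i) (r j)"
    and "\<And>j. j < n - 1 \<Longrightarrow> odd (r j)"
  shows "A_finite n (2 * n - 1) (power_map n H m r)"
proof -
  interpret linear_form_powers n H m r by unfold_locales (rule assms; assumption)+
  show ?thesis by (rule A_finite_power_map)
qed

end
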